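(* Let $d\ge2$, $s>0$ and $\beta<\frac{3-d}{4}$. For any $C_*>0$ there exist $f,g\in H^{\frac{d-1}{4}+\beta}(\mathbb R^d)$ such that $$\big\||\square|^{\beta}\big(e^{it\phi_s(D)}f\,\overline{e^{it\phi_s(D)}g}\big)\big\|_{L^2(\mathbb{R}^{d+1})}^2>C_*\,\|\phi_s(D)^{\frac{d-1}{4}+\beta}f\|_{L^2(\mathbb{R}^d)}^2\,\|\phi_s(D)^{\frac{d-1}{4}+\beta}g\|_{L^2(\mathbb{R}^d)}^2.$$
   Context: For $s>0$ and $r\ge0$, $\phi_s(r)=\sqrt{s^2+r^2}$. Spatial Fourier transform: $\widehat f(\xi)=\int_{\mathbb R^d}e^{-ix\cdot\xi}f(x)\,\mathrm dx$. $D=\sqrt{-\Delta_x}$; $\phi_s(D)^\alpha$ is the Fourier multiplier with symbol $\phi_s(|\xi|)^\alpha$; the Klein--Gordon propagator is $e^{it\phi_s(D)}f(x)=(2\pi)^{-d}\int_{\mathbb R^d}e^{i(x\cdot\xi+t\phi_s(|\xi|))}\widehat f(\xi)\,\mathrm d\xi$. The operator $|\square|^\beta$ is the space-time Fourier multiplier with symbol $\big|\tau^2-|\xi|^2\big|^\beta$, $(\tau,\xi)$ dual to $(t,x)\in\mathbb R\times\mathbb R^d$; the left-hand side is understood via Plancherel as an element of $[0,\infty]$. $H^\alpha(\mathbb R^d)$ is the inhomogeneous Sobolev space with norm $\|\phi_1(D)^\alpha f\|_{L^2(\mathbb R^d)}$. *)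

theory Defs
  imports "HOL-Analysis.Analysis"
begin

definition fourier :: "('a::euclidean_space \<Rightarrow> complex) \<Rightarrow> 'a \<Rightarrow> complex" where
  "fourier f \<xi> = (LINT x|lborel. cis (- (x \<bullet> \<xi>)) * f x)"

definition inv_fourier :: "('a::euclidean_space \<Rightarrow> complex) \<Rightarrow> 'a \<Rightarrow> complex" where
  "inv_fourier f x = complex_of_real (1 / (2 * pi) ^ DIM('a)) * (LINT \<xi>|lborel. cis (x \<bullet> \<xi>) * f \<xi>)"


subsection \<open>Schwartz functions and tempered distributions\<close>

fun iter_deriv :: "'a::euclidean_space list \<Rightarrow> ('a \<Rightarrow> complex) \<Rightarrow> 'a \<Rightarrow> complex" where
  "iter_deriv [] f = f"
| "iter_deriv (v # vs) f = (\<lambda>x. frechet_derivative (iter_deriv vs f) (at x) v)"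

definition schwartz :: "('a::euclidean_space \<Rightarrow> complex) set" where
  "schwartz = {f. \<forall>vs. set vs \<subseteq> Basis \<longrightarrow>
     (\<forall>x. iter_deriv vs f differentiable (at x)) \<and>
     (\<forall>k. bounded (range (\<lambda>x. norm x ^ k *\<^sub>R iter_deriv vs f x)))}"

text \<open>A tempered distribution is a functional of which only the values on \<^const>\<open>schwartz\<close> matter.
  Continuity is stated as boundedness by finitely many Schwartz seminorms.\<close>

type_synonym 'a distribution = "('a \<Rightarrow> complex) \<Rightarrow> complex"

definition tempered :: "'a::euclidean_space distribution \<Rightarrow> bool" where
  "tempered T \<longleftrightarrow>
     (\<forall>\<phi>\<in>schwartz. \<forall>\<psi>\<in>schwartz. T (\<lambda>x. \<phi> x + \<psi> x) = T \<phi> + T \<psi>) \<and>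
     (\<forall>c. \<forall>\<phi>\<in>schwartz. T (\<lambda>x. c * \<phi> x) = c * T \<phi>) \<and>
     (\<exists>C N. \<forall>\<phi>\<in>schwartz. \<forall>B.
        (\<forall>vs k x. set vs \<subseteq> Basis \<and> length vs \<le> N \<and> k \<le> N \<longrightarrow>
            norm x ^ k * norm (iter_deriv vs \<phi> x) \<le> B)
        \<longrightarrow> norm (T \<phi>) \<le> C * B)"

definition tempered_fun :: "('a::euclidean_space \<Rightarrow> complex) \<Rightarrow> bool" where
  "tempered_fun f \<longleftrightarrow> f \<in> borel_measurable lborel \<and>
     (\<forall>\<phi>\<in>schwartz. integrable lborel (\<lambda>x. f x * \<phi> x))"

definition distr_of :: "('a::euclidean_space \<Rightarrow> complex) \<Rightarrow> 'a distribution" where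
  "distr_of f = (\<lambda>\<phi>. LINT x|lborel. f x * \<phi> x)"

text \<open>The distribution \<open>T\<close> is the function \<open>f\<close>; such an \<open>f\<close> is unique almost everywhere.\<close>

definition represents :: "('a::euclidean_space \<Rightarrow> complex) \<Rightarrow> 'a distribution \<Rightarrow> bool" where
  "represents f T \<longleftrightarrow> tempered_fun f \<and> (\<forall>\<phi>\<in>schwartz. T \<phi> = distr_of f \<phi>)"

definition fourier_distr :: "'a::euclidean_space distribution \<Rightarrow> 'a distribution" where
  "fourier_distr T = (\<lambda>\<phi>. T (fourier \<phi>))"

text \<open>The multiplier with symbol \<open>m\<close> is \<open>T \<mapsto> F\<^sup>-\<^sup>1 (m F T)\<close>, transposed onto the test function.
  This is meaningful for smooth \<open>m\<close> with polynomially bounded derivatives, such as the symbols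
  \<open>\<phi>\<^sub>s(\<bar>\<xi>\<bar>)\<^sup>\<alpha>\<close> and \<open>exp (i t \<phi>\<^sub>s(\<bar>\<xi>\<bar>))\<close> with \<open>s > 0\<close> below, since \<open>m\<close> then preserves
  \<^const>\<open>schwartz\<close>.\<close>

definition fourier_multiplier ::
    "('a::euclidean_space \<Rightarrow> complex) \<Rightarrow> 'a distribution \<Rightarrow> 'a distribution" where
  "fourier_multiplier m T = (\<lambda>\<phi>. T (fourier (\<lambda>\<xi>. m \<xi> * inv_fourier \<phi> \<xi>)))"

text \<open>The squared norm is \<open>\<infinity>\<close> (infimum of the empty set) if \<open>T\<close> is not a function.\<close>

definition L2_norm_sq :: "'a::euclidean_space distribution \<Rightarrow> ennreal" where
  "L2_norm_sq T = (INF h\<in>{h. represents h T}. \<integral>\<^sup>+x. ennreal ((norm (h x))\<^sup>2) \<partial>lborel)"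


subsection \<open>Sobolev spaces and the Klein--Gordon propagator\<close>

definition kg_phi :: "real \<Rightarrow> real \<Rightarrow> real" where
  "kg_phi s r = sqrt (s\<^sup>2 + r\<^sup>2)"

definition kg_phi_pow :: "real \<Rightarrow> real \<Rightarrow> 'a::euclidean_space distribution \<Rightarrow> 'a distribution" where
  "kg_phi_pow s \<alpha> = fourier_multiplier (\<lambda>\<xi>. complex_of_real (kg_phi s (norm \<xi>) powr \<alpha>))"

definition sobolev :: "real \<Rightarrow> 'a::euclidean_space distribution set" where
  "sobolev \<alpha> = {f. tempered f \<and> L2_norm_sq (kg_phi_pow 1 \<alpha> f) < \<infinity>}"

definition kg_propagator ::
    "real \<Rightarrow> real \<Rightarrow> 'a::euclidean_space distribution \<Rightarrow> 'a distribution" where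
  "kg_propagator s t = fourier_multiplier (\<lambda>\<xi>. cis (t * kg_phi s (norm \<xi>)))"

text \<open>The space-time function \<open>u\<close> is \<open>(t, x) \<mapsto> (exp (i t \<phi>\<^sub>s(D)) f)(x)\<close>; it is unique almost
  everywhere. It exists for every \<open>f\<close> in \<open>L\<^sup>2\<close>, whereas for general \<open>f\<close> in a Sobolev space of
  negative order the propagated distributions need not be functions and cannot be multiplied.\<close>

definition kg_wave ::
    "real \<Rightarrow> 'a::euclidean_space distribution \<Rightarrow> (real \<times> 'a \<Rightarrow> complex) \<Rightarrow> bool" where
  "kg_wave s f u \<longleftrightarrow> u \<in> borel_measurable lborel \<and>
     (\<forall>t. represents (\<lambda>x. u (t, x)) (kg_propagator s t f))"

text \<open>The squared \<open>L\<^sup>2\<close> norm of \<open>\<bar>\<box>\<bar>\<^sup>\<beta> W\<close>, in the sense of Plancherel on space-time of dimension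
  \<open>d + 1\<close>. The supremum only selects the almost everywhere unique function \<open>G\<close> that is the Fourier
  transform of \<open>W\<close>. For a \<open>W\<close> without such a \<open>G\<close> the value is 0, so that no such \<open>W\<close> can witness
  a lower bound.\<close>

definition box_norm_sq :: "real \<Rightarrow> (real \<times> 'a::euclidean_space \<Rightarrow> complex) \<Rightarrow> ennreal" where
  "box_norm_sq \<beta> W =
     (SUP G\<in>{G. tempered_fun W \<and> represents G (fourier_distr (distr_of W))}.
        ennreal (1 / (2 * pi) ^ (DIM('a) + 1)) *
        (\<integral>\<^sup>+(\<tau>, \<xi>). ennreal ((\<bar>\<tau>\<^sup>2 - (norm \<xi>)\<^sup>2\<bar> powr \<beta> * norm (G (\<tau>, \<xi>)))\<^sup>2) \<partial>lborel))"

end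

theory Submission
  imports Defs "HOL-Probability.Characteristic_Functions" "HOL-Probability.Sinc_Integral"
begin

text \<open>Let the Fourier transforms \<open>F\<close> and \<open>H\<close> of \<open>f\<close> and \<open>g\<close> be tents of height \<open>L\<close> centred at \<open>3 L e\<^sub>1 \<plusminus> 2 e\<^sub>2\<close>, of
  width \<open>L\<close> in direction \<open>e\<^sub>1\<close> and of width \<open>1\<close> in all others. The space-time Fourier transform of the product
  is the density of the image of \<open>F(\<eta>) H(\<zeta>) d\<eta> d\<zeta>\<close> under
  \<open>(\<eta>, \<zeta>) \<mapsto> (\<phi>\<^sub>s(\<bar>\<eta>\<bar>) - \<phi>\<^sub>s(\<bar>\<zeta>\<bar>), \<eta> - \<zeta>)\<close>. Since the waves are nearly parallel, it lives on a set of
  volume \<open>O(1)\<close>, where the symbol \<open>\<bar>\<tau>\<^sup>2 - \<bar>\<xi>\<bar>\<^sup>2\<bar>\<close> is bounded above and, by the opposite signs in direction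
  \<open>e\<^sub>2\<close>, also below. As its total mass is of order \<open>L\<^sup>4\<close>, the left-hand side is at least of order \<open>L\<^sup>8\<close> by
  the Cauchy--Schwarz inequality, whereas the right-hand side is of order \<open>L\<^bsup>6 + 4\<alpha>\<^esup>\<close> with
  \<open>\<alpha> = (d - 1)/4 + \<beta> < 1/2\<close>.\<close>

subsection \<open>Integration over Euclidean spaces\<close>

text \<open>The density itself is never computed. Only its total mass and a set that carries it
  enter, and Radon-Nikodym supplies it once the image measure is known to be absolutely continuous;
  the separation in direction e_2 that bounds the symbol below gives this as well. The carrying set
  has length of order L along e_1, but for each momentum its energy is confined to an interval of
  length O(1/L), since phi_s(|eta|) differs from the e_1 component of eta by O(1/L); this is where L
  cancels from the volume. Both bounds on the symbol are called for because beta may have either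
  sign when d = 2. Each tent has mass of order L^2; a squared weighted norm is L^(2 alpha) times the
  squared height L^2 times the volume L. Tents are used because f and g are then integrable
  functions whose transforms are continuous, nonnegative and compactly supported: the distributions
  in the definitions become absolutely convergent integrals, and the Fourier analysis reduces to
  inversion for integrable functions, a Plancherel upper bound and the decay of transforms of test
  functions.\<close>

lemma lborel_integrable_affine:
  fixes f :: "'a::euclidean_space \<Rightarrow> 'b::{banach, second_countable_topology}"
  assumes "c \<noteq> 0" "integrable lborel f"
  shows "integrable lborel (\<lambda>x. f (t + c *\<^sub>R x))"
proof -
  have [measurable]: "f \<in> borel_measurable borel" using assms(2) by auto
  have "integrable (density (distr lborel borel (\<lambda>x. t + c *\<^sub>R x)) (\<lambda>_. \<bar>c\<bar>^DIM('a))) f"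
    using assms(2) lborel_affine[OF assms(1), of t] by simp
  then have "integrable lborel (\<lambda>x. \<bar>c\<bar>^DIM('a) *\<^sub>R f (t + c *\<^sub>R x))"
    by (subst (asm) integrable_density) (simp_all add: integrable_distr_eq)
  then have "integrable lborel (\<lambda>x. inverse (\<bar>c\<bar>^DIM('a)) *\<^sub>R (\<bar>c\<bar>^DIM('a) *\<^sub>R f (t + c *\<^sub>R x)))"
    by (rule integrable_scaleR_right)
  then show ?thesis
    using assms(1) by simp
qed

lemma lborel_integral_affine:
  fixes f :: "'a::euclidean_space \<Rightarrow> 'b::{banach, second_countable_topology}"
  assumes "c \<noteq> 0" "f \<in> borel_measurable borel"
  shows "(LINT x|lborel. f x) = \<bar>c\<bar>^DIM('a) *\<^sub>R (LINT x|lborel. f (t + c *\<^sub>R x))"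
proof -
  note [measurable] = assms(2)
  show ?thesis
    by (subst lborel_affine[OF assms(1), of t], subst integral_density) (auto simp: integral_distr)
qed

lemma lborel_nn_integral_affine:
  fixes f :: "'a::euclidean_space \<Rightarrow> ennreal"
  assumes "c \<noteq> 0" "f \<in> borel_measurable borel"
  shows "(\<integral>\<^sup>+x. f x \<partial>lborel) = ennreal (\<bar>c\<bar>^DIM('a)) * (\<integral>\<^sup>+x. f (t + c *\<^sub>R x) \<partial>lborel)"
proof -
  note [measurable] = assms(2)
  show ?thesis
    by (subst lborel_affine[OF assms(1), of t], subst nn_integral_density)
       (auto simp: nn_integral_distr nn_integral_cmult ennreal_power)
qed

text \<open>Serves two separable integrands: the Gaussian, and the majorant in
  \<open>integrable_decay\<close>.\<close>

lemma lborel_integrable_prod: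
  fixes f :: "'a::euclidean_space \<Rightarrow> real \<Rightarrow> 'b::{real_normed_field, banach, second_countable_topology}"
  assumes "\<And>b. b \<in> Basis \<Longrightarrow> integrable lborel (f b)"
  shows "integrable lborel (\<lambda>x::'a. \<Prod>b\<in>Basis. f b (x \<bullet> b))"
proof -
  interpret product_sigma_finite "\<lambda>_::'a. lborel :: real measure" ..
  have [measurable]: "b \<in> Basis \<Longrightarrow> f b \<in> borel_measurable borel" for b
    using assms[of b] by auto
  have "integrable (\<Pi>\<^sub>M b\<in>(Basis::'a set). lborel) (\<lambda>x. \<Prod>b\<in>Basis. f b (x b))"
    using assms by (intro product_integrable_prod) auto
  then show ?thesis
    by (subst lborel_eq, subst integrable_distr_eq) (auto cong: prod.cong)
qed

lemma lborel_integral_prod: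
  fixes f :: "'a::euclidean_space \<Rightarrow> real \<Rightarrow> 'b::{real_normed_field, banach, second_countable_topology}"
  assumes "\<And>b. b \<in> Basis \<Longrightarrow> integrable lborel (f b)"
  shows "(LINT x|lborel. (\<Prod>b\<in>Basis. f b ((x::'a) \<bullet> b))) = (\<Prod>b\<in>Basis. LINT y|lborel. f b y)"
proof -
  interpret product_sigma_finite "\<lambda>_::'a. lborel :: real measure" ..
  have [measurable]: "b \<in> Basis \<Longrightarrow> f b \<in> borel_measurable borel" for b
    using assms[of b] by auto
  show ?thesis
    by (subst lborel_eq, subst integral_distr)
       (auto intro!: product_integral_prod assms cong: prod.cong)
qed

subsection \<open>Gaussians\<close>

lemma cis_sum: "finite A \<Longrightarrow> cis (\<Sum>b\<in>A. f b) = (\<Prod>b\<in>A. cis (f b))"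
  by (induction rule: finite_induct) (auto simp: cis_mult[symmetric])

lemma measurable_cis [measurable]: "cis \<in> borel_measurable borel"
  by (intro borel_measurable_continuous_onI continuous_intros)

text \<open>Unit variance, so that the function is its own Fourier transform up to the factor
  \<open>sqrt (2 * pi) ^ DIM('a)\<close> and matches the standard normal density.\<close>

definition gauss :: "'a::euclidean_space \<Rightarrow> real" where
  "gauss x = exp (- (norm x)\<^sup>2 / 2)"

lemma gauss_prod: "gauss (x::'a::euclidean_space) = (\<Prod>b\<in>Basis. exp (- (x \<bullet> b)\<^sup>2 / 2))"
  unfolding gauss_def
  by (subst exp_sum[symmetric], simp, subst power2_norm_eq_inner, subst euclidean_inner)
     (simp add: sum_negf sum_divide_distrib[symmetric] power2_eq_square)

lemma continuous_gauss [continuous_intros]: "continuous_on A gauss"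
  unfolding gauss_def by (intro continuous_intros) auto

lemma measurable_gauss [measurable]: "gauss \<in> borel_measurable borel"
  by (intro borel_measurable_continuous_onI continuous_intros)

lemma gauss_pos: "gauss x > 0" and gauss_le_1: "gauss x \<le> 1" and gauss_0 [simp]: "gauss 0 = 1"
  by (auto simp: gauss_def)

text \<open>The integral is the characteristic function of the standard normal distribution, with
  the normalising factor of the density moved to the right-hand side.\<close>

lemma has_integral_gauss_1D:
  "has_bochner_integral lborel (\<lambda>x. cis (t * x) * exp (- x\<^sup>2 / 2)) (complex_of_real (sqrt (2 * pi) * exp (- t\<^sup>2 / 2)))"
proof -
  interpret real_distribution std_normal_distribution
    by (rule real_dist_normal_dist)
  have i: "integrable std_normal_distribution (\<lambda>x. cis (t * x))"
    by (rule integrable_const_bound[where B=1]) auto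
  have "char std_normal_distribution t = (LINT x|std_normal_distribution. cis (t * x))"
    by (simp add: char_def cis_conv_exp)
  then have "(LINT x|std_normal_distribution. cis (t * x)) = complex_of_real (exp (- t\<^sup>2 / 2))"
    by (simp add: char_std_normal_distribution)
  with i have "has_bochner_integral lborel (\<lambda>x. std_normal_density x *\<^sub>R cis (t * x)) (complex_of_real (exp (- t\<^sup>2 / 2)))"
    by (simp add: has_bochner_integral_iff integrable_density integral_density)
  then have "has_bochner_integral lborel (\<lambda>x. complex_of_real (sqrt (2*pi)) * (std_normal_density x *\<^sub>R cis (t * x)))
      (complex_of_real (sqrt (2*pi)) * complex_of_real (exp (- t\<^sup>2 / 2)))"
    by (rule has_bochner_integral_mult_right)
  then show ?thesis
    by (simp add: std_normal_density_def scaleR_conv_of_real mult_ac)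
qed

lemma has_integral_gauss:
  "has_bochner_integral lborel (\<lambda>x::'a::euclidean_space. cis (x \<bullet> \<xi>) * gauss x)
     (complex_of_real (sqrt (2 * pi) ^ DIM('a) * gauss \<xi>))"
proof -
  have eq: "cis (x \<bullet> \<xi>) * gauss x = (\<Prod>b\<in>Basis. cis ((\<xi> \<bullet> b) * (x \<bullet> b)) * exp (- (x \<bullet> b)\<^sup>2 / 2))" for x :: 'a
    by (subst euclidean_inner) (simp add: cis_sum gauss_prod prod.distrib mult.commute)
  note 1 = has_integral_gauss_1D[unfolded has_bochner_integral_iff, THEN conjunct1]
    has_integral_gauss_1D[unfolded has_bochner_integral_iff, THEN conjunct2]
  show ?thesis
    unfolding has_bochner_integral_iff eq
  proof
    show "(LINT x|lborel. (\<Prod>b\<in>Basis. cis ((\<xi> \<bullet> b) * ((x::'a) \<bullet> b)) * exp (- (x \<bullet> b)\<^sup>2 / 2))) =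
        complex_of_real (sqrt (2 * pi) ^ DIM('a) * gauss \<xi>)"
      by (subst lborel_integral_prod[OF 1(1)]) (simp only: 1(2), simp add: gauss_prod[of \<xi>] prod.distrib)
  qed (intro lborel_integrable_prod 1)
qed

lemma integrable_gauss: "integrable lborel (gauss :: 'a::euclidean_space \<Rightarrow> real)"
  and integral_gauss: "(LINT x|lborel. gauss (x::'a)) = sqrt (2 * pi) ^ DIM('a)"
proof -
  have h: "has_bochner_integral lborel (\<lambda>x::'a. complex_of_real (gauss x)) (complex_of_real (sqrt (2 * pi) ^ DIM('a)))"
    using has_integral_gauss[of "0::'a"] by simp
  then have "has_bochner_integral lborel (\<lambda>x::'a. Re (complex_of_real (gauss x))) (Re (complex_of_real (sqrt (2 * pi) ^ DIM('a))))"
    by (rule has_bochner_integral_Re)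
  then have "has_bochner_integral lborel (gauss :: 'a \<Rightarrow> real) (sqrt (2 * pi) ^ DIM('a))" by simp
  then show "integrable lborel (gauss :: 'a \<Rightarrow> real)" "(LINT x|lborel. gauss (x::'a)) = sqrt (2 * pi) ^ DIM('a)"
    by (auto simp: has_bochner_integral_iff)
qed

lemma has_integral_gauss_scaled:
  assumes "\<delta> > 0"
  shows "has_bochner_integral lborel (\<lambda>x::'a::euclidean_space. cis (x \<bullet> \<xi>) * gauss (\<delta> *\<^sub>R x))
     (complex_of_real ((sqrt (2 * pi) / \<delta>) ^ DIM('a) * gauss (\<xi> /\<^sub>R \<delta>)))"
proof -
  let ?f = "\<lambda>x::'a. cis (x \<bullet> (\<xi> /\<^sub>R \<delta>)) * complex_of_real (gauss x)"
  have h: "integrable lborel ?f" "(LINT x|lborel. ?f x) = complex_of_real (sqrt (2 * pi) ^ DIM('a) * gauss (\<xi> /\<^sub>R \<delta>))"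
    using has_integral_gauss[of "\<xi> /\<^sub>R \<delta>"] by (auto simp: has_bochner_integral_iff)
  have "integrable lborel (\<lambda>x. ?f (0 + \<delta> *\<^sub>R x))"
    using assms by (intro lborel_integrable_affine h) auto
  moreover have "(LINT x|lborel. ?f x) = \<bar>\<delta>\<bar>^DIM('a) *\<^sub>R (LINT x|lborel. ?f (0 + \<delta> *\<^sub>R x))"
    using assms h by (intro lborel_integral_affine) auto
  ultimately show ?thesis
    using assms unfolding h
    by (auto simp: has_bochner_integral_iff scaleR_conv_of_real field_simps power_divide)
qed

subsection \<open>Fourier inversion and the Plancherel inequality\<close>

lemma measurable_cnj [measurable]: "cnj \<in> borel_measurable borel"
  by (intro borel_measurable_continuous_onI continuous_intros)

lemma integrable_cis_mult:
  assumes "integrable M f" "g \<in> borel_measurable M"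
  shows "integrable M (\<lambda>x. cis (g x) * f x)"
  by (rule Bochner_Integration.integrable_bound[OF assms(1)])
     (use assms borel_measurable_integrable[OF assms(1)] in \<open>auto simp: norm_mult\<close>)

text \<open>The Fubini hypothesis for interchanges of integrals with an oscillating factor
  \<open>b\<close>: the tensor product of the two integrable functions dominates.\<close>

lemma integrable_pair_bounded:
  fixes f :: "'a::euclidean_space \<Rightarrow> complex" and k :: "'b::euclidean_space \<Rightarrow> complex"
  assumes f: "integrable lborel f" and k: "integrable lborel k"
    and b [measurable]: "b \<in> borel_measurable borel" and b1: "\<And>p. norm (b p) \<le> 1"
  shows "integrable (lborel \<Otimes>\<^sub>M lborel) (\<lambda>(x, y). f x * k y * b (x, y))"
proof -
  have [measurable]: "f \<in> borel_measurable borel" "k \<in> borel_measurable borel"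
    using f k by auto
  have b' [measurable]: "b \<in> borel_measurable (borel \<Otimes>\<^sub>M borel)"
    by (simp add: borel_prod)
  have 0: "integrable (lborel \<Otimes>\<^sub>M lborel) (\<lambda>(x, y). f x * k y)"
    by (rule lborel_pair.Fubini_integrable) (use f k in \<open>auto simp: norm_mult\<close>)
  show ?thesis
    by (rule Bochner_Integration.integrable_bound[OF 0])
       (auto simp: norm_mult intro!: AE_I2 mult_left_le b1)
qed

lemma inv_fourier_eq_fourier:
  "inv_fourier (f::'a::euclidean_space \<Rightarrow> complex) x = fourier f (- x) / (2 * pi) ^ DIM('a)"
  by (simp add: fourier_def inv_fourier_def inner_commute)

lemma norm_fourier_le:
  assumes "integrable lborel f"
  shows "norm (fourier f \<xi>) \<le> (LINT x|lborel. norm (f x))"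
  unfolding fourier_def
  by (rule order_trans[OF integral_norm_bound]) (simp add: norm_mult)

lemma norm_inv_fourier_le:
  assumes "integrable lborel (f::'a::euclidean_space \<Rightarrow> complex)"
  shows "norm (inv_fourier f \<xi>) \<le> (LINT x|lborel. norm (f x)) / (2 * pi) ^ DIM('a)"
  unfolding inv_fourier_eq_fourier
  using norm_fourier_le[OF assms, of "- \<xi>"] by (simp add: norm_divide norm_mult norm_power divide_right_mono)

lemma continuous_fourier:
  assumes "integrable lborel f"
  shows "continuous_on UNIV (fourier f)"
proof -
  have [measurable]: "f \<in> borel_measurable borel" using assms by auto
  have "isCont (fourier f) \<xi>" for \<xi>
    unfolding continuous_at_sequentially o_def fourier_def
  proof safe
    fix X :: "nat \<Rightarrow> 'a" assume X: "X \<longlonglongrightarrow> \<xi>"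
    show "(\<lambda>n. LINT x|lborel. cis (- (x \<bullet> X n)) * f x) \<longlonglongrightarrow> (LINT x|lborel. cis (- (x \<bullet> \<xi>)) * f x)"
    proof (rule integral_dominated_convergence[where w="\<lambda>x. norm (f x)"])
      show "AE x in lborel. (\<lambda>n. cis (- (x \<bullet> X n)) * f x) \<longlonglongrightarrow> cis (- (x \<bullet> \<xi>)) * f x"
        by (auto intro!: tendsto_intros X)
    qed (use assms in \<open>auto simp: norm_mult\<close>)
  qed
  then show ?thesis by (simp add: continuous_on_eq_continuous_at)
qed

lemma continuous_inv_fourier:
  assumes "integrable lborel f"
  shows "continuous_on UNIV (inv_fourier f)"
  unfolding inv_fourier_eq_fourier[abs_def]
  by (intro continuous_intros continuous_on_compose2[OF continuous_fourier[OF assms]]) auto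

lemma measurable_fourier_transforms [measurable]:
  "integrable lborel f \<Longrightarrow> inv_fourier f \<in> borel_measurable borel"
  "integrable lborel f \<Longrightarrow> fourier f \<in> borel_measurable borel"
  using continuous_inv_fourier[of f] continuous_fourier[of f] by (auto intro: borel_measurable_continuous_onI)

text \<open>The multiplication formula, by Fubini. It moves a Fourier transform from a test function
  to an integrable function.\<close>

lemma integral_mult_fourier:
  fixes f k :: "'a::euclidean_space \<Rightarrow> complex"
  assumes f: "integrable lborel f" and k: "integrable lborel k"
  shows "(LINT x|lborel. f x * fourier k x) = (LINT \<xi>|lborel. fourier f \<xi> * k \<xi>)"
proof -
  let ?h = "\<lambda>x \<xi>. f x * k \<xi> * cis (- (x \<bullet> \<xi>))"
  have "integrable (lborel \<Otimes>\<^sub>M lborel) (\<lambda>(x, \<xi>). ?h x \<xi>)"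
    using integrable_pair_bounded[OF f k, of "\<lambda>(x, \<xi>). cis (- (x \<bullet> \<xi>))"]
    by (simp add: borel_prod[symmetric] split_beta)
  from lborel_pair.Fubini_integral[OF this]
  have "(LINT x|lborel. (LINT \<xi>|lborel. ?h x \<xi>)) = (LINT \<xi>|lborel. (LINT x|lborel. ?h x \<xi>))" by simp
  moreover have "(LINT \<xi>|lborel. ?h x \<xi>) = f x * fourier k x" for x
    unfolding fourier_def by (subst integral_mult_right_zero[symmetric]) (simp add: mult_ac inner_commute)
  moreover have "(LINT x|lborel. ?h x \<xi>) = fourier f \<xi> * k \<xi>" for \<xi>
    unfolding fourier_def by (subst integral_mult_left_zero[symmetric]) (simp add: mult_ac)
  ultimately show ?thesis by simp
qed

text \<open>Without the Gaussian factor the double integral behind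
  \<open>fourier (inv_fourier F)\<close> does not converge absolutely. With it, Fubini leaves the
  transform of a Gaussian of width 1/\<delta>, that is, an average of \<open>F\<close> over
  distances of order \<delta> around \<xi>.\<close>

lemma fourier_gauss_mult_inv_fourier:
  fixes F :: "'a::euclidean_space \<Rightarrow> complex"
  assumes F: "integrable lborel F" and \<delta>: "\<delta> > 0"
  shows "fourier (\<lambda>x. inv_fourier F x * gauss (\<delta> *\<^sub>R x)) \<xi> =
    (sqrt (2 * pi) / \<delta>) ^ DIM('a) / (2 * pi) ^ DIM('a) * (LINT \<eta>|lborel. F \<eta> * gauss ((\<eta> - \<xi>) /\<^sub>R \<delta>))"
proof -
  let ?h = "\<lambda>x \<eta>. complex_of_real (gauss (\<delta> *\<^sub>R x)) * F \<eta> * (cis (- (x \<bullet> \<xi>)) * cis (x \<bullet> \<eta>))"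
  have g: "integrable lborel (\<lambda>x::'a. complex_of_real (gauss (\<delta> *\<^sub>R x)))"
    using lborel_integrable_affine[of \<delta> "\<lambda>x::'a. complex_of_real (gauss x)" 0] \<delta> integrable_gauss by auto
  have "integrable (lborel \<Otimes>\<^sub>M lborel) (\<lambda>(x, \<eta>). ?h x \<eta>)"
    using integrable_pair_bounded[OF g F, of "\<lambda>(x, \<eta>). cis (- (x \<bullet> \<xi>)) * cis (x \<bullet> \<eta>)"]
    by (simp add: borel_prod[symmetric] split_beta norm_mult)
  from lborel_pair.Fubini_integral[OF this]
  have "(LINT x|lborel. (LINT \<eta>|lborel. ?h x \<eta>)) = (LINT \<eta>|lborel. (LINT x|lborel. ?h x \<eta>))" by simp
  moreover have "(LINT \<eta>|lborel. ?h x \<eta>) =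
      (2 * pi) ^ DIM('a) * (cis (- (x \<bullet> \<xi>)) * (inv_fourier F x * gauss (\<delta> *\<^sub>R x)))" for x
  proof -
    have "(LINT \<eta>|lborel. ?h x \<eta>) = (LINT \<eta>|lborel. complex_of_real (gauss (\<delta> *\<^sub>R x)) * cis (- (x \<bullet> \<xi>)) * (cis (x \<bullet> \<eta>) * F \<eta>))"
      by (simp add: mult_ac)
    then show ?thesis by (simp add: inv_fourier_def)
  qed
  moreover have "(LINT x|lborel. ?h x \<eta>) = (sqrt (2 * pi) / \<delta>) ^ DIM('a) * (F \<eta> * gauss ((\<eta> - \<xi>) /\<^sub>R \<delta>))" for \<eta>
  proof -
    have "(LINT x|lborel. ?h x \<eta>) = (LINT x|lborel. F \<eta> * (cis (x \<bullet> (\<eta> - \<xi>)) * gauss (\<delta> *\<^sub>R x)))"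
      by (simp add: mult_ac cis_mult inner_diff_right)
    also have "\<dots> = F \<eta> * (complex_of_real ((sqrt (2 * pi) / \<delta>) ^ DIM('a) * gauss ((\<eta> - \<xi>) /\<^sub>R \<delta>)))"
      using has_integral_gauss_scaled[OF \<delta>, of "\<eta> - \<xi>"] by (simp add: has_bochner_integral_iff)
    finally show ?thesis by simp
  qed
  ultimately have "(2 * pi) ^ DIM('a) * (LINT x|lborel. cis (- (x \<bullet> \<xi>)) * (inv_fourier F x * gauss (\<delta> *\<^sub>R x))) =
      (sqrt (2 * pi) / \<delta>) ^ DIM('a) * (LINT \<eta>|lborel. F \<eta> * gauss ((\<eta> - \<xi>) /\<^sub>R \<delta>))"
    by (simp only: integral_mult_right_zero)
  moreover have "A = K / a * B" if "a * A = K * B" "a \<noteq> 0" for a A K B :: complex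
    using that by (simp add: field_simps)
  ultimately show ?thesis
    unfolding fourier_def of_real_divide by simp
qed

text \<open>Let \<delta> tend to 0 in the regularised identity. The left-hand side converges because
  \<open>inv_fourier F\<close> is integrable; the right-hand side, after the substitution \<eta> =
  \<xi> + \<delta> z, because \<open>F\<close> is continuous and bounded.\<close>

theorem fourier_inv_fourier:
  fixes F :: "'a::euclidean_space \<Rightarrow> complex"
  assumes F: "integrable lborel F" and c: "continuous_on UNIV F" and B: "\<And>x. norm (F x) \<le> B"
    and i: "integrable lborel (inv_fourier F)"
  shows "fourier (inv_fourier F) \<xi> = F \<xi>"
proof -
  define \<delta> :: "nat \<Rightarrow> real" where "\<delta> n = inverse (real (Suc n))" for n
  have \<delta>: "\<delta> \<longlonglongrightarrow> 0" "\<delta> n > 0" for n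
    unfolding \<delta>_def by (rule LIMSEQ_inverse_real_of_nat) simp
  have cF: "isCont F x" for x using c by (simp add: continuous_on_eq_continuous_at)
  have cg: "isCont gauss (x::'a)" for x using continuous_gauss[of "UNIV :: 'a set"] by (simp add: continuous_on_eq_continuous_at)
  note [measurable] = measurable_fourier_transforms(1)[OF F]
  have [measurable]: "F \<in> borel_measurable borel" using F by auto
  have "(\<lambda>n. LINT x|lborel. cis (- (x \<bullet> \<xi>)) * (inv_fourier F x * gauss (\<delta> n *\<^sub>R x))) \<longlonglongrightarrow>
      (LINT x|lborel. cis (- (x \<bullet> \<xi>)) * inv_fourier F x)"
  proof (rule integral_dominated_convergence[where w="\<lambda>x. norm (inv_fourier F x)"])
    show "AE x in lborel. (\<lambda>n. cis (- (x \<bullet> \<xi>)) * (inv_fourier F x * gauss (\<delta> n *\<^sub>R x))) \<longlonglongrightarrow> cis (- (x \<bullet> \<xi>)) * inv_fourier F x"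
    proof (rule AE_I2)
      fix x :: 'a
      have "(\<lambda>n. \<delta> n *\<^sub>R x) \<longlonglongrightarrow> 0 *\<^sub>R x" by (intro tendsto_intros \<delta>)
      then have "(\<lambda>n. gauss (\<delta> n *\<^sub>R x)) \<longlonglongrightarrow> gauss (0 *\<^sub>R x)" by (intro isCont_tendsto_compose[OF cg])
      then have "(\<lambda>n. cis (- (x \<bullet> \<xi>)) * (inv_fourier F x * gauss (\<delta> n *\<^sub>R x))) \<longlonglongrightarrow> cis (- (x \<bullet> \<xi>)) * (inv_fourier F x * complex_of_real (gauss (0 *\<^sub>R x)))"
        by (intro tendsto_intros)
      then show "(\<lambda>n. cis (- (x \<bullet> \<xi>)) * (inv_fourier F x * gauss (\<delta> n *\<^sub>R x))) \<longlonglongrightarrow> cis (- (x \<bullet> \<xi>)) * inv_fourier F x"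
        by simp
    qed
  qed (use i in \<open>auto simp: norm_mult less_imp_le[OF gauss_pos] intro!: mult_left_le gauss_le_1\<close>)
  then have 1: "(\<lambda>n. fourier (\<lambda>x. inv_fourier F x * gauss (\<delta> n *\<^sub>R x)) \<xi>) \<longlonglongrightarrow> fourier (inv_fourier F) \<xi>"
    by (simp add: fourier_def)
  have "(\<lambda>n. LINT z|lborel. F (\<xi> + \<delta> n *\<^sub>R z) * gauss z) \<longlonglongrightarrow> (LINT z|lborel. F \<xi> * gauss (z::'a))"
  proof (rule integral_dominated_convergence[where w="\<lambda>x::'a. B * gauss x"])
    show "AE z in lborel. (\<lambda>n. F (\<xi> + \<delta> n *\<^sub>R z) * gauss z) \<longlonglongrightarrow> F \<xi> * gauss z"
    proof (rule AE_I2)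
      fix z :: 'a
      have "(\<lambda>n. \<xi> + \<delta> n *\<^sub>R z) \<longlonglongrightarrow> \<xi> + 0 *\<^sub>R z" by (intro tendsto_intros \<delta>)
      then show "(\<lambda>n. F (\<xi> + \<delta> n *\<^sub>R z) * gauss z) \<longlonglongrightarrow> F \<xi> * gauss z"
        by (intro tendsto_intros isCont_tendsto_compose[OF cF]) simp
    qed
  qed (use integrable_gauss B in \<open>auto simp: norm_mult less_imp_le[OF gauss_pos] intro!: mult_right_mono\<close>)
  also have "(LINT z|lborel. F \<xi> * gauss (z::'a)) = F \<xi> * sqrt (2 * pi) ^ DIM('a)"
    by (simp add: integral_gauss)
  finally have 2: "(\<lambda>n. (sqrt (2 * pi) ^ DIM('a) / (2 * pi) ^ DIM('a)) * (LINT z|lborel. F (\<xi> + \<delta> n *\<^sub>R z) * gauss z))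
     \<longlonglongrightarrow> complex_of_real (sqrt (2 * pi) ^ DIM('a) / (2 * pi) ^ DIM('a)) * (F \<xi> * sqrt (2 * pi) ^ DIM('a))"
    by (intro tendsto_intros) simp
  \<comment> \<open>One power of \<open>sqrt (2 * pi)\<close> comes from the transform of the
    Gaussian, the other from its mass; together they cancel the normalisation of
    \<open>inv_fourier\<close>.\<close>
  have "complex_of_real (sqrt (2 * pi) ^ DIM('a) / (2 * pi) ^ DIM('a)) * (F \<xi> * sqrt (2 * pi) ^ DIM('a)) =
     F \<xi> * complex_of_real ((sqrt (2 * pi) * sqrt (2 * pi)) ^ DIM('a) / (2 * pi) ^ DIM('a))"
    unfolding power_mult_distrib by (simp add: mult_ac)
  also have "\<dots> = F \<xi>" by simp
  finally have 3: "complex_of_real (sqrt (2 * pi) ^ DIM('a) / (2 * pi) ^ DIM('a)) * (F \<xi> * sqrt (2 * pi) ^ DIM('a)) = F \<xi>" .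
  have "fourier (\<lambda>x. inv_fourier F x * gauss (\<delta> n *\<^sub>R x)) \<xi> =
     complex_of_real (sqrt (2 * pi) ^ DIM('a) / (2 * pi) ^ DIM('a)) * (LINT z|lborel. F (\<xi> + \<delta> n *\<^sub>R z) * gauss z)" for n
    by (subst fourier_gauss_mult_inv_fourier[OF F \<delta>(2)], subst lborel_integral_affine[of "\<delta> n" _ \<xi>])
       (use \<delta>(2)[of n] in \<open>auto simp: scaleR_conv_of_real power_divide\<close>)
  with 2 3 have "(\<lambda>n. fourier (\<lambda>x. inv_fourier F x * gauss (\<delta> n *\<^sub>R x)) \<xi>) \<longlonglongrightarrow> F \<xi>" by simp
  with 1 show ?thesis by (rule LIMSEQ_unique)
qed

text \<open>A reflection exchanges the two transforms up to the normalising factor, so this is the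
  inversion theorem read with the substitution y -> -y.\<close>

corollary inv_fourier_fourier:
  fixes F :: "'a::euclidean_space \<Rightarrow> complex"
  assumes F: "integrable lborel F" and c: "continuous_on UNIV F" and B: "\<And>x. norm (F x) \<le> B"
    and i: "integrable lborel (fourier F)"
  shows "inv_fourier (fourier F) x = F x"
proof -
  have eq: "inv_fourier F = (\<lambda>x. fourier F (- x) / (2 * pi) ^ DIM('a))"
    by (simp add: inv_fourier_eq_fourier fun_eq_iff)
  have [measurable]: "fourier F \<in> borel_measurable borel" using i by auto
  have "integrable lborel (\<lambda>x. fourier F (0 + (-1) *\<^sub>R x))"
    by (rule lborel_integrable_affine) (use i in auto)
  then have "integrable lborel (inv_fourier F)" unfolding eq by auto
  from fourier_inv_fourier[OF F c B this, of x]
  have "F x = fourier (\<lambda>x. fourier F (- x) / (2 * pi) ^ DIM('a)) x" unfolding eq by simp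
  also have "\<dots> = (LINT y|lborel. cis (- (y \<bullet> x)) * fourier F (- y)) / (2 * pi) ^ DIM('a)"
    by (simp add: fourier_def)
  also have "(LINT y|lborel. cis (- (y \<bullet> x)) * fourier F (- y)) = (LINT y|lborel. cis (y \<bullet> x) * fourier F y)"
    by (subst (2) lborel_integral_affine[of "-1" _ 0]) auto
  finally show ?thesis by (simp add: inv_fourier_def inner_commute)
qed

text \<open>With a Gaussian weight the left-hand side becomes c^2 times the double integral of
  F(\<eta>) times the conjugate of F(\<zeta>) against an even kernel of mass 1/c, where c = (2
  pi)^(-d). The Schur test bounds this by c times the squared norm of \<open>F\<close>, uniformly in
  the weight, and Fatou removes the weight.\<close>

theorem nn_integral_inv_fourier_le:
  fixes F :: "'a::euclidean_space \<Rightarrow> complex"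
  assumes F: "integrable lborel F"
  shows "(\<integral>\<^sup>+x. ennreal ((norm (inv_fourier F x))\<^sup>2) \<partial>lborel)
    \<le> ennreal (1 / (2 * pi) ^ DIM('a)) * (\<integral>\<^sup>+\<xi>. ennreal ((norm (F \<xi>))\<^sup>2) \<partial>lborel)" (is "_ \<le> ?R")
proof -
  define c where "c = 1 / (2 * pi) ^ DIM('a)"
  have c: "c \<ge> 0" by (simp add: c_def)
  define \<delta> :: "nat \<Rightarrow> real" where "\<delta> n = inverse (real (Suc n))" for n
  have \<delta>: "\<delta> \<longlonglongrightarrow> 0" "\<delta> n > 0" for n
    unfolding \<delta>_def by (rule LIMSEQ_inverse_real_of_nat) simp
  have cg: "isCont gauss (x::'a)" for x using continuous_gauss[of "UNIV :: 'a set"] by (simp add: continuous_on_eq_continuous_at)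
  have [measurable]: "F \<in> borel_measurable borel" using F by auto
  note [measurable] = measurable_fourier_transforms(1)[OF F]
  have bd: "(\<integral>\<^sup>+x. ennreal ((norm (inv_fourier F x))\<^sup>2 * gauss (d *\<^sub>R x)) \<partial>lborel) \<le> ?R" if d: "d > 0" for d
  proof -
    define k where "k x = inv_fourier F x * gauss (d *\<^sub>R x)" for x
    define \<Gamma> where "\<Gamma> y = (sqrt (2 * pi) / d) ^ DIM('a) * gauss (y /\<^sub>R d)" for y :: 'a
    have \<Gamma>0: "\<Gamma> y \<ge> 0" for y using d by (simp add: \<Gamma>_def gauss_pos less_imp_le)
    have [measurable]: "\<Gamma> \<in> borel_measurable borel" unfolding \<Gamma>_def by measurable
    have g: "integrable lborel (\<lambda>x::'a. gauss (d *\<^sub>R x))"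
      using lborel_integrable_affine[of d "gauss::'a\<Rightarrow>real" 0] d integrable_gauss by auto
    have k: "integrable lborel k"
    proof (rule Bochner_Integration.integrable_bound[OF integrable_mult_right[OF g]])
      show "AE x in lborel. norm (k x) \<le> norm ((LINT x|lborel. norm (F x)) / (2 * pi) ^ DIM('a) * gauss (d *\<^sub>R x))"
        unfolding k_def using norm_inv_fourier_le[OF F]
        by (intro AE_I2) (auto simp: norm_mult abs_mult less_imp_le[OF gauss_pos] simp del: times_divide_eq_left
            intro!: mult_right_mono order_trans[OF _ abs_ge_self])
    qed (unfold k_def, measurable)
    have [measurable]: "k \<in> borel_measurable borel" using k by auto
    note [measurable] = measurable_fourier_transforms(2)[OF k]
    have kk: "integrable lborel (\<lambda>x. k x * cnj (inv_fourier F x))"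
    proof (rule Bochner_Integration.integrable_bound[OF integrable_mult_right[OF k]])
      show "AE x in lborel. norm (k x * cnj (inv_fourier F x)) \<le> norm (complex_of_real ((LINT x|lborel. norm (F x)) / (2 * pi) ^ DIM('a)) * k x)"
        unfolding norm_mult complex_mod_cnj norm_of_real mult.commute[of "norm (k _)"]
        by (intro AE_I2 mult_right_mono order_trans[OF norm_inv_fourier_le[OF F] abs_ge_self]) auto
    qed measurable
    have eq: "k x * cnj (inv_fourier F x) = complex_of_real ((norm (inv_fourier F x))\<^sup>2 * gauss (d *\<^sub>R x))" for x
      unfolding k_def of_real_mult complex_norm_square by (simp only: mult_ac)
    have i2: "integrable lborel (\<lambda>x. (norm (inv_fourier F x))\<^sup>2 * gauss (d *\<^sub>R x))"
      using kk[unfolded eq] unfolding complex_of_real_integrable_eq .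
    \<comment> \<open>Written as a Fourier transform, the conjugate can be handled by the
      multiplication formula, which moves the transform onto \<open>k\<close>.\<close>
    have cF: "cnj (inv_fourier F x) = c * fourier (\<lambda>\<xi>. cnj (F \<xi>)) x" for x
    proof -
      have "cnj (LINT \<xi>|lborel. cis (x \<bullet> \<xi>) * F \<xi>) = (LINT \<xi>|lborel. cnj (cis (x \<bullet> \<xi>) * F \<xi>))"
        by (rule Bochner_Integration.integral_cnj[symmetric])
      also have "\<dots> = fourier (\<lambda>\<xi>. cnj (F \<xi>)) x"
        unfolding fourier_def
        by (intro Bochner_Integration.integral_cong refl) (simp add: cis_cnj inner_commute)
      finally show ?thesis by (simp add: inv_fourier_def c_def)
    qed
    have "complex_of_real (LINT x|lborel. (norm (inv_fourier F x))\<^sup>2 * gauss (d *\<^sub>R x)) = (LINT x|lborel. k x * cnj (inv_fourier F x))"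
      unfolding eq by (rule integral_complex_of_real[symmetric])
    also have "\<dots> = c * (LINT x|lborel. k x * fourier (\<lambda>\<xi>. cnj (F \<xi>)) x)"
      unfolding cF mult.left_commute[of _ "complex_of_real c"] by (rule integral_mult_right_zero)
    also have "\<dots> = c * (LINT \<zeta>|lborel. fourier k \<zeta> * cnj (F \<zeta>))"
      by (subst integral_mult_fourier[OF k]) (use F in auto)
    finally have I: "complex_of_real (LINT x|lborel. (norm (inv_fourier F x))\<^sup>2 * gauss (d *\<^sub>R x)) = c * (LINT \<zeta>|lborel. fourier k \<zeta> * cnj (F \<zeta>))" .
    have fk: "ennreal (norm (fourier k \<zeta>)) \<le> ennreal c * (\<integral>\<^sup>+\<eta>. ennreal (norm (F \<eta>) * \<Gamma> (\<eta> - \<zeta>)) \<partial>lborel)" for \<zeta>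
    proof -
      have "fourier k \<zeta> = c * (LINT \<eta>|lborel. F \<eta> * \<Gamma> (\<eta> - \<zeta>))"
        unfolding k_def \<Gamma>_def c_def
        by (subst fourier_gauss_mult_inv_fourier[OF F d], simp, subst mult.left_commute, subst integral_mult_right_zero, simp)
      then have "ennreal (norm (fourier k \<zeta>)) = ennreal c * ennreal (norm (LINT \<eta>|lborel. F \<eta> * \<Gamma> (\<eta> - \<zeta>)))"
        using c by (simp add: norm_mult ennreal_mult)
      also have "\<dots> \<le> ennreal c * (\<integral>\<^sup>+\<eta>. ennreal (norm (F \<eta> * \<Gamma> (\<eta> - \<zeta>))) \<partial>lborel)"
        by (intro mult_left_mono integral_norm_bound_ennreal Bochner_Integration.integrable_bound[OF integrable_mult_right[OF F, of "complex_of_real ((sqrt (2 * pi) / d) ^ DIM('a))"]])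
           (use d in \<open>auto simp: \<Gamma>_def norm_mult norm_divide norm_power abs_mult less_imp_le[OF gauss_pos] mult.commute intro!: mult_left_mono mult_left_le gauss_le_1\<close>)
      finally show ?thesis using \<Gamma>0 by (simp add: norm_mult)
    qed
    \<comment> \<open>The mass of \<open>\<Gamma>\<close> does not depend on \<open>d\<close>; this
      makes the final bound uniform in the weight.\<close>
    have \<Gamma>i: "(\<integral>\<^sup>+\<eta>. ennreal (\<Gamma> (\<eta> - \<zeta>)) \<partial>lborel) = ennreal (1 / c)" for \<zeta>
    proof -
      have "(\<integral>\<^sup>+\<eta>. ennreal (\<Gamma> (\<eta> - \<zeta>)) \<partial>lborel) = ennreal (d ^ DIM('a)) * (\<integral>\<^sup>+z. ennreal ((sqrt (2 * pi) / d) ^ DIM('a)) * ennreal (gauss (z::'a)) \<partial>lborel)"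
        by (subst lborel_nn_integral_affine[of d _ \<zeta>]) (use d in \<open>auto simp: \<Gamma>_def ennreal_mult less_imp_le[OF gauss_pos]\<close>)
      also have "\<dots> = ennreal (d ^ DIM('a)) * (ennreal ((sqrt (2 * pi) / d) ^ DIM('a)) * ennreal (sqrt (2*pi) ^ DIM('a)))"
        using integrable_gauss[where 'a='a] integral_gauss[where 'a='a]
        by (subst nn_integral_cmult) (auto simp: nn_integral_eq_integral less_imp_le[OF gauss_pos])
      also have "\<dots> = ennreal ((sqrt (2 * pi) * sqrt (2 * pi)) ^ DIM('a))"
      proof -
        have "d ^ DIM('a) * ((sqrt (2 * pi) / d) ^ DIM('a) * sqrt (2*pi) ^ DIM('a)) = (sqrt (2 * pi) * sqrt (2 * pi)) ^ DIM('a)"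
          unfolding power_divide power_mult_distrib using d by simp
        then show ?thesis
          using d by (simp only: ennreal_mult[symmetric] zero_le_power divide_nonneg_pos real_sqrt_ge_zero
             mult_nonneg_nonneg less_imp_le pi_gt_zero zero_le_numeral)
      qed
      also have "\<dots> = ennreal (1 / c)" by (simp add: c_def)
      finally show ?thesis .
    qed
    have \<Gamma>sym: "\<Gamma> (\<eta> - \<zeta>) = \<Gamma> (\<zeta> - \<eta>)" for \<eta> \<zeta> by (simp add: \<Gamma>_def gauss_def norm_minus_commute)
    let ?N = "\<integral>\<^sup>+\<xi>. ennreal ((norm (F \<xi>))\<^sup>2) \<partial>lborel"
    have half: "(\<integral>\<^sup>+\<zeta>. (\<integral>\<^sup>+\<eta>. ennreal ((norm (F \<zeta>))\<^sup>2) * ennreal (\<Gamma> (\<eta> - \<zeta>)) \<partial>lborel) \<partial>lborel) = ?N * ennreal (1 / c)"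
      by (simp add: nn_integral_cmult \<Gamma>i nn_integral_multc)
    have half2: "(\<integral>\<^sup>+\<zeta>. (\<integral>\<^sup>+\<eta>. ennreal ((norm (F \<eta>))\<^sup>2) * ennreal (\<Gamma> (\<eta> - \<zeta>)) \<partial>lborel) \<partial>lborel) = ?N * ennreal (1 / c)"
      by (subst lborel_pair.Fubini', measurable, subst \<Gamma>sym, rule half)
    have "(\<integral>\<^sup>+x. ennreal ((norm (inv_fourier F x))\<^sup>2 * gauss (d *\<^sub>R x)) \<partial>lborel) = ennreal (LINT x|lborel. (norm (inv_fourier F x))\<^sup>2 * gauss (d *\<^sub>R x))"
      by (rule nn_integral_eq_integral[OF i2]) (auto simp: less_imp_le[OF gauss_pos])
    also have "\<dots> \<le> ennreal (norm (complex_of_real (LINT x|lborel. (norm (inv_fourier F x))\<^sup>2 * gauss (d *\<^sub>R x))))"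
      by (intro ennreal_leI) simp
    also have "\<dots> = ennreal c * ennreal (norm (LINT \<zeta>|lborel. fourier k \<zeta> * cnj (F \<zeta>)))"
      unfolding I using c by (simp add: norm_mult ennreal_mult)
    also have "\<dots> \<le> ennreal c * (\<integral>\<^sup>+\<zeta>. ennreal (norm (fourier k \<zeta> * cnj (F \<zeta>))) \<partial>lborel)"
    proof (intro mult_left_mono integral_norm_bound_ennreal)
      show "integrable lborel (\<lambda>\<zeta>. fourier k \<zeta> * cnj (F \<zeta>))"
        by (rule Bochner_Integration.integrable_bound[OF integrable_mult_right[OF F, of "complex_of_real (LINT x|lborel. norm (k x))"]])
           (use norm_fourier_le[OF k] in \<open>auto simp: norm_mult intro!: mult_right_mono order_trans[OF _ abs_ge_self]\<close>)
    qed auto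
    also have "\<dots> \<le> ennreal c * (\<integral>\<^sup>+\<zeta>. (ennreal c * (\<integral>\<^sup>+\<eta>. ennreal (norm (F \<eta>) * \<Gamma> (\<eta> - \<zeta>)) \<partial>lborel)) * ennreal (norm (F \<zeta>)) \<partial>lborel)"
      by (intro mult_left_mono nn_integral_mono) (auto simp: norm_mult ennreal_mult intro!: mult_right_mono fk)
    also have "\<dots> = ennreal c * ennreal c * (\<integral>\<^sup>+\<zeta>. (\<integral>\<^sup>+\<eta>. ennreal (norm (F \<eta>) * norm (F \<zeta>) * \<Gamma> (\<eta> - \<zeta>)) \<partial>lborel) \<partial>lborel)"
      using \<Gamma>0 by (simp add: nn_integral_multc nn_integral_cmult ennreal_mult mult_ac flip: nn_integral_multc nn_integral_cmult)
    \<comment> \<open>Schur test: 2ab <= a^2 + b^2 splits the product, and by the symmetry of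
      \<open>\<Gamma>\<close> each half integrates to \<open>?N * ennreal (1 / c)\<close>.\<close>
    also have "\<dots> \<le> ennreal c * ennreal c * (\<integral>\<^sup>+\<zeta>. (\<integral>\<^sup>+\<eta>. ennreal (1/2) * (ennreal ((norm (F \<zeta>))\<^sup>2) * ennreal (\<Gamma> (\<eta> - \<zeta>)) + ennreal ((norm (F \<eta>))\<^sup>2) * ennreal (\<Gamma> (\<eta> - \<zeta>))) \<partial>lborel) \<partial>lborel)"
    proof (intro mult_left_mono nn_integral_mono)
      fix \<zeta> \<eta>
      have "2 * (norm (F \<eta>) * norm (F \<zeta>)) \<le> (norm (F \<zeta>))\<^sup>2 + (norm (F \<eta>))\<^sup>2"
        using sum_squares_bound[of "norm (F \<eta>)" "norm (F \<zeta>)"] by (simp add: mult_ac)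
      then have "norm (F \<eta>) * norm (F \<zeta>) * \<Gamma> (\<eta> - \<zeta>) \<le> (1/2 * ((norm (F \<zeta>))\<^sup>2 + (norm (F \<eta>))\<^sup>2)) * \<Gamma> (\<eta> - \<zeta>)"
        using \<Gamma>0 by (intro mult_right_mono) auto
      also have "\<dots> = 1/2 * ((norm (F \<zeta>))\<^sup>2 * \<Gamma> (\<eta> - \<zeta>) + (norm (F \<eta>))\<^sup>2 * \<Gamma> (\<eta> - \<zeta>))"
        by (simp add: algebra_simps)
      finally have *: "norm (F \<eta>) * norm (F \<zeta>) * \<Gamma> (\<eta> - \<zeta>) \<le> 1/2 * ((norm (F \<zeta>))\<^sup>2 * \<Gamma> (\<eta> - \<zeta>) + (norm (F \<eta>))\<^sup>2 * \<Gamma> (\<eta> - \<zeta>))" .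
      show "ennreal (norm (F \<eta>) * norm (F \<zeta>) * \<Gamma> (\<eta> - \<zeta>)) \<le> ennreal (1/2) * (ennreal ((norm (F \<zeta>))\<^sup>2) * ennreal (\<Gamma> (\<eta> - \<zeta>)) + ennreal ((norm (F \<eta>))\<^sup>2) * ennreal (\<Gamma> (\<eta> - \<zeta>)))"
      proof -
        have "ennreal (h * (a * g + b * g)) = ennreal h * (ennreal a * ennreal g + ennreal b * ennreal g)"
          if "h \<ge> 0" "a \<ge> 0" "b \<ge> 0" "g \<ge> 0" for a b g h :: real
          using that by (simp add: ennreal_mult)
        from this[of "1/2" "(norm (F \<zeta>))\<^sup>2" "(norm (F \<eta>))\<^sup>2" "\<Gamma> (\<eta> - \<zeta>)"] \<Gamma>0 show ?thesis
          using ennreal_leI[OF *] by (simp only: zero_le_power2 zero_le_divide_1_iff zero_le_numeral)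
      qed
    qed auto
    also have "\<dots> = ennreal c * ennreal c * (ennreal (1/2) * (?N * ennreal (1 / c) + ?N * ennreal (1 / c)))"
      by (simp add: nn_integral_cmult nn_integral_add nn_integral_multc \<Gamma>i half2 del: ennreal_half)
    also have "ennreal (1/2) * (?N * ennreal (1 / c) + ?N * ennreal (1 / c)) = (ennreal (1/2) * ennreal 2) * (?N * ennreal (1/c))"
      by (simp add: mult_2[symmetric] mult.assoc del: ennreal_half)
    also have "ennreal (1/2) * ennreal 2 = 1" by (subst ennreal_mult[symmetric]) auto
    also have "ennreal c * ennreal c * (1 * (?N * ennreal (1/c))) = ennreal c * ?N * (ennreal c * ennreal (1/c))"
      by (simp add: mult_ac)
    also have "ennreal c * ennreal (1/c) = 1"
      by (subst ennreal_mult[symmetric]) (auto simp: c_def)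
    finally show ?thesis by (simp add: c_def)
  qed
  \<comment> \<open>The weights tend to 1 pointwise, so Fatou's lemma carries the uniform bound to
    the limit.\<close>
  have "(\<integral>\<^sup>+x. ennreal ((norm (inv_fourier F x))\<^sup>2) \<partial>lborel) =
     (\<integral>\<^sup>+x. liminf (\<lambda>n. ennreal ((norm (inv_fourier F x))\<^sup>2 * gauss (\<delta> n *\<^sub>R x))) \<partial>lborel)"
  proof (intro nn_integral_cong lim_imp_Liminf[symmetric])
    fix x :: 'a
    have "(\<lambda>n. \<delta> n *\<^sub>R x) \<longlonglongrightarrow> 0 *\<^sub>R x" by (intro tendsto_intros \<delta>)
    then have "(\<lambda>n. gauss (\<delta> n *\<^sub>R x)) \<longlonglongrightarrow> gauss (0 *\<^sub>R x)" by (intro isCont_tendsto_compose[OF cg])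
    then have "(\<lambda>n. ennreal ((norm (inv_fourier F x))\<^sup>2 * gauss (\<delta> n *\<^sub>R x))) \<longlonglongrightarrow> ennreal ((norm (inv_fourier F x))\<^sup>2 * gauss (0 *\<^sub>R x))"
      by (intro tendsto_intros)
    then show "(\<lambda>n. ennreal ((norm (inv_fourier F x))\<^sup>2 * gauss (\<delta> n *\<^sub>R x))) \<longlonglongrightarrow> ennreal ((norm (inv_fourier F x))\<^sup>2)"
      by simp
  qed auto
  also have "\<dots> \<le> liminf (\<lambda>n. \<integral>\<^sup>+x. ennreal ((norm (inv_fourier F x))\<^sup>2 * gauss (\<delta> n *\<^sub>R x)) \<partial>lborel)"
    by (rule nn_integral_liminf) auto
  also have "\<dots> \<le> limsup (\<lambda>n. \<integral>\<^sup>+x. ennreal ((norm (inv_fourier F x))\<^sup>2 * gauss (\<delta> n *\<^sub>R x)) \<partial>lborel)"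
    by (rule Liminf_le_Limsup) simp
  also have "\<dots> \<le> ?R"
    by (intro Limsup_bounded always_eventually allI bd \<delta>)
  finally show ?thesis .
qed

subsection \<open>Schwartz functions\<close>

text \<open>Each one-dimensional factor 1 / (1 + x_b^2) is at least 1 / (1 + |x|^2), so decay of
  order \<open>DIM('a)\<close> is dominated by the integrable product of these factors.\<close>

lemma integrable_decay:
  fixes g :: "'a::euclidean_space \<Rightarrow> complex"
  assumes [measurable]: "g \<in> borel_measurable borel"
    and K: "\<And>x. norm (g x) * (1 + (norm x)\<^sup>2) ^ DIM('a) \<le> K"
  shows "integrable lborel g"
proof -
  have "integrable lborel (\<lambda>x. inverse (1 + x\<^sup>2 :: real))"
    using integrable_inverse_1_plus_square by (simp add: set_integrable_def)
  then have "integrable lborel (\<lambda>x::'a. \<Prod>b\<in>Basis. inverse (1 + (x \<bullet> b)\<^sup>2))"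
    by (intro lborel_integrable_prod)
  then have i: "integrable lborel (\<lambda>x::'a. K * (\<Prod>b\<in>Basis. inverse (1 + (x \<bullet> b)\<^sup>2)))" by simp
  show ?thesis
  proof (rule Bochner_Integration.integrable_bound[OF i])
    show "AE x in lborel. norm (g x) \<le> norm (K * (\<Prod>b\<in>Basis. inverse (1 + (x \<bullet> b)\<^sup>2)))"
    proof (rule AE_I2)
      fix x :: 'a
      have le: "(\<Prod>b\<in>Basis. 1 + (x \<bullet> b)\<^sup>2) \<le> (1 + (norm x)\<^sup>2) ^ DIM('a)"
      proof -
        have "1 + (x \<bullet> b)\<^sup>2 \<le> 1 + (norm x)\<^sup>2" if "b \<in> Basis" for b
          using Basis_le_norm[OF that, of x] by (simp add: abs_le_square_iff[symmetric])
        then have "(\<Prod>b\<in>Basis. 1 + (x \<bullet> b)\<^sup>2) \<le> (\<Prod>b\<in>(Basis::'a set). 1 + (norm x)\<^sup>2)"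
          by (intro prod_mono) auto
        then show ?thesis by simp
      qed
      have pos: "(\<Prod>b\<in>Basis. 1 + (x \<bullet> b)\<^sup>2) > 0" by (intro prod_pos) (auto intro: add_pos_nonneg)
      have "norm (g x) * (\<Prod>b\<in>Basis. 1 + (x \<bullet> b)\<^sup>2) \<le> K"
        using mult_left_mono[OF le norm_ge_zero[of "g x"]] K[of x] by linarith
      then have "norm (g x) \<le> K / (\<Prod>b\<in>Basis. 1 + (x \<bullet> b)\<^sup>2)" using pos by (simp add: field_simps)
      also have "\<dots> = K * (\<Prod>b\<in>Basis. inverse (1 + (x \<bullet> b)\<^sup>2))"
        by (subst prod_inversef[unfolded o_def]) (simp add: divide_inverse)
      finally show "norm (g x) \<le> norm (K * (\<Prod>b\<in>Basis. inverse (1 + (x \<bullet> b)\<^sup>2)))" by simp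
    qed
  qed simp
qed

lemma schwartz_differentiable:
  assumes "\<phi> \<in> schwartz" "set vs \<subseteq> Basis"
  shows "iter_deriv vs \<phi> differentiable (at x)"
  using assms by (auto simp: schwartz_def)

lemma schwartz_continuous:
  assumes "\<phi> \<in> schwartz" "set vs \<subseteq> Basis"
  shows "continuous_on UNIV (iter_deriv vs \<phi>)"
  using schwartz_differentiable[OF assms]
  by (simp add: continuous_on_eq_continuous_at differentiable_imp_continuous_within)

lemma one_plus_power_le: "(1 + t) ^ N \<le> 2 ^ N * (1 + t ^ N)" if "t \<ge> 0" for t :: real
proof (cases "t \<le> 1")
  case True
  then have "(1 + t) ^ N \<le> 2 ^ N * 1" using that by (simp add: power_mono)
  also have "\<dots> \<le> 2 ^ N * (1 + t ^ N)" using that by (intro mult_left_mono) auto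
  finally show ?thesis .
next
  case False
  then have "(1 + t) ^ N \<le> (2 * t) ^ N" using that by (intro power_mono) auto
  also have "\<dots> \<le> 2 ^ N * (1 + t ^ N)" using that by (simp add: power_mult_distrib)
  finally show ?thesis .
qed

text \<open>The seminorms with weights of degree 0 and 2N suffice, since (1 + t)^N <= 2^N (1 +
  t^N).\<close>

lemma schwartz_decay:
  assumes "\<phi> \<in> schwartz" "set vs \<subseteq> Basis"
  obtains K where "K \<ge> 0" "\<And>x. norm (iter_deriv vs \<phi> x) * (1 + (norm x)\<^sup>2) ^ N \<le> K"
proof -
  have "\<exists>B. \<forall>x. norm (norm x ^ k *\<^sub>R iter_deriv vs \<phi> x) \<le> B" for k
    using assms unfolding schwartz_def bounded_iff by auto
  then obtain B where B: "\<And>k x. norm x ^ k * norm (iter_deriv vs \<phi> x) \<le> B k"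
    unfolding norm_scaleR by (metis abs_norm_cancel power_abs)
  have b: "norm (iter_deriv vs \<phi> x) * (1 + (norm x)\<^sup>2) ^ N \<le> 2 ^ N * (B 0 + B (2 * N))" for x
  proof -
    have "norm (iter_deriv vs \<phi> x) * (1 + (norm x)\<^sup>2) ^ N \<le> norm (iter_deriv vs \<phi> x) * (2 ^ N * (1 + ((norm x)\<^sup>2) ^ N))"
      by (intro mult_left_mono one_plus_power_le) auto
    also have "\<dots> = 2 ^ N * (norm x ^ 0 * norm (iter_deriv vs \<phi> x) + norm x ^ (2 * N) * norm (iter_deriv vs \<phi> x))"
      by (simp add: algebra_simps flip: power_mult)
    also have "\<dots> \<le> 2 ^ N * (B 0 + B (2 * N))"
      by (intro mult_left_mono add_mono B) auto
    finally show ?thesis .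
  qed
  moreover have "0 \<le> 2 ^ N * (B 0 + B (2 * N))"
    by (rule order_trans[OF _ b[of 0]]) auto
  ultimately show ?thesis using that by blast
qed

lemma integrable_schwartz_deriv:
  fixes \<phi> :: "'a::euclidean_space \<Rightarrow> complex"
  assumes "\<phi> \<in> schwartz" "set vs \<subseteq> Basis"
  shows "integrable lborel (iter_deriv vs \<phi>)"
proof -
  obtain K where "\<And>x. norm (iter_deriv vs \<phi> x) * (1 + (norm x)\<^sup>2) ^ DIM('a) \<le> K"
    using schwartz_decay[OF assms] by metis
  then show ?thesis
    by (rule integrable_decay[rotated]) (intro borel_measurable_continuous_onI schwartz_continuous assms)
qed

lemmas integrable_schwartz = integrable_schwartz_deriv[where vs="[]", simplified]
lemmas continuous_schwartz = schwartz_continuous[where vs="[]", simplified]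

lemma measurable_schwartz: "\<phi> \<in> schwartz \<Longrightarrow> \<phi> \<in> borel_measurable borel"
  by (intro borel_measurable_continuous_onI continuous_schwartz)

lemma bounded_schwartz:
  assumes "\<phi> \<in> schwartz"
  obtains B where "\<And>x. norm (\<phi> x) \<le> B"
  using schwartz_decay[OF assms, of "[]" 0] by auto

section \<open>Decay of the Fourier transform of a Schwartz function\<close>

lemma has_vector_derivative_quotient:
  assumes "(f has_vector_derivative y) (at 0)"
  shows "((\<lambda>\<theta>. (f \<theta> - f 0) /\<^sub>R \<theta>) \<longlongrightarrow> y) (at 0)"
proof -
  have "((\<lambda>\<theta>. norm (f (0 + \<theta>) - f 0 - \<theta> *\<^sub>R y) / norm \<theta>) \<longlongrightarrow> 0) (at 0)"
    using assms unfolding has_vector_derivative_def has_derivative_at by simp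
  moreover have "eventually (\<lambda>\<theta>. norm (f (0 + \<theta>) - f 0 - \<theta> *\<^sub>R y) / norm \<theta> = norm ((f \<theta> - f 0) /\<^sub>R \<theta> - y)) (at 0)"
    unfolding eventually_at_filter
  proof (intro always_eventually allI impI)
    fix \<theta> :: real assume "\<theta> \<noteq> 0"
    then have "(f \<theta> - f 0) /\<^sub>R \<theta> - y = (f \<theta> - f 0 - \<theta> *\<^sub>R y) /\<^sub>R \<theta>"
      by (simp add: scaleR_diff_right)
    then show "norm (f (0 + \<theta>) - f 0 - \<theta> *\<^sub>R y) / norm \<theta> = norm ((f \<theta> - f 0) /\<^sub>R \<theta> - y)"
      by (simp add: divide_inverse)
  qed
  ultimately have "((\<lambda>\<theta>. norm ((f \<theta> - f 0) /\<^sub>R \<theta> - y)) \<longlongrightarrow> 0) (at 0)"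
    by (rule Lim_transform_eventually)
  then show ?thesis
    by (simp only: tendsto_norm_zero_iff LIM_zero_iff)
qed

text \<open>In place of an integration by parts, the difference quotient in direction
  \<open>b\<close> is transformed: a translation by h b multiplies the transform by
  \<open>cis (h * (\<xi> \<bullet> b))\<close>, and dominated convergence handles the limit under
  the integral.\<close>

lemma fourier_deriv_schwartz:
  fixes \<phi> :: "'a::euclidean_space \<Rightarrow> complex"
  assumes \<phi>: "\<phi> \<in> schwartz" "set vs \<subseteq> Basis" and b: "b \<in> Basis"
  shows "fourier (iter_deriv (b # vs) \<phi>) \<xi> = \<i> * (\<xi> \<bullet> b) * fourier (iter_deriv vs \<phi>) \<xi>"
proof -
  define g where "g = iter_deriv vs \<phi>"
  define g' where "g' = iter_deriv (b # vs) \<phi>"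
  have vs': "set (b # vs) \<subseteq> Basis" using \<phi> b by simp
  have gd: "(g has_derivative frechet_derivative g (at x)) (at x)" for x
    using schwartz_differentiable[OF \<phi>, of x] unfolding g_def by (simp add: frechet_derivative_works)
  have g': "g' x = frechet_derivative g (at x) b" for x by (simp add: g'_def g_def)
  have line: "((\<lambda>\<theta>. g (x + \<theta> *\<^sub>R b)) has_derivative (\<lambda>r. r *\<^sub>R g' (x + \<theta> *\<^sub>R b))) (at \<theta>)" for x \<theta>
  proof -
    have "((\<lambda>\<theta>. g (x + \<theta> *\<^sub>R b)) has_derivative (\<lambda>r. frechet_derivative g (at (x + \<theta> *\<^sub>R b)) (r *\<^sub>R b))) (at \<theta>)"
      by (rule has_derivative_compose[OF _ gd]) (auto intro!: derivative_eq_intros)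
    then show ?thesis
      using linear_frechet_derivative[OF schwartz_differentiable[OF \<phi>, folded g_def]]
      by (simp add: g' linear_scale)
  qed
  have gi: "integrable lborel g" unfolding g_def by (rule integrable_schwartz_deriv[OF \<phi>])
  have g'i: "integrable lborel g'" unfolding g'_def by (rule integrable_schwartz_deriv[OF \<phi>(1) vs'])
  have [measurable]: "g \<in> borel_measurable borel" "g' \<in> borel_measurable borel" using gi g'i by auto
  obtain K where K0: "K \<ge> 0" and K: "\<And>x. norm (g' x) * (1 + (norm x)\<^sup>2) ^ DIM('a) \<le> K"
    using schwartz_decay[OF \<phi>(1) vs', of "DIM('a)"] unfolding g'_def by metis
  \<comment> \<open>A majorant for the derivative on the unit ball around x: if |y - x| <= 1 then 1
    + |x|^2 <= 3 (1 + |y|^2), whence the factor \<open>3 ^ DIM('a)\<close>. It is complex-valued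
    only to fit \<open>integrable_decay\<close>.\<close>
  define w where "w x = complex_of_real (3 ^ DIM('a) * K / (1 + (norm x)\<^sup>2) ^ DIM('a))" for x :: 'a
  have wi: "integrable lborel w"
  proof (rule integrable_decay)
    show "norm (w x) * (1 + (norm x)\<^sup>2) ^ DIM('a) \<le> 3 ^ DIM('a) * K" for x
    proof -
      have "(1 + (norm x)\<^sup>2) ^ DIM('a) > 0" by (intro zero_less_power add_pos_nonneg) auto
      then show ?thesis using K0 by (simp add: w_def norm_divide norm_mult norm_power del: of_real_power of_real_add of_real_mult of_real_divide)
    qed
  qed (unfold w_def, measurable)
  have near: "norm (g' y) \<le> norm (w x)" if "norm (y - x) \<le> 1" for x y
  proof -
    have p: "1 + (norm z)\<^sup>2 > 0" for z :: 'a by (intro add_pos_nonneg) auto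
    have "norm x \<le> norm y + 1" using that norm_triangle_sub[of x y] by (simp add: norm_minus_commute)
    then have "(norm x)\<^sup>2 \<le> (norm y + 1)\<^sup>2" by (intro power_mono) auto
    moreover have "2 * norm y \<le> 1 + (norm y)\<^sup>2" using sum_squares_bound[of 1 "norm y"] by simp
    ultimately have "(norm x)\<^sup>2 \<le> 2 + 2 * (norm y)\<^sup>2" by (simp add: power2_sum)
    moreover have "0 \<le> (norm y)\<^sup>2" by simp
    moreover have "1 + t \<le> 3 * (1 + u)" if "t \<le> 2 + 2 * u" "0 \<le> u" for t u :: real
      using that by simp
    ultimately have "1 + (norm x)\<^sup>2 \<le> 3 * (1 + (norm y)\<^sup>2)" by blast
    then have "(1 + (norm x)\<^sup>2) ^ DIM('a) \<le> 3 ^ DIM('a) * (1 + (norm y)\<^sup>2) ^ DIM('a)"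
      unfolding power_mult_distrib[symmetric] by (intro power_mono) auto
    then have "norm (g' y) * (1 + (norm x)\<^sup>2) ^ DIM('a) \<le> 3 ^ DIM('a) * (norm (g' y) * (1 + (norm y)\<^sup>2) ^ DIM('a))"
      by (subst mult.left_commute) (intro mult_left_mono norm_ge_zero)
    also have "\<dots> \<le> 3 ^ DIM('a) * K" by (intro mult_left_mono K) auto
    finally have "norm (g' y) \<le> 3 ^ DIM('a) * K / (1 + (norm x)\<^sup>2) ^ DIM('a)"
      using p[of x] by (simp add: pos_le_divide_eq)
    then show ?thesis unfolding w_def norm_of_real by linarith
  qed
  define h :: "nat \<Rightarrow> real" where "h n = inverse (real (Suc n))" for n
  have h: "h \<longlonglongrightarrow> 0" "h n > 0" "h n \<le> 1" for n
    unfolding h_def by (rule LIMSEQ_inverse_real_of_nat) (auto simp: field_simps)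
  have hf: "filterlim h (at 0) sequentially"
    using h by (auto simp: filterlim_at eventually_sequentially less_imp_neq[THEN not_sym])
  define D where "D n x = (g (x + h n *\<^sub>R b) - g x) /\<^sub>R h n" for n x
  have "(\<lambda>n. LINT x|lborel. cis (- (x \<bullet> \<xi>)) * D n x) \<longlonglongrightarrow> (LINT x|lborel. cis (- (x \<bullet> \<xi>)) * g' x)"
  proof (rule integral_dominated_convergence[where w="\<lambda>x. norm (w x)"])
    show "AE x in lborel. (\<lambda>n. cis (- (x \<bullet> \<xi>)) * D n x) \<longlonglongrightarrow> cis (- (x \<bullet> \<xi>)) * g' x"
    proof (rule AE_I2)
      fix x
      have "((\<lambda>\<theta>. g (x + \<theta> *\<^sub>R b)) has_vector_derivative g' x) (at 0)"
        using line[of x 0] by (simp add: has_vector_derivative_def)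
      then have "((\<lambda>\<theta>. (g (x + \<theta> *\<^sub>R b) - g x) /\<^sub>R \<theta>) \<longlongrightarrow> g' x) (at 0)"
        using has_vector_derivative_quotient by fastforce
      from filterlim_compose[OF this hf] show "(\<lambda>n. cis (- (x \<bullet> \<xi>)) * D n x) \<longlonglongrightarrow> cis (- (x \<bullet> \<xi>)) * g' x"
        unfolding D_def by (intro tendsto_intros)
    qed
    show "AE x in lborel. norm (cis (- (x \<bullet> \<xi>)) * D n x) \<le> norm (w x)" for n
    proof (rule AE_I2)
      fix x
      \<comment> \<open>By the mean value inequality the difference quotient is at most the
        derivative at a point of the segment, whose length \<open>h n\<close> is at most 1, within
        the range of \<open>near\<close>.\<close>
      have "\<exists>\<theta>\<in>{0<..<h n}. norm (g (x + h n *\<^sub>R b) - g (x + 0 *\<^sub>R b)) \<le> norm ((h n - 0) *\<^sub>R g' (x + \<theta> *\<^sub>R b))"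
        by (rule mvt_general[OF h(2)[of n] _ line])
           (intro continuous_at_imp_continuous_on ballI has_derivative_continuous[OF line])
      then obtain \<theta> where \<theta>: "0 < \<theta>" "\<theta> < h n" "norm (g (x + h n *\<^sub>R b) - g (x + 0 *\<^sub>R b)) \<le> norm ((h n - 0) *\<^sub>R g' (x + \<theta> *\<^sub>R b))"
        by auto
      then have "norm (D n x) \<le> norm (g' (x + \<theta> *\<^sub>R b))"
        using h(2)[of n] unfolding D_def norm_scaleR by (simp add: inverse_eq_divide pos_divide_le_eq mult.commute)
      also have "\<dots> \<le> norm (w x)" using \<theta> h(3)[of n] b by (intro near) auto
      finally show "norm (cis (- (x \<bullet> \<xi>)) * D n x) \<le> norm (w x)" by (simp add: norm_mult)
    qed
  qed (use wi in \<open>auto simp: D_def\<close>)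
  moreover have "(LINT x|lborel. cis (- (x \<bullet> \<xi>)) * D n x) = ((cis (h n * (\<xi> \<bullet> b)) - cis (0 * (\<xi> \<bullet> b))) /\<^sub>R h n) * fourier g \<xi>" for n
  proof -
    let ?k = "\<lambda>x. cis (- (x \<bullet> \<xi>)) * g x"
    have ki: "integrable lborel ?k" by (rule integrable_cis_mult) (use gi in auto)
    have ki2: "integrable lborel (\<lambda>x. ?k (h n *\<^sub>R b + 1 *\<^sub>R x))" by (rule lborel_integrable_affine) (use ki in auto)
    have "(LINT x|lborel. ?k x) = \<bar>1::real\<bar>^DIM('a) *\<^sub>R (LINT x|lborel. ?k (h n *\<^sub>R b + 1 *\<^sub>R x))"
      by (rule lborel_integral_affine) (use ki in auto)
    then have k: "(LINT x|lborel. ?k (h n *\<^sub>R b + 1 *\<^sub>R x)) = fourier g \<xi>" by (simp add: fourier_def)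
    have "cis (- (x \<bullet> \<xi>)) * D n x = inverse (h n) *\<^sub>R (cis (h n * (\<xi> \<bullet> b)) * ?k (h n *\<^sub>R b + 1 *\<^sub>R x) - ?k x)" for x
    proof -
      have "cis (h n * (\<xi> \<bullet> b)) * cis (- ((h n *\<^sub>R b + x) \<bullet> \<xi>)) = cis (- (x \<bullet> \<xi>))"
        by (simp add: cis_mult inner_add_left inner_commute[of b \<xi>])
      then have *: "cis (h n * (\<xi> \<bullet> b)) * ?k (h n *\<^sub>R b + 1 *\<^sub>R x) = cis (- (x \<bullet> \<xi>)) * g (h n *\<^sub>R b + x)"
        by (simp add: mult.assoc[symmetric])
      show ?thesis unfolding * by (simp add: D_def algebra_simps)
    qed
    then have "(LINT x|lborel. cis (- (x \<bullet> \<xi>)) * D n x) =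
        (LINT x|lborel. inverse (h n) *\<^sub>R (cis (h n * (\<xi> \<bullet> b)) * ?k (h n *\<^sub>R b + 1 *\<^sub>R x) - ?k x))" by simp
    also have "\<dots> = inverse (h n) *\<^sub>R (cis (h n * (\<xi> \<bullet> b)) * fourier g \<xi> - fourier g \<xi>)"
      unfolding integral_scaleR_right
      by (subst Bochner_Integration.integral_diff[OF integrable_mult_right[OF ki2] ki])
         (simp only: integral_mult_right_zero k, simp add: fourier_def)
    finally show ?thesis by (simp add: algebra_simps)
  qed
  moreover have "(\<lambda>n. ((cis (h n * (\<xi> \<bullet> b)) - cis (0 * (\<xi> \<bullet> b))) /\<^sub>R h n) * fourier g \<xi>) \<longlonglongrightarrow> (\<i> * (\<xi> \<bullet> b)) * fourier g \<xi>"
  proof (intro tendsto_mult tendsto_const)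
    have "((\<lambda>t. cis (t * (\<xi> \<bullet> b))) has_vector_derivative (\<i> * (\<xi> \<bullet> b))) (at 0)"
      by (auto intro!: derivative_eq_intros simp: has_vector_derivative_def scaleR_conv_of_real mult_ac)
    then have "((\<lambda>\<theta>. (cis (\<theta> * (\<xi> \<bullet> b)) - cis (0 * (\<xi> \<bullet> b))) /\<^sub>R \<theta>) \<longlongrightarrow> \<i> * (\<xi> \<bullet> b)) (at 0)"
      by (rule has_vector_derivative_quotient)
    from filterlim_compose[OF this hf]
    show "(\<lambda>n. (cis (h n * (\<xi> \<bullet> b)) - cis (0 * (\<xi> \<bullet> b))) /\<^sub>R h n) \<longlonglongrightarrow> \<i> * (\<xi> \<bullet> b)" .
  qed
  ultimately have "(LINT x|lborel. cis (- (x \<bullet> \<xi>)) * g' x) = (\<i> * (\<xi> \<bullet> b)) * fourier g \<xi>"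
    using LIMSEQ_unique by (simp only:) blast
  then show ?thesis by (simp add: fourier_def g_def g'_def)
qed

lemma norm_fourier_iter_deriv:
  assumes "\<phi> \<in> schwartz" "b \<in> Basis"
  shows "norm (fourier (iter_deriv (replicate k b) \<phi>) \<xi>) = \<bar>\<xi> \<bullet> b\<bar> ^ k * norm (fourier \<phi> \<xi>)"
proof (induction k)
  case (Suc k)
  have "fourier (iter_deriv (b # replicate k b) \<phi>) \<xi> = \<i> * (\<xi> \<bullet> b) * fourier (iter_deriv (replicate k b) \<phi>) \<xi>"
    by (rule fourier_deriv_schwartz) (use assms in \<open>auto simp: set_replicate_conv_if\<close>)
  then show ?case using Suc by (simp add: norm_mult)
qed simp

text \<open>The largest coordinate of \<xi> controls |\<xi>|, so it is enough to bound the pure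
  derivatives in the coordinate directions, whose L^1 norms are the numbers
  \<open>I k b\<close>.\<close>

lemma fourier_schwartz_decay:
  fixes \<phi> :: "'a::euclidean_space \<Rightarrow> complex"
  assumes \<phi>: "\<phi> \<in> schwartz"
  obtains K where "\<And>\<xi>. norm (fourier \<phi> \<xi>) * (1 + (norm \<xi>)\<^sup>2) ^ N \<le> K"
proof -
  define I where "I k b = (LINT x|lborel. norm (iter_deriv (replicate k b) \<phi> x))" for k and b :: 'a
  have I: "\<bar>\<xi> \<bullet> b\<bar> ^ k * norm (fourier \<phi> \<xi>) \<le> I k b" if "b \<in> Basis" for \<xi> k b
    unfolding I_def norm_fourier_iter_deriv[OF \<phi> that, symmetric]
    by (intro norm_fourier_le integrable_schwartz_deriv \<phi>) (use that in \<open>auto simp: set_replicate_conv_if\<close>)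
  have I0: "I k b \<ge> 0" for k b by (simp add: I_def)
  \<comment> \<open>\<open>I 0 b\<close> has the same value for every \<open>b\<close>; an arbitrary
    basis vector stands in for the term without derivatives.\<close>
  define K where "K = 2 ^ N * (I 0 (SOME b. b \<in> Basis) + DIM('a) ^ N * (\<Sum>b\<in>Basis. I (2 * N) b))"
  have "norm (fourier \<phi> \<xi>) * (1 + (norm \<xi>)\<^sup>2) ^ N \<le> K" for \<xi>
  proof -
    define t where "t = Max ((\<lambda>b. (\<xi> \<bullet> b)\<^sup>2) ` Basis)"
    have "t \<in> (\<lambda>b. (\<xi> \<bullet> b)\<^sup>2) ` Basis" unfolding t_def by (intro Max_in) auto
    then obtain c where c: "c \<in> Basis" "t = (\<xi> \<bullet> c)\<^sup>2" by auto
    have "(norm \<xi>)\<^sup>2 = (\<Sum>b\<in>Basis. (\<xi> \<bullet> b)\<^sup>2)"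
      by (subst power2_norm_eq_inner, subst euclidean_inner) (simp add: power2_eq_square)
    also have "\<dots> \<le> DIM('a) * t" by (rule sum_bounded_above) (auto simp: t_def)
    finally have "((norm \<xi>)\<^sup>2) ^ N \<le> (DIM('a) * t) ^ N" by (intro power_mono) auto
    also have "\<dots> = DIM('a) ^ N * \<bar>\<xi> \<bullet> c\<bar> ^ (2 * N)" by (simp add: c power_mult_distrib power_mult)
    finally have 1: "((norm \<xi>)\<^sup>2) ^ N \<le> DIM('a) ^ N * \<bar>\<xi> \<bullet> c\<bar> ^ (2 * N)" .
    have "norm (fourier \<phi> \<xi>) * (1 + (norm \<xi>)\<^sup>2) ^ N \<le> norm (fourier \<phi> \<xi>) * (2 ^ N * (1 + ((norm \<xi>)\<^sup>2) ^ N))"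
      by (intro mult_left_mono one_plus_power_le) auto
    also have "\<dots> \<le> norm (fourier \<phi> \<xi>) * (2 ^ N * (1 + DIM('a) ^ N * \<bar>\<xi> \<bullet> c\<bar> ^ (2 * N)))"
      by (intro mult_left_mono add_left_mono 1) auto
    also have "\<dots> = 2 ^ N * (\<bar>\<xi> \<bullet> (SOME b. b \<in> Basis)\<bar> ^ 0 * norm (fourier \<phi> \<xi>) + DIM('a) ^ N * (\<bar>\<xi> \<bullet> c\<bar> ^ (2 * N) * norm (fourier \<phi> \<xi>)))"
      by (simp add: algebra_simps)
    also have "\<dots> \<le> 2 ^ N * (I 0 (SOME b. b \<in> Basis) + DIM('a) ^ N * (\<Sum>b\<in>Basis. I (2 * N) b))"
      by (intro mult_left_mono add_mono I SOME_Basis order_trans[OF I[OF c(1)]] member_le_sum c I0) auto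
    finally show ?thesis by (simp add: K_def)
  qed
  then show ?thesis using that by blast
qed

text \<open>Linear growth of \<open>m\<close> covers unimodular phases and powers of phi_s with
  exponent at most 1. One extra power of 1 + |\<xi>|^2 in the decay, hence
  \<open>Suc DIM('a)\<close>, absorbs it.\<close>

lemma integrable_fourier_schwartz:
  fixes \<phi> :: "'a::euclidean_space \<Rightarrow> complex"
  assumes \<phi>: "\<phi> \<in> schwartz" and [measurable]: "m \<in> borel_measurable borel"
    and m: "\<And>\<xi>. norm (m \<xi>) \<le> A * (1 + norm \<xi>)"
  shows "integrable lborel (\<lambda>\<xi>. m \<xi> * fourier \<phi> \<xi>)"
proof -
  obtain K where K: "\<And>\<xi>. norm (fourier \<phi> \<xi>) * (1 + (norm \<xi>)\<^sup>2) ^ (Suc DIM('a)) \<le> K"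
    using fourier_schwartz_decay[OF \<phi>, of "Suc DIM('a)"] by blast
  have A: "A \<ge> 0" using order_trans[OF norm_ge_zero m[of 0]] by simp
  note [measurable] = measurable_fourier_transforms(2)[OF integrable_schwartz[OF \<phi>]]
  show ?thesis
  proof (rule integrable_decay)
    fix \<xi> :: 'a
    have "norm \<xi> \<le> 1 + (norm \<xi>)\<^sup>2" using sum_squares_bound[of 1 "norm \<xi>"] by (simp; smt (verit) norm_ge_zero)
    then have "1 + norm \<xi> \<le> 2 * (1 + (norm \<xi>)\<^sup>2)" by (smt (verit) zero_le_power2)
    then have "norm (m \<xi>) \<le> A * (2 * (1 + (norm \<xi>)\<^sup>2))"
      using A by (intro order_trans[OF m] mult_left_mono) auto
    then have "norm (m \<xi> * fourier \<phi> \<xi>) * (1 + (norm \<xi>)\<^sup>2) ^ DIM('a) \<le> (A * (2 * (1 + (norm \<xi>)\<^sup>2))) * norm (fourier \<phi> \<xi>) * (1 + (norm \<xi>)\<^sup>2) ^ DIM('a)"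
      unfolding norm_mult by (intro mult_right_mono) auto
    also have "\<dots> = 2 * A * (norm (fourier \<phi> \<xi>) * (1 + (norm \<xi>)\<^sup>2) ^ (Suc DIM('a)))" by simp
    also have "\<dots> \<le> 2 * A * K" using A by (intro mult_left_mono K) auto
    finally show "norm (m \<xi> * fourier \<phi> \<xi>) * (1 + (norm \<xi>)\<^sup>2) ^ DIM('a) \<le> 2 * A * K" .
  qed simp
qed

lemma integrable_inv_fourier_schwartz:
  fixes \<phi> :: "'a::euclidean_space \<Rightarrow> complex"
  assumes \<phi>: "\<phi> \<in> schwartz" and [measurable]: "m \<in> borel_measurable borel"
    and m: "\<And>\<xi>. norm (m \<xi>) \<le> A * (1 + norm \<xi>)"
  shows "integrable lborel (\<lambda>\<xi>. m \<xi> * inv_fourier \<phi> \<xi>)"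
proof -
  have "integrable lborel (\<lambda>\<xi>. m (- \<xi>) * fourier \<phi> \<xi>)"
    by (rule integrable_fourier_schwartz[OF \<phi>, of _ A]) (use m[of "- _"] in auto)
  from lborel_integrable_affine[OF _ this, of "-1" 0]
  have "integrable lborel (\<lambda>\<xi>. m \<xi> * fourier \<phi> (- \<xi>) / (2 * pi) ^ DIM('a))" by auto
  then show ?thesis by (simp add: inv_fourier_eq_fourier)
qed

subsection \<open>Fourier multipliers on integrable functions\<close>

lemma integrable_mult_bounded:
  fixes f g :: "'a \<Rightarrow> complex"
  assumes "integrable M f" "g \<in> borel_measurable M" "\<And>x. norm (g x) \<le> B"
  shows "integrable M (\<lambda>x. f x * g x)"
proof (rule Bochner_Integration.integrable_bound[OF integrable_mult_right[OF assms(1), of "complex_of_real B"]])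
  show "AE x in M. norm (f x * g x) \<le> norm (complex_of_real B * f x)"
    unfolding norm_mult norm_of_real mult.commute[of "norm (f _)"]
    by (intro AE_I2 mult_right_mono order_trans[OF assms(3) abs_ge_self] norm_ge_zero)
qed (use assms(1,2) borel_measurable_integrable[OF assms(1)] in measurable)

lemma integrable_mult_schwartz:
  fixes f \<phi> :: "'a::euclidean_space \<Rightarrow> complex"
  assumes "integrable lborel f" "\<phi> \<in> schwartz"
  shows "integrable lborel (\<lambda>x. f x * \<phi> x)"
proof -
  obtain B where "\<And>x. norm (\<phi> x) \<le> B" using bounded_schwartz[OF assms(2)] by blast
  then show ?thesis using assms by (intro integrable_mult_bounded) (auto simp: measurable_schwartz)
qed

text \<open>The supremum of the test function alone controls the pairing, with the L^1 norm of
  \<open>f\<close> as constant; hence the order 0.\<close>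

lemma tempered_distr_of:
  fixes f :: "'a::euclidean_space \<Rightarrow> complex"
  assumes f: "integrable lborel f"
  shows "tempered (distr_of f)"
  unfolding tempered_def distr_of_def
proof (intro conjI ballI allI exI[of _ "LINT x|lborel. norm (f x)"] exI[of _ 0] impI)
  fix \<phi> \<psi> :: "'a \<Rightarrow> complex" assume "\<phi> \<in> schwartz" "\<psi> \<in> schwartz"
  then show "(LINT x|lborel. f x * (\<phi> x + \<psi> x)) = (LINT x|lborel. f x * \<phi> x) + (LINT x|lborel. f x * \<psi> x)"
    by (simp add: distrib_left integrable_mult_schwartz f)
next
  fix c and \<phi> :: "'a \<Rightarrow> complex"
  show "(LINT x|lborel. f x * (c * \<phi> x)) = c * (LINT x|lborel. f x * \<phi> x)"
    unfolding mult.left_commute[of _ c] by (rule integral_mult_right_zero)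
next
  fix \<phi> :: "'a \<Rightarrow> complex" and B
  assume \<phi>: "\<phi> \<in> schwartz" and "\<forall>vs k x. set vs \<subseteq> Basis \<and> length vs \<le> 0 \<and> k \<le> 0 \<longrightarrow> norm x ^ k * norm (iter_deriv vs \<phi> x) \<le> B"
  then have B: "norm (\<phi> x) \<le> B" for x by auto
  have "norm (LINT x|lborel. f x * \<phi> x) \<le> (LINT x|lborel. norm (f x * \<phi> x))"
    by (rule integral_norm_bound)
  also have "\<dots> \<le> (LINT x|lborel. norm (f x) * B)"
    using f by (intro integral_mono integrable_norm integrable_mult_schwartz \<phi> integrable_mult_left)
      (auto simp: norm_mult intro!: mult_left_mono B)
  finally show "norm (LINT x|lborel. f x * \<phi> x) \<le> (LINT x|lborel. norm (f x)) * B" by simp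
qed

lemma tempered_fun_bounded:
  fixes f :: "'a::euclidean_space \<Rightarrow> complex"
  assumes "f \<in> borel_measurable borel" "\<And>x. norm (f x) \<le> B"
  shows "tempered_fun f"
  using integrable_mult_bounded[OF integrable_schwartz, of _ f B] assms
  by (auto simp: tempered_fun_def mult.commute)

lemma tempered_fun_integrable: "integrable lborel f \<Longrightarrow> tempered_fun f"
  by (auto simp: tempered_fun_def integrable_mult_schwartz)

lemma integral_mult_inv_fourier:
  fixes f k :: "'a::euclidean_space \<Rightarrow> complex"
  assumes f: "integrable lborel f" and k: "integrable lborel k"
  shows "(LINT x|lborel. f x * inv_fourier k x) = (LINT \<xi>|lborel. inv_fourier f \<xi> * k \<xi>)"
proof -
  have [measurable]: "f \<in> borel_measurable borel" "k \<in> borel_measurable borel" using f k by auto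
  note [measurable] = measurable_fourier_transforms(2)[OF k]
  have f': "integrable lborel (\<lambda>x. f (- x))" using lborel_integrable_affine[of "-1" f 0] f by simp
  have "(LINT x|lborel. f x * fourier k (- x)) = (LINT x|lborel. f (- x) * fourier k x)"
    by (subst lborel_integral_affine[of "-1" _ 0]) auto
  also have "\<dots> = (LINT \<xi>|lborel. fourier (\<lambda>x. f (- x)) \<xi> * k \<xi>)"
    by (rule integral_mult_fourier[OF f' k])
  also have "fourier (\<lambda>x. f (- x)) = (\<lambda>\<xi>. fourier f (- \<xi>))"
    unfolding fourier_def by (rule ext, subst lborel_integral_affine[of "-1" _ 0]) auto
  finally show ?thesis by (simp add: inv_fourier_eq_fourier)
qed

text \<open>Two transpositions: the outer \<open>fourier\<close> in
  \<open>fourier_multiplier\<close> passes to \<open>f\<close>, then \<open>inv_fourier\<close>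
  passes from the test function to \<open>m\<close> times the transform of \<open>f\<close>.\<close>

theorem represents_fourier_multiplier:
  fixes f m :: "'a::euclidean_space \<Rightarrow> complex"
  assumes f: "integrable lborel f" and m [measurable]: "m \<in> borel_measurable borel"
    and A: "\<And>\<xi>. norm (m \<xi>) \<le> A * (1 + norm \<xi>)"
    and i: "integrable lborel (\<lambda>\<xi>. m \<xi> * fourier f \<xi>)"
  shows "represents (inv_fourier (\<lambda>\<xi>. m \<xi> * fourier f \<xi>)) (fourier_multiplier m (distr_of f))"
  unfolding represents_def
proof (intro conjI ballI)
  show "tempered_fun (inv_fourier (\<lambda>\<xi>. m \<xi> * fourier f \<xi>))"
    by (rule tempered_fun_bounded[OF measurable_fourier_transforms(1)[OF i] norm_inv_fourier_le[OF i]])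
next
  fix \<phi> :: "'a \<Rightarrow> complex" assume \<phi>: "\<phi> \<in> schwartz"
  have "fourier_multiplier m (distr_of f) \<phi> = (LINT x|lborel. f x * fourier (\<lambda>\<xi>. m \<xi> * inv_fourier \<phi> \<xi>) x)"
    by (simp add: fourier_multiplier_def distr_of_def)
  also have "\<dots> = (LINT \<xi>|lborel. fourier f \<xi> * (m \<xi> * inv_fourier \<phi> \<xi>))"
    by (intro integral_mult_fourier f integrable_inv_fourier_schwartz[OF \<phi> m A])
  also have "\<dots> = (LINT \<xi>|lborel. (m \<xi> * fourier f \<xi>) * inv_fourier \<phi> \<xi>)"
    by (simp add: mult_ac)
  also have "\<dots> = distr_of (inv_fourier (\<lambda>\<xi>. m \<xi> * fourier f \<xi>)) \<phi>"
    unfolding distr_of_def by (intro integral_mult_inv_fourier i integrable_schwartz \<phi>)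
  finally show "fourier_multiplier m (distr_of f) \<phi> = distr_of (inv_fourier (\<lambda>\<xi>. m \<xi> * fourier f \<xi>)) \<phi>" .
qed

text \<open>\<open>L2_norm_sq\<close> is an infimum over representatives, so the explicit one gives
  an upper bound, to which the Plancherel inequality applies.\<close>

corollary L2_norm_sq_fourier_multiplier_le:
  fixes f m :: "'a::euclidean_space \<Rightarrow> complex"
  assumes "integrable lborel f" "m \<in> borel_measurable borel"
    and "\<And>\<xi>. norm (m \<xi>) \<le> A * (1 + norm \<xi>)"
    and "integrable lborel (\<lambda>\<xi>. m \<xi> * fourier f \<xi>)"
  shows "L2_norm_sq (fourier_multiplier m (distr_of f)) \<le>
    ennreal (1 / (2 * pi) ^ DIM('a)) * (\<integral>\<^sup>+\<xi>. ennreal ((norm (m \<xi> * fourier f \<xi>))\<^sup>2) \<partial>lborel)"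
proof -
  have "L2_norm_sq (fourier_multiplier m (distr_of f)) \<le>
      (\<integral>\<^sup>+x. ennreal ((norm (inv_fourier (\<lambda>\<xi>. m \<xi> * fourier f \<xi>) x))\<^sup>2) \<partial>lborel)"
    unfolding L2_norm_sq_def by (intro INF_lower CollectI represents_fourier_multiplier[OF assms])
  also note nn_integral_inv_fourier_le[OF assms(4)]
  finally show ?thesis .
qed

section \<open>The Klein-Gordon symbol and explicit solutions\<close>

lemma kg_phi_pos: "s > 0 \<Longrightarrow> kg_phi s r > 0"
  by (simp add: kg_phi_def add_pos_nonneg)

lemma kg_phi_sq: "(kg_phi s r)\<^sup>2 = s\<^sup>2 + r\<^sup>2"
  by (simp add: kg_phi_def)

lemma kg_phi_mono: "0 \<le> r \<Longrightarrow> r \<le> r' \<Longrightarrow> kg_phi s r \<le> kg_phi s r'"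
  by (simp add: kg_phi_def power_mono)

lemma kg_phi_ge: "r \<ge> 0 \<Longrightarrow> kg_phi s r \<ge> r" and kg_phi_ge_mass: "s \<ge> 0 \<Longrightarrow> kg_phi s r \<ge> s"
  by (simp_all add: kg_phi_def real_le_rsqrt)

lemma kg_phi_le: "s \<ge> 0 \<Longrightarrow> r \<ge> 0 \<Longrightarrow> kg_phi s r \<le> s + r"
  unfolding kg_phi_def by (rule real_le_lsqrt) (auto simp: power2_sum)

lemma continuous_kg_phi [continuous_intros]: "continuous_on A f \<Longrightarrow> continuous_on A (\<lambda>x. kg_phi s (f x))"
  unfolding kg_phi_def by (intro continuous_intros)

lemma measurable_kg_phi [measurable]: "kg_phi s \<in> borel_measurable borel"
  by (intro borel_measurable_continuous_onI continuous_intros)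

text \<open>For \<alpha> >= 0 the bound phi_s(r) <= s + r decides; for \<alpha> < 0 the power is
  largest at r = 0. One linear bound serves both, in the form that the multiplier lemmas ask
  for.\<close>

lemma kg_phi_powr_le:
  assumes "s > 0" "\<alpha> \<le> 1" "r \<ge> 0"
  shows "kg_phi s r powr \<alpha> \<le> (s powr \<alpha> + s + 1) * (1 + r)"
proof (cases "\<alpha> \<ge> 0")
  case True
  have "kg_phi s r powr \<alpha> \<le> (1 + s + r) powr \<alpha>"
    using kg_phi_le[of s r] kg_phi_pos[of s r] assms True by (intro powr_mono2) auto
  also have "\<dots> \<le> (1 + s + r) powr 1" using assms by (intro powr_mono) auto
  also have "\<dots> = 1 + s + r" using assms by simp
  also have "\<dots> \<le> (s powr \<alpha> + s + 1) * (1 + r)" using assms by (simp add: algebra_simps add_increasing)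
  finally show ?thesis .
next
  case False
  have "kg_phi s r powr \<alpha> \<le> s powr \<alpha>"
    using kg_phi_ge_mass[of s r] assms False by (intro powr_mono2') auto
  also have "\<dots> \<le> (s powr \<alpha> + s + 1) * (1 + r)" using assms by (simp add: algebra_simps add_increasing)
  finally show ?thesis .
qed

lemma L2_norm_sq_kg_phi_pow_le:
  fixes f :: "'a::euclidean_space \<Rightarrow> complex"
  assumes f: "integrable lborel f" and s: "s > 0" and \<alpha>: "\<alpha> \<le> 1"
    and R: "\<And>\<xi>. norm \<xi> > R \<Longrightarrow> fourier f \<xi> = 0"
  shows "L2_norm_sq (kg_phi_pow s \<alpha> (distr_of f)) \<le> ennreal (1 / (2 * pi) ^ DIM('a)) *
     (\<integral>\<^sup>+\<xi>. ennreal ((kg_phi s (norm \<xi>) powr \<alpha> * norm (fourier f \<xi>))\<^sup>2) \<partial>lborel)"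
proof -
  let ?m = "\<lambda>\<xi>::'a. complex_of_real (kg_phi s (norm \<xi>) powr \<alpha>)"
  have m: "?m \<in> borel_measurable borel" by measurable
  have b: "norm (?m \<xi>) \<le> (s powr \<alpha> + s + 1) * (1 + norm \<xi>)" for \<xi>
    using kg_phi_powr_le[OF s \<alpha>, of "norm \<xi>"] by simp
  \<comment> \<open>Compact support of the transform makes its product with the continuous symbol
    integrable.\<close>
  have "integrable lborel (\<lambda>\<xi>. indicator (cball 0 R) \<xi> *\<^sub>R (?m \<xi> * fourier f \<xi>))"
    by (intro borel_integrable_compact compact_cball continuous_intros continuous_on_subset[OF continuous_fourier[OF f]])
       (use kg_phi_pos[OF s] in \<open>auto simp: less_imp_neq[THEN not_sym]\<close>)
  moreover have "indicator (cball 0 R) \<xi> *\<^sub>R (?m \<xi> * fourier f \<xi>) = ?m \<xi> * fourier f \<xi>" for \<xi>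
    using R[of \<xi>] by (auto simp: indicator_def)
  ultimately have i: "integrable lborel (\<lambda>\<xi>. ?m \<xi> * fourier f \<xi>)" by simp
  show ?thesis
    using L2_norm_sq_fourier_multiplier_le[OF f m b i] by (simp add: kg_phi_pow_def norm_mult)
qed

text \<open>A representative of the propagated wave that is defined at every point; it is the
  witness for \<open>kg_wave\<close>.\<close>

definition kg_solution :: "real \<Rightarrow> ('a::euclidean_space \<Rightarrow> complex) \<Rightarrow> real \<times> 'a \<Rightarrow> complex" where
  "kg_solution s f = (\<lambda>(t, x). inv_fourier (\<lambda>\<xi>. cis (t * kg_phi s (norm \<xi>)) * fourier f \<xi>) x)"

lemma measurable_kg_solution:
  assumes "integrable lborel (fourier f)"
  shows "kg_solution s f \<in> borel_measurable borel"
proof -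
  have [measurable]: "fourier f \<in> borel_measurable borel" using assms by auto
  have "(\<lambda>p. LINT \<xi>|lborel. cis (snd p \<bullet> \<xi>) * (cis (fst p * kg_phi s (norm \<xi>)) * fourier f \<xi>)) \<in> borel_measurable (borel \<Otimes>\<^sub>M borel)"
    by (intro lborel.borel_measurable_lebesgue_integral) measurable
  then show ?thesis
    unfolding kg_solution_def inv_fourier_def by (simp add: borel_prod split_beta)
qed

lemma norm_kg_solution_le:
  fixes f :: "'a::euclidean_space \<Rightarrow> complex"
  assumes "integrable lborel (fourier f)"
  shows "norm (kg_solution s f p) \<le> (LINT \<xi>|lborel. norm (fourier f \<xi>)) / (2 * pi) ^ DIM('a)"
proof (cases p)
  case (Pair t x)
  have "integrable lborel (\<lambda>\<xi>. cis (t * kg_phi s (norm \<xi>)) * fourier f \<xi>)"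
    by (intro integrable_cis_mult assms) measurable
  from norm_inv_fourier_le[OF this, of x] show ?thesis
    by (simp add: Pair kg_solution_def norm_mult)
qed

lemma kg_wave_kg_solution:
  fixes f :: "'a::euclidean_space \<Rightarrow> complex"
  assumes f: "integrable lborel f" and F: "integrable lborel (fourier f)"
  shows "kg_wave s (distr_of f) (kg_solution s f)"
  unfolding kg_wave_def kg_propagator_def
proof (intro conjI allI)
  show "represents (\<lambda>x. kg_solution s f (t, x)) (fourier_multiplier (\<lambda>\<xi>. cis (t * kg_phi s (norm \<xi>))) (distr_of f))" for t
    unfolding kg_solution_def prod.case
    by (rule represents_fourier_multiplier[OF f, of _ 1]) (intro integrable_cis_mult F | simp)+
qed (use measurable_kg_solution[OF F] in simp)

subsection \<open>The Fourier transform of a product of two waves\<close>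

definition momentum_diff :: "real \<Rightarrow> 'a::euclidean_space \<times> 'a \<Rightarrow> real \<times> 'a" where
  "momentum_diff s = (\<lambda>(\<eta>, \<zeta>). (kg_phi s (norm \<eta>) - kg_phi s (norm \<zeta>), \<eta> - \<zeta>))"

lemma measurable_momentum_diff [measurable]:
  "momentum_diff s \<in> borel_measurable (borel :: ('a::euclidean_space \<times> 'a) measure)"
proof -
  have "(\<lambda>q::'a \<times> 'a. (kg_phi s (norm (fst q)) - kg_phi s (norm (snd q)), fst q - snd q)) \<in> borel_measurable borel"
    by (intro borel_measurable_continuous_onI continuous_intros)
  then show ?thesis by (simp add: momentum_diff_def split_beta)
qed

text \<open>On \<open>L\<close> the map \<open>T\<close> expands distances by at least the factor c,
  so its inverse is Lipschitz, and Lipschitz images of negligible sets are negligible.\<close>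

lemma null_set_expanding_preimage:
  fixes T :: "real \<Rightarrow> real"
  assumes N: "N \<in> null_sets lborel" and L: "L \<in> sets borel" and TL: "T ` L \<subseteq> N" and c: "c > 0"
    and T: "\<And>r r'. r \<in> L \<Longrightarrow> r' \<in> L \<Longrightarrow> r' < r \<Longrightarrow> c * (r - r') \<le> T r - T r'"
  shows "emeasure lborel L = 0"
proof -
  have T': "\<bar>r - r'\<bar> \<le> inverse c * \<bar>T r - T r'\<bar>" if "r \<in> L" "r' \<in> L" for r r'
  proof -
    have "c * \<bar>r - r'\<bar> \<le> \<bar>T r - T r'\<bar>"
      using T[OF that] T[OF that(2,1)] by (cases r r' rule: linorder_cases) (auto simp: abs_if algebra_simps)
    then show ?thesis using c by (simp add: field_simps)
  qed
  then have inj: "inj_on T L" by (fastforce intro!: inj_onI)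
  define g where "g = inv_into L T"
  have g: "g (T r) = r" if "r \<in> L" for r using inj that by (simp add: g_def)
  have "negligible N" using N by (simp add: negligible_iff_null_sets null_sets_completionI)
  then have "negligible (T ` L)" using TL by (rule negligible_subset)
  then have "negligible (g ` (T ` L))"
  proof (rule negligible_locally_Lipschitz_image[OF order_refl])
    show "\<exists>U B. open U \<and> x \<in> U \<and> (\<forall>y\<in>T ` L \<inter> U. norm (g y - g x) \<le> B * norm (y - x))" if "x \<in> T ` L" for x
      using that T' by (intro exI[of _ UNIV] exI[of _ "inverse c"]) (auto simp: g)
  qed
  moreover have "g ` (T ` L) = L" by (force simp: g image_image)
  ultimately have "L \<in> null_sets lebesgue" by (simp add: negligible_iff_null_sets)
  then show ?thesis using L by (simp add: null_sets_completion_iff null_sets_def)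
qed

text \<open>The slope of phi_s(|eta|) along \<open>e\<close> is (eta . e) / phi_s(|eta|), here at
  least 1 / phi_s(R), while phi_s(|eta - xi|) does not increase. The comparison goes through
  differences of squares, so that only the two endpoints enter.\<close>

lemma kg_phi_line_expanding:
  fixes \<eta> e :: "'a::euclidean_space"
  assumes s: "s > 0" and e: "e \<in> Basis" and r: "r' < r"
    and R: "norm (\<eta> + r *\<^sub>R e) \<le> R" "norm (\<eta> + r' *\<^sub>R e) \<le> R"
    and p: "(\<eta> + r *\<^sub>R e) \<bullet> e \<ge> 1" "(\<eta> + r' *\<^sub>R e) \<bullet> e \<ge> 1"
    and m: "(\<eta> + r *\<^sub>R e - \<xi>) \<bullet> e \<le> -1" "(\<eta> + r' *\<^sub>R e - \<xi>) \<bullet> e \<le> -1"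
  shows "inverse (kg_phi s R) * (r - r') \<le>
    (kg_phi s (norm (\<eta> + r *\<^sub>R e)) - kg_phi s (norm (\<eta> + r *\<^sub>R e - \<xi>))) -
    (kg_phi s (norm (\<eta> + r' *\<^sub>R e)) - kg_phi s (norm (\<eta> + r' *\<^sub>R e - \<xi>)))"
proof -
  have diff: "(norm (v + r *\<^sub>R e))\<^sup>2 - (norm (v + r' *\<^sub>R e))\<^sup>2 = (r - r') * ((v + r *\<^sub>R e) \<bullet> e + (v + r' *\<^sub>R e) \<bullet> e)" for v
    using e by (simp add: power2_norm_eq_inner inner_add_left inner_add_right inner_commute algebra_simps)
  define a a' where "a = kg_phi s (norm (\<eta> + r *\<^sub>R e))" and "a' = kg_phi s (norm (\<eta> + r' *\<^sub>R e))"
  have a: "a > 0" "a' > 0" "a \<le> kg_phi s R" "a' \<le> kg_phi s R"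
    using R kg_phi_pos[OF s] kg_phi_mono unfolding a_def a'_def by auto
  have "(r - r') * 2 \<le> a\<^sup>2 - a'\<^sup>2"
    unfolding a_def a'_def kg_phi_sq using diff[of \<eta>] mult_left_mono[of 2 "(\<eta> + r *\<^sub>R e) \<bullet> e + (\<eta> + r' *\<^sub>R e) \<bullet> e" "r - r'"] p r by simp
  also have "a\<^sup>2 - a'\<^sup>2 = (a - a') * (a + a')" by (simp add: power2_eq_square algebra_simps)
  finally have 1: "(r - r') * 2 \<le> (a - a') * (a + a')" .
  then have "a - a' > 0" using r a zero_less_mult_pos2[of "a - a'" "a + a'"] by (smt (verit))
  then have "(a - a') * (a + a') \<le> (a - a') * (2 * kg_phi s R)" using a by (intro mult_left_mono) auto
  with 1 have "r - r' \<le> (a - a') * kg_phi s R" by simp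
  then have "inverse (kg_phi s R) * (r - r') \<le> a - a'"
    using kg_phi_pos[OF s, of R] by (simp add: inverse_eq_divide pos_divide_le_eq)
  moreover have "kg_phi s (norm (\<eta> + r *\<^sub>R e - \<xi>)) \<le> kg_phi s (norm (\<eta> + r' *\<^sub>R e - \<xi>))"
  proof -
    have "(r - r') * ((\<eta> - \<xi> + r *\<^sub>R e) \<bullet> e + (\<eta> - \<xi> + r' *\<^sub>R e) \<bullet> e) \<le> 0"
      using m r by (intro mult_nonneg_nonpos) (auto simp: algebra_simps inner_simps)
    then have "(norm (\<eta> - \<xi> + r *\<^sub>R e))\<^sup>2 \<le> (norm (\<eta> - \<xi> + r' *\<^sub>R e))\<^sup>2" unfolding diff[symmetric] by simp
    moreover have "\<eta> + t *\<^sub>R e - \<xi> = \<eta> - \<xi> + t *\<^sub>R e" for t by simp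
    ultimately show ?thesis by (simp only:) (simp add: kg_phi_def)
  qed
  ultimately show ?thesis by (simp add: a_def a'_def)
qed

text \<open>Fibrewise over \<open>\<xi> = \<eta> - \<zeta>\<close>, the energy difference is strictly monotone in direction \<open>e\<close>, because
  the velocities of the two particles in this direction have opposite signs. Averaging over translations
  along \<open>e\<close> reduces the claim to one dimension.\<close>

lemma AE_momentum_diff_notin_null_set:
  fixes e :: "'a::euclidean_space"
  assumes s: "s > 0" and e: "e \<in> Basis" and N: "N \<in> null_sets (lborel :: (real \<times> 'a) measure)"
  shows "AE q in lborel. norm (fst q) \<le> R \<and> fst q \<bullet> e \<ge> 1 \<and> snd q \<bullet> e \<le> -1 \<longrightarrow> momentum_diff s q \<notin> N"
proof -
  have Nb [measurable]: "N \<in> sets borel" using N by auto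
  define Z where "Z = {q. norm (fst q) \<le> R \<and> fst q \<bullet> e \<ge> 1 \<and> snd q \<bullet> e \<le> -1 \<and> momentum_diff s q \<in> N}"
  have Zb [measurable]: "Z \<in> sets (borel :: ('a \<times> 'a) measure)"
  proof -
    have "Z = {q. norm (fst q) \<le> R \<and> 1 \<le> fst q \<bullet> e \<and> snd q \<bullet> e \<le> -1} \<inter> (momentum_diff s -` N \<inter> space borel)"
      by (auto simp: Z_def)
    also have "\<dots> \<in> sets borel"
      by (intro sets.Int borel_closed closed_Collect_conj closed_Collect_le continuous_intros
          measurable_sets[OF measurable_momentum_diff Nb])
    finally show ?thesis .
  qed
  have Zi [measurable]: "indicator Z \<in> borel_measurable (borel :: ('a \<times> 'a) measure)" by measurable
  \<comment> \<open>By Fubini almost every energy slice of \<open>N\<close> is null, so the claim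
    can be checked for one \<xi> at a time.\<close>
  have Nnull: "AE \<xi> in lborel. emeasure lborel ((\<lambda>\<tau>. (\<tau>, \<xi>)) -` N) = 0"
  proof -
    have NN: "N \<in> sets (lborel \<Otimes>\<^sub>M lborel)" unfolding lborel_prod by simp
    have "emeasure (lborel \<Otimes>\<^sub>M lborel) N = 0" using N unfolding lborel_prod by (rule null_setsD1)
    then have "(\<integral>\<^sup>+\<xi>. emeasure lborel ((\<lambda>\<tau>. (\<tau>, \<xi>)) -` N) \<partial>lborel) = 0"
      by (simp add: lborel_pair.emeasure_pair_measure_alt2[OF NN])
    then show ?thesis
      by (subst (asm) nn_integral_0_iff_AE) (auto intro: lborel_pair.measurable_emeasure_Pair2[OF NN])
  qed
  have slice: "(\<integral>\<^sup>+\<eta>. indicator Z (\<eta>, \<eta> - \<xi>) \<partial>lborel) = 0" if \<xi>: "emeasure lborel ((\<lambda>\<tau>. (\<tau>, \<xi>)) -` N) = 0" for \<xi>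
  proof -
    define I where "I = (\<integral>\<^sup>+\<eta>. indicator Z (\<eta>, \<eta> - \<xi>) \<partial>lborel)"
    have m2 [measurable]: "(\<lambda>\<eta>. indicator Z (\<eta>, \<eta> - \<xi>) :: ennreal) \<in> borel_measurable borel"
      by (rule measurable_compose[OF _ Zi]) (intro borel_measurable_continuous_onI continuous_intros)
    have m3: "(\<lambda>p. indicator Z (snd p + fst p *\<^sub>R e, snd p + fst p *\<^sub>R e - \<xi>) :: ennreal) \<in> borel_measurable (lborel \<Otimes>\<^sub>M lborel)"
      unfolding lborel_prod measurable_lborel2
      by (rule measurable_compose[OF _ Zi]) (intro borel_measurable_continuous_onI continuous_intros)
    \<comment> \<open>Translation invariance: the integral shifted by \<open>r\<close> has the value
      \<open>I\<close> for every \<open>r\<close>.\<close>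
    have I: "I = (\<integral>\<^sup>+\<eta>. indicator Z (\<eta> + r *\<^sub>R e, \<eta> + r *\<^sub>R e - \<xi>) \<partial>lborel)" for r
      unfolding I_def by (subst lborel_nn_integral_affine[of 1 _ "r *\<^sub>R e"]) (auto simp: add.commute)
    have NN: "(\<lambda>\<tau>. (\<tau>, \<xi>)) -` N \<in> null_sets lborel"
      using \<xi> measurable_sets[of "\<lambda>\<tau>. (\<tau>, \<xi>)" borel borel N]
      by (auto simp: null_sets_def intro!: borel_measurable_continuous_onI continuous_intros)
    have "(\<integral>\<^sup>+r. indicator Z (\<eta> + r *\<^sub>R e, \<eta> + r *\<^sub>R e - \<xi>) \<partial>lborel) = 0" for \<eta>
    proof -
      define L where "L = {r. (\<eta> + r *\<^sub>R e, \<eta> + r *\<^sub>R e - \<xi>) \<in> Z}"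
      have "L = (\<lambda>r. (\<eta> + r *\<^sub>R e, \<eta> + r *\<^sub>R e - \<xi>)) -` Z \<inter> space borel" by (auto simp: L_def)
      also have "\<dots> \<in> sets borel"
        by (rule measurable_sets[OF _ Zb]) (intro borel_measurable_continuous_onI continuous_intros)
      finally have L: "L \<in> sets borel" .
      have "emeasure lborel L = 0"
      proof (rule null_set_expanding_preimage[OF NN L])
        show "(\<lambda>r. kg_phi s (norm (\<eta> + r *\<^sub>R e)) - kg_phi s (norm (\<eta> + r *\<^sub>R e - \<xi>))) ` L \<subseteq> (\<lambda>\<tau>. (\<tau>, \<xi>)) -` N"
          by (auto simp: L_def Z_def momentum_diff_def)
        show "inverse (kg_phi s R) > 0" using kg_phi_pos[OF s] by simp
        show "inverse (kg_phi s R) * (r - r') \<le>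
          (kg_phi s (norm (\<eta> + r *\<^sub>R e)) - kg_phi s (norm (\<eta> + r *\<^sub>R e - \<xi>))) -
          (kg_phi s (norm (\<eta> + r' *\<^sub>R e)) - kg_phi s (norm (\<eta> + r' *\<^sub>R e - \<xi>)))"
          if "r \<in> L" "r' \<in> L" "r' < r" for r r'
          by (rule kg_phi_line_expanding[OF s e]) (use that in \<open>auto simp: L_def Z_def\<close>)
      qed
      moreover have "(\<integral>\<^sup>+r. indicator Z (\<eta> + r *\<^sub>R e, \<eta> + r *\<^sub>R e - \<xi>) \<partial>lborel) = (\<integral>\<^sup>+r. indicator L r \<partial>lborel)"
        by (intro nn_integral_cong) (simp add: L_def indicator_def)
      ultimately show ?thesis using L by simp
    qed
    then have "0 = (\<integral>\<^sup>+\<eta>. (\<integral>\<^sup>+r. indicator Z (\<eta> + r *\<^sub>R e, \<eta> + r *\<^sub>R e - \<xi>) \<partial>lborel) \<partial>lborel)" by simp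
    also have "\<dots> = (\<integral>\<^sup>+r. (\<integral>\<^sup>+\<eta>. indicator Z (\<eta> + r *\<^sub>R e, \<eta> + r *\<^sub>R e - \<xi>) \<partial>lborel) \<partial>lborel)"
      using lborel_pair.Fubini'[of "\<lambda>r \<eta>. indicator Z (\<eta> + r *\<^sub>R e, \<eta> + r *\<^sub>R e - \<xi>)"] m3 by (simp add: split_beta)
    also have "\<dots> = (\<integral>\<^sup>+r. I \<partial>(lborel :: real measure))" unfolding I[symmetric] ..
    \<comment> \<open>The constant \<open>I\<close> is integrated over the whole line of shifts,
      whereas integrating over the shifts first gave 0; so \<open>I\<close> must vanish.\<close>
    also have "\<dots> = I * \<infinity>" by simp
    finally have "I = 0" by (metis ennreal_top_eq_mult_iff ennreal_mult_eq_top_iff infinity_ennreal_def mult_eq_0_iff ennreal_top_neq_zero)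
    then show ?thesis by (simp add: I_def)
  qed
  have mZ: "(\<lambda>p. indicator Z (fst p, fst p - snd p) :: ennreal) \<in> borel_measurable (lborel \<Otimes>\<^sub>M lborel)"
    unfolding lborel_prod measurable_lborel2
    by (rule measurable_compose[OF _ Zi]) (intro borel_measurable_continuous_onI continuous_intros)
  have "emeasure lborel Z = emeasure (lborel \<Otimes>\<^sub>M lborel) Z" by (simp add: lborel_prod)
  also have "\<dots> = (\<integral>\<^sup>+\<eta>. (\<integral>\<^sup>+\<zeta>. indicator Z (\<eta>, \<zeta>) \<partial>lborel) \<partial>lborel)"
    by (rule lborel.emeasure_pair_measure) (unfold lborel_prod, simp)
  \<comment> \<open>The substitution \<zeta> = \<eta> - \<xi> fibres \<open>Z\<close> over the
    momentum difference.\<close>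
  also have "\<dots> = (\<integral>\<^sup>+\<eta>. (\<integral>\<^sup>+\<xi>. indicator Z (\<eta>, \<eta> - \<xi>) \<partial>lborel) \<partial>lborel)"
  proof (rule nn_integral_cong)
    fix \<eta> :: 'a
    have "(\<lambda>\<zeta>. indicator Z (\<eta>, \<zeta>) :: ennreal) \<in> borel_measurable borel"
      by (rule measurable_compose[OF _ Zi]) (intro borel_measurable_continuous_onI continuous_intros)
    then show "(\<integral>\<^sup>+\<zeta>. indicator Z (\<eta>, \<zeta>) \<partial>lborel) = (\<integral>\<^sup>+\<xi>. indicator Z (\<eta>, \<eta> - \<xi>) \<partial>lborel)"
      by (subst lborel_nn_integral_affine[of "-1" _ \<eta>]) auto
  qed
  also have "\<dots> = (\<integral>\<^sup>+\<xi>. (\<integral>\<^sup>+\<eta>. indicator Z (\<eta>, \<eta> - \<xi>) \<partial>lborel) \<partial>lborel)"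
    using lborel_pair.Fubini'[of "\<lambda>\<eta> \<xi>. indicator Z (\<eta>, \<eta> - \<xi>)"] mZ by (simp add: split_beta)
  also have "\<dots> = (\<integral>\<^sup>+\<xi>. 0 \<partial>(lborel :: 'a measure))"
    by (rule nn_integral_cong_AE) (use Nnull in eventually_elim, rule slice)
  finally have "emeasure lborel Z = 0" by simp
  then have "AE q in lborel. q \<notin> Z" by (intro AE_not_in) (simp add: null_sets_def)
  then show ?thesis by eventually_elim (auto simp: Z_def)
qed

section \<open>The transform of a product of waves as an image measure\<close>

lemma integrable_tensor:
  fixes f :: "'a::euclidean_space \<Rightarrow> complex" and k :: "'b::euclidean_space \<Rightarrow> complex"
  assumes f: "integrable lborel f" and k: "integrable lborel k"
  shows "integrable lborel (\<lambda>q. f (fst q) * k (snd q))"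
    and integral_tensor: "(LINT q|lborel. f (fst q) * k (snd q)) = (LINT x|lborel. f x) * (LINT y|lborel. k y)"
proof -
  have i: "integrable (lborel \<Otimes>\<^sub>M lborel) (\<lambda>(x, y). f x * k y)"
    using integrable_pair_bounded[OF f k, of "\<lambda>_. 1"] by simp
  then show "integrable lborel (\<lambda>q. f (fst q) * k (snd q))"
    unfolding lborel_prod split_beta .
  have "(LINT x|lborel. (LINT y|lborel. f x * k y)) = (LINT q|lborel. f (fst q) * k (snd q))"
    using lborel_pair.integral_fst[OF i] unfolding lborel_prod split_beta .
  then show "(LINT q|lborel. f (fst q) * k (snd q)) = (LINT x|lborel. f x) * (LINT y|lborel. k y)"
    by simp
qed

text \<open>The product of the two inversion integrals is one double integral. Conjugation reverses
  energy and momentum of the second wave, which puts differences into the phase.\<close>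

lemma kg_solution_mult_cnj:
  fixes f g :: "'a::euclidean_space \<Rightarrow> complex"
  assumes F: "integrable lborel (fourier f)" and G: "integrable lborel (fourier g)"
  shows "kg_solution s f p * cnj (kg_solution s g p) = complex_of_real (1 / (2 * pi) ^ (2 * DIM('a))) *
    (LINT q|lborel. fourier f (fst q) * cnj (fourier g (snd q)) * cis (p \<bullet> momentum_diff s q))"
proof (cases p)
  case (Pair t x)
  define c where "c = complex_of_real (1 / (2 * pi) ^ DIM('a))"
  define a where "a h \<eta> = cis (x \<bullet> \<eta>) * (cis (t * kg_phi s (norm \<eta>)) * fourier h \<eta>)" for h \<eta>
  have i: "integrable lborel (a h)" if "integrable lborel (fourier h)" for h
    unfolding a_def by (intro integrable_cis_mult that) measurable
  have k: "kg_solution s h p = c * (LINT \<eta>|lborel. a h \<eta>)" for h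
    by (simp add: Pair kg_solution_def inv_fourier_def a_def c_def)
  have "kg_solution s f p * cnj (kg_solution s g p) = c * c * ((LINT \<eta>|lborel. a f \<eta>) * (LINT \<zeta>|lborel. cnj (a g \<zeta>)))"
    unfolding k Bochner_Integration.integral_cnj complex_cnj_mult by (simp add: c_def)
  also have "(LINT \<eta>|lborel. a f \<eta>) * (LINT \<zeta>|lborel. cnj (a g \<zeta>)) = (LINT q|lborel. a f (fst q) * cnj (a g (snd q)))"
    by (rule integral_tensor[symmetric]) (intro integrable_cnj i F G)+
  also have "\<dots> = (LINT q|lborel. fourier f (fst q) * cnj (fourier g (snd q)) * cis (p \<bullet> momentum_diff s q))"
  proof (intro Bochner_Integration.integral_cong refl)
    fix q :: "'a \<times> 'a"
    obtain \<eta> \<zeta> where q: "q = (\<eta>, \<zeta>)" by (cases q)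
    have "cis (p \<bullet> momentum_diff s q) = cis (x \<bullet> \<eta>) * cis (t * kg_phi s (norm \<eta>)) * cnj (cis (x \<bullet> \<zeta>) * cis (t * kg_phi s (norm \<zeta>)))"
      by (simp add: q Pair momentum_diff_def cis_cnj cis_mult algebra_simps inner_diff_right)
    then show "a f (fst q) * cnj (a g (snd q)) = fourier f (fst q) * cnj (fourier g (snd q)) * cis (p \<bullet> momentum_diff s q)"
      by (simp add: a_def q mult_ac)
  qed
  also have "c * c = complex_of_real (1 / (2 * pi) ^ (2 * DIM('a)))"
  proof -
    have "1 / a ^ n * (1 / a ^ n) = 1 / a ^ (2 * n)" for a :: real and n by (simp add: mult_2 power_add)
    then show ?thesis unfolding c_def of_real_mult[symmetric] by (rule arg_cong)
  qed
  finally show ?thesis .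
qed

lemma tempered_fun_kg_product:
  fixes f g :: "'a::euclidean_space \<Rightarrow> complex"
  assumes F: "integrable lborel (fourier f)" and G: "integrable lborel (fourier g)"
  shows "tempered_fun (\<lambda>p. kg_solution s f p * cnj (kg_solution s g p))"
proof (rule tempered_fun_bounded)
  note [measurable] = measurable_kg_solution[OF F] measurable_kg_solution[OF G]
  show "(\<lambda>p. kg_solution s f p * cnj (kg_solution s g p)) \<in> borel_measurable borel" by measurable
  show "norm (kg_solution s f p * cnj (kg_solution s g p)) \<le>
    (LINT \<xi>|lborel. norm (fourier f \<xi>)) / (2 * pi) ^ DIM('a) * ((LINT \<xi>|lborel. norm (fourier g \<xi>)) / (2 * pi) ^ DIM('a))" for p
    unfolding norm_mult complex_mod_cnj
    by (intro mult_mono norm_kg_solution_le F G) auto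
qed

text \<open>Fubini brings the space-time integral inside, where Fourier inversion evaluates it as
  the test function at the momentum difference. Space-time inversion contributes (2 pi)^(d+1), the
  two spatial inverse transforms (2 pi)^(-2d).\<close>

lemma fourier_distr_kg_product:
  fixes f g :: "'a::euclidean_space \<Rightarrow> complex"
  assumes F: "integrable lborel (fourier f)" and G: "integrable lborel (fourier g)" and \<phi>: "\<phi> \<in> schwartz"
  shows "fourier_distr (distr_of (\<lambda>p. kg_solution s f p * cnj (kg_solution s g p))) \<phi> =
    complex_of_real ((2 * pi) ^ (DIM('a) + 1) / (2 * pi) ^ (2 * DIM('a))) *
    (LINT q|lborel. fourier f (fst q) * cnj (fourier g (snd q)) * \<phi> (momentum_diff s q))"
proof -
  define \<Phi> where "\<Phi> q = fourier f (fst q) * cnj (fourier g (snd q))" for q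
  define c where "c = complex_of_real (1 / (2 * pi) ^ (2 * DIM('a)))"
  have c: "c * complex_of_real ((2 * pi) ^ (DIM('a) + 1)) = complex_of_real ((2 * pi) ^ (DIM('a) + 1) / (2 * pi) ^ (2 * DIM('a)))"
  proof -
    have "1 / b * a = a / b" for a b :: real by simp
    then show ?thesis unfolding c_def of_real_mult[symmetric] by (rule arg_cong)
  qed
  have \<Phi>: "integrable lborel \<Phi>" unfolding \<Phi>_def by (intro integrable_tensor integrable_cnj F G)
  have \<phi>i: "integrable lborel (fourier \<phi>)" using integrable_fourier_schwartz[OF \<phi>, of "\<lambda>_. 1" 1] by simp
  let ?h = "\<lambda>p q. fourier \<phi> p * \<Phi> q * cis (p \<bullet> momentum_diff s q)"
  have b: "(\<lambda>x. cis (fst x \<bullet> momentum_diff s (snd x))) \<in> borel_measurable (borel :: ((real \<times> 'a) \<times> ('a \<times> 'a)) measure)"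
  proof -
    have "(\<lambda>x. momentum_diff s (snd x)) \<in> borel_measurable (borel :: ((real \<times> 'a) \<times> ('a \<times> 'a)) measure)"
      by (rule measurable_compose[OF _ measurable_momentum_diff]) (intro borel_measurable_continuous_onI continuous_intros)
    moreover have "fst \<in> borel_measurable (borel :: ((real \<times> 'a) \<times> ('a \<times> 'a)) measure)"
      by (intro borel_measurable_continuous_onI continuous_intros)
    ultimately show ?thesis by (intro measurable_compose[OF _ measurable_cis] borel_measurable_inner)
  qed
  have hi: "integrable (lborel \<Otimes>\<^sub>M lborel) (\<lambda>(p, q). ?h p q)"
    using integrable_pair_bounded[OF \<phi>i \<Phi> b] by simp
  have "fourier_distr (distr_of (\<lambda>p. kg_solution s f p * cnj (kg_solution s g p))) \<phi> =
      (LINT p|lborel. c * (LINT q|lborel. \<Phi> q * cis (p \<bullet> momentum_diff s q)) * fourier \<phi> p)"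
    by (simp add: fourier_distr_def distr_of_def kg_solution_mult_cnj[OF F G] c_def \<Phi>_def)
  also have "\<dots> = (LINT p|lborel. c * (LINT q|lborel. ?h p q))"
  proof (intro Bochner_Integration.integral_cong refl)
    fix p
    have "(LINT q|lborel. ?h p q) = (LINT q|lborel. fourier \<phi> p * (\<Phi> q * cis (p \<bullet> momentum_diff s q)))"
      by (simp add: mult_ac)
    then show "c * (LINT q|lborel. \<Phi> q * cis (p \<bullet> momentum_diff s q)) * fourier \<phi> p = c * (LINT q|lborel. ?h p q)"
      by simp
  qed
  also have "\<dots> = c * (LINT p|lborel. (LINT q|lborel. ?h p q))" by (rule integral_mult_right_zero)
  also have "(LINT p|lborel. (LINT q|lborel. ?h p q)) = (LINT q|lborel. (LINT p|lborel. ?h p q))"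
    using lborel_pair.Fubini_integral[OF hi] by simp
  also have "\<dots> = (LINT q|lborel. (2 * pi) ^ (DIM('a) + 1) * (\<Phi> q * \<phi> (momentum_diff s q)))"
  proof (intro Bochner_Integration.integral_cong refl)
    fix q
    obtain B where B: "\<And>x. norm (\<phi> x) \<le> B" using bounded_schwartz[OF \<phi>] by blast
    have "(LINT p|lborel. ?h p q) = (LINT p|lborel. \<Phi> q * (cis (momentum_diff s q \<bullet> p) * fourier \<phi> p))"
      by (simp add: mult_ac inner_commute)
    also have "\<dots> = \<Phi> q * ((2 * pi) ^ (DIM('a) + 1) * inv_fourier (fourier \<phi>) (momentum_diff s q))"
      by (simp add: inv_fourier_def)
    also have "inv_fourier (fourier \<phi>) (momentum_diff s q) = \<phi> (momentum_diff s q)"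
      by (rule inv_fourier_fourier[OF integrable_schwartz[OF \<phi>] continuous_schwartz[OF \<phi>] B \<phi>i])
    finally show "(LINT p|lborel. ?h p q) = (2 * pi) ^ (DIM('a) + 1) * (\<Phi> q * \<phi> (momentum_diff s q))"
      by (simp add: mult_ac)
  qed
  also have "\<dots> = (2 * pi) ^ (DIM('a) + 1) * (LINT q|lborel. \<Phi> q * \<phi> (momentum_diff s q))"
    by (rule integral_mult_right_zero)
  also have "c * ((2 * pi) ^ (DIM('a) + 1) * (LINT q|lborel. \<Phi> q * \<phi> (momentum_diff s q))) =
     complex_of_real ((2 * pi) ^ (DIM('a) + 1) / (2 * pi) ^ (2 * DIM('a))) * (LINT q|lborel. \<Phi> q * \<phi> (momentum_diff s q))"
    by (subst mult.assoc[symmetric], subst c) (rule refl)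
  finally show ?thesis unfolding \<Phi>_def .
qed

text \<open>Cauchy-Schwarz against the indicator of \<open>S\<close>: spreading mass I over volume
  at most V costs at least I^2 / V in squared norm.\<close>

lemma nn_integral_power2_ge:
  fixes h :: "'a \<Rightarrow> ennreal"
  assumes [measurable]: "h \<in> borel_measurable M" "S \<in> sets M"
    and V: "emeasure M S \<le> ennreal V" "V > 0" and I: "(\<integral>\<^sup>+x\<in>S. h x \<partial>M) = ennreal I" "I \<ge> 0"
  shows "ennreal (I\<^sup>2 / V) \<le> (\<integral>\<^sup>+x\<in>S. (h x)\<^sup>2 \<partial>M)"
proof -
  have "ennreal I = (\<integral>\<^sup>+x. (h x * indicator S x) * indicator S x \<partial>M)"
    unfolding I(1)[symmetric] by (intro nn_integral_cong) (simp add: indicator_def)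
  then have "(ennreal I)\<^sup>2 = (\<integral>\<^sup>+x. (h x * indicator S x) * indicator S x \<partial>M)\<^sup>2"
    by (rule arg_cong)
  also have "\<dots> \<le> (\<integral>\<^sup>+x. (h x * indicator S x)\<^sup>2 \<partial>M) * (\<integral>\<^sup>+x. (indicator S x)\<^sup>2 \<partial>M)"
    by (rule Cauchy_Schwarz_nn_integral) auto
  also have "(\<integral>\<^sup>+x. (h x * indicator S x)\<^sup>2 \<partial>M) = (\<integral>\<^sup>+x\<in>S. (h x)\<^sup>2 \<partial>M)"
    by (auto simp: indicator_def intro!: nn_integral_cong)
  also have "(\<integral>\<^sup>+x. (indicator S x)\<^sup>2 \<partial>M) = (\<integral>\<^sup>+x. indicator S x \<partial>M)"
    by (auto simp: indicator_def intro!: nn_integral_cong)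
  also have "\<dots> = emeasure M S" by simp
  also have "(\<integral>\<^sup>+x\<in>S. (h x)\<^sup>2 \<partial>M) * emeasure M S \<le> (\<integral>\<^sup>+x\<in>S. (h x)\<^sup>2 \<partial>M) * ennreal V"
    by (intro mult_left_mono V) simp
  finally have le: "ennreal (I\<^sup>2) \<le> (\<integral>\<^sup>+x\<in>S. (h x)\<^sup>2 \<partial>M) * ennreal V"
    using I(2) by (simp add: ennreal_power)
  show ?thesis
  \<comment> \<open>An infinite integral leaves nothing to show; otherwise the division takes place
    in the reals.\<close>
  proof (cases "\<integral>\<^sup>+x\<in>S. (h x)\<^sup>2 \<partial>M")
    case (real y)
    then have "I\<^sup>2 \<le> y * V" using le V(2) by (simp add: ennreal_mult[of y V, symmetric])
    then show ?thesis using V(2) real by (simp add: pos_divide_le_eq ennreal_leI)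
  qed simp
qed

text \<open>The image measure \<open>\<nu>\<close> of the tensor product of \<open>F\<close> and
  \<open>H\<close> has a density, which up to a constant is the function \<open>G\<close> that
  \<open>box_norm_sq\<close> looks for. As \<open>S\<close> carries all of \<open>\<nu>\<close>, the
  density has on \<open>S\<close> the full product of the masses as integral. On \<open>S\<close>
  the squared symbol is at least \<kappa>, and Cauchy-Schwarz does the rest.\<close>

theorem box_norm_sq_kg_product_ge:
  fixes f g :: "'a::euclidean_space \<Rightarrow> complex" and F H :: "'a \<Rightarrow> real"
  assumes s: "s > 0" and e: "e \<in> Basis"
    and F: "\<And>\<xi>. fourier f \<xi> = complex_of_real (F \<xi>)" "\<And>\<xi>. F \<xi> \<ge> 0" "integrable lborel F"
    and H: "\<And>\<xi>. fourier g \<xi> = complex_of_real (H \<xi>)" "\<And>\<xi>. H \<xi> \<ge> 0" "integrable lborel H"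
    and suppF: "\<And>\<eta>. F \<eta> \<noteq> 0 \<Longrightarrow> norm \<eta> \<le> R \<and> \<eta> \<bullet> e \<ge> 1"
    and suppH: "\<And>\<zeta>. H \<zeta> \<noteq> 0 \<Longrightarrow> \<zeta> \<bullet> e \<le> -1"
    and S: "S \<in> sets borel" "\<And>\<eta> \<zeta>. F \<eta> \<noteq> 0 \<Longrightarrow> H \<zeta> \<noteq> 0 \<Longrightarrow> momentum_diff s (\<eta>, \<zeta>) \<in> S"
    and V: "emeasure lborel S \<le> ennreal V" "V > 0"
    and \<kappa>: "\<kappa> \<ge> 0" "\<And>\<tau> \<xi>. (\<tau>, \<xi>) \<in> S \<Longrightarrow> \<kappa> \<le> (\<bar>\<tau>\<^sup>2 - (norm \<xi>)\<^sup>2\<bar> powr \<beta>)\<^sup>2"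
  shows "ennreal (1 / (2 * pi) ^ (DIM('a) + 1) * (\<kappa> * ((2 * pi) ^ (DIM('a) + 1) / (2 * pi) ^ (2 * DIM('a)))\<^sup>2 *
      (((LINT \<xi>|lborel. F \<xi>) * (LINT \<xi>|lborel. H \<xi>))\<^sup>2 / V)))
    \<le> box_norm_sq \<beta> (\<lambda>p. kg_solution s f p * cnj (kg_solution s g p))"
proof -
  let ?W = "\<lambda>p. kg_solution s f p * cnj (kg_solution s g p)"
  define K where "K = (2 * pi) ^ (DIM('a) + 1) / (2 * pi) ^ (2 * DIM('a))"
  have K: "K > 0" unfolding K_def by (intro divide_pos_pos zero_less_power) auto
  have Fi: "integrable lborel (fourier f)" and Hi: "integrable lborel (fourier g)"
    unfolding F(1)[THEN ext] H(1)[THEN ext] complex_of_real_integrable_eq by (rule F(3), rule H(3))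
  have [measurable]: "F \<in> borel_measurable borel" "H \<in> borel_measurable borel" using F(3) H(3) by auto
  note [measurable] = S(1)
  define \<Phi> where "\<Phi> q = F (fst q) * H (snd q)" for q
  define I where "I = (LINT \<xi>|lborel. F \<xi>) * (LINT \<xi>|lborel. H \<xi>)"
  have \<Phi>0: "\<Phi> q \<ge> 0" for q using F(2) H(2) by (simp add: \<Phi>_def)
  have "integrable lborel (\<lambda>q. complex_of_real (F (fst q)) * complex_of_real (H (snd q)))"
      "(LINT q|lborel. complex_of_real (F (fst q)) * complex_of_real (H (snd q))) =
       (LINT x|lborel. complex_of_real (F x)) * (LINT x|lborel. complex_of_real (H x))"
    by (intro integrable_tensor integral_tensor; simp add: F H)+
  then have "integrable lborel (\<lambda>q. complex_of_real (\<Phi> q))" "(LINT q|lborel. complex_of_real (\<Phi> q)) = complex_of_real I"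
    by (simp_all add: \<Phi>_def I_def)
  then have \<Phi>: "integrable lborel \<Phi>" "(LINT q|lborel. \<Phi> q) = I"
    unfolding integral_complex_of_real complex_of_real_integrable_eq of_real_eq_iff by auto
  have [measurable]: "\<Phi> \<in> borel_measurable borel" using \<Phi>(1) by auto
  have I0: "I \<ge> 0" using F(2) H(2) by (simp add: I_def)
  define \<nu> where "\<nu> = distr (density lborel (\<lambda>q. ennreal (\<Phi> q))) borel (momentum_diff s)"
  have sets\<nu> [simp]: "sets \<nu> = sets borel" by (simp add: \<nu>_def)
  have emeas: "emeasure \<nu> A = (\<integral>\<^sup>+q. ennreal (\<Phi> q) * indicator A (momentum_diff s q) \<partial>lborel)" if "A \<in> sets borel" for A
    using that unfolding \<nu>_def
    by (subst emeasure_distr, simp, simp, subst emeasure_density)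
       (auto simp: indicator_def measurable_sets_borel[OF measurable_momentum_diff] intro!: nn_integral_cong)
  \<comment> \<open>Wherever the tensor product is nonzero the image point lies in \<open>S\<close>,
    so the indicator drops out.\<close>
  have S_all: "ennreal (\<Phi> q) * indicator S (momentum_diff s q) = ennreal (\<Phi> q)" for q
    using S(2)[of "fst q" "snd q"] by (cases "\<Phi> q = 0") (auto simp: \<Phi>_def)
  have \<nu>S: "emeasure \<nu> S = ennreal I"
    using \<Phi> \<Phi>0 by (simp add: emeas S S_all nn_integral_eq_integral)
  have \<nu>U: "emeasure \<nu> UNIV = ennreal I"
    using \<Phi> \<Phi>0 by (simp add: emeas nn_integral_eq_integral)
  \<comment> \<open>Almost every pair in the supports avoids the preimage of a null set, by the
    opposite signs in direction \<open>e\<close>; off the supports \<open>\<Phi>\<close>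
    vanishes.\<close>
  have ac: "absolutely_continuous lborel \<nu>"
    unfolding absolutely_continuous_def
  proof
    fix N assume N: "N \<in> null_sets (lborel :: (real \<times> 'a) measure)"
    then have Nb: "N \<in> sets borel" by auto
    have "emeasure \<nu> N = (\<integral>\<^sup>+q. 0 \<partial>(lborel :: ('a \<times> 'a) measure))"
      unfolding emeas[OF Nb]
    proof (rule nn_integral_cong_AE)
      show "AE q in lborel. ennreal (\<Phi> q) * indicator N (momentum_diff s q) = 0"
        using AE_momentum_diff_notin_null_set[OF s e N, of R]
      proof eventually_elim
        case (elim q)
        then show ?case using suppF[of "fst q"] suppH[of "snd q"]
          by (cases "\<Phi> q = 0") (auto simp: \<Phi>_def)
      qed
    qed
    then show "N \<in> null_sets \<nu>" using Nb by (auto simp: null_sets_def)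
  qed
  define h where "h = RN_deriv lborel \<nu>"
  have [measurable]: "h \<in> borel_measurable borel" using borel_measurable_RN_deriv[of lborel \<nu>] by (simp add: h_def)
  have h\<nu>: "density lborel h = \<nu>" unfolding h_def
    by (rule sigma_finite_measure.density_RN_deriv[OF sigma_finite_lborel ac]) simp
  have hS: "(\<integral>\<^sup>+x\<in>S. h x \<partial>lborel) = ennreal I"
    using \<nu>S S(1) unfolding h\<nu>[symmetric] by (simp add: emeasure_density)
  have hU: "(\<integral>\<^sup>+x. h x \<partial>lborel) = ennreal I"
    using \<nu>U unfolding h\<nu>[symmetric] by (simp add: emeasure_density)
  have hfin: "AE x in lborel. h x \<noteq> \<infinity>" by (rule nn_integral_PInf_AE) (simp_all add: hU)
  \<comment> \<open>A real-valued version of the density, equal to it almost everywhere because the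
    total mass is finite.\<close>
  define k where "k x = enn2real (h x)" for x
  have [measurable]: "k \<in> borel_measurable borel" unfolding k_def by measurable
  have k0: "k x \<ge> 0" for x by (simp add: k_def)
  have kh: "AE x in lborel. ennreal (k x) = h x" using hfin by eventually_elim (simp add: k_def less_top)
  have k\<nu>: "density lborel (\<lambda>x. ennreal (k x)) = \<nu>"
    unfolding h\<nu>[symmetric] by (rule density_cong) (use kh in auto)
  have kU: "(\<integral>\<^sup>+x. ennreal (k x) \<partial>lborel) = ennreal I" unfolding hU[symmetric] by (rule nn_integral_cong_AE[OF kh])
  have ki: "integrable lborel k"
    by (rule integrableI_nonneg) (auto simp: k0 kU)
  define G where "G x = complex_of_real (K * k x)" for x
  have Gi: "integrable lborel G" unfolding G_def using ki by simp
  have G: "represents G (fourier_distr (distr_of ?W))"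
    unfolding represents_def
  proof (intro conjI ballI tempered_fun_integrable Gi)
    fix \<phi> :: "real \<times> 'a \<Rightarrow> complex" assume \<phi>: "\<phi> \<in> schwartz"
    note [measurable] = measurable_schwartz[OF \<phi>]
    have "(LINT q|lborel. fourier f (fst q) * cnj (fourier g (snd q)) * \<phi> (momentum_diff s q)) = (LINT q|lborel. \<Phi> q *\<^sub>R \<phi> (momentum_diff s q))"
      by (simp add: F(1) H(1) \<Phi>_def scaleR_conv_of_real)
    also have "\<dots> = (LINT q|density lborel \<Phi>. \<phi> (momentum_diff s q))"
      by (subst integral_density) (auto simp: \<Phi>0)
    also have "\<dots> = (LINT x|\<nu>. \<phi> x)" unfolding \<nu>_def by (subst integral_distr) auto
    also have "\<dots> = (LINT x|lborel. k x *\<^sub>R \<phi> x)" unfolding k\<nu>[symmetric] by (subst integral_density) (auto simp: k0)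
    finally have "fourier_distr (distr_of ?W) \<phi> = K * (LINT x|lborel. k x *\<^sub>R \<phi> x)"
      unfolding fourier_distr_kg_product[OF Fi Hi \<phi>] K_def[symmetric] by (rule arg_cong)
    also have "\<dots> = (LINT x|lborel. K * (k x *\<^sub>R \<phi> x))" by (rule integral_mult_right_zero[symmetric])
    also have "\<dots> = distr_of G \<phi>" by (simp add: distr_of_def G_def scaleR_conv_of_real mult_ac)
    finally show "fourier_distr (distr_of ?W) \<phi> = distr_of G \<phi>" .
  qed
  have mult3: "ennreal a * (ennreal b * ennreal c) = ennreal (a * (b * c))" if "a \<ge> 0" "b \<ge> 0" "c \<ge> 0" for a b c
    using that by (simp add: ennreal_mult)
  have "ennreal (\<kappa> * K\<^sup>2) * ennreal (I\<^sup>2 / V) \<le> ennreal (\<kappa> * K\<^sup>2) * (\<integral>\<^sup>+x\<in>S. (ennreal (k x))\<^sup>2 \<partial>lborel)"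
  proof (intro mult_left_mono nn_integral_power2_ge V I0)
    show "(\<integral>\<^sup>+x\<in>S. ennreal (k x) \<partial>lborel) = ennreal I"
      unfolding hS[symmetric] by (rule nn_integral_cong_AE) (use kh in \<open>eventually_elim, simp\<close>)
  qed auto
  also have "\<dots> = (\<integral>\<^sup>+x. ennreal (\<kappa> * K\<^sup>2) * ((ennreal (k x))\<^sup>2 * indicator S x) \<partial>lborel)"
    by (rule nn_integral_cmult[symmetric]) measurable
  also have "\<dots> \<le> (\<integral>\<^sup>+(\<tau>, \<xi>). ennreal ((\<bar>\<tau>\<^sup>2 - (norm \<xi>)\<^sup>2\<bar> powr \<beta> * norm (G (\<tau>, \<xi>)))\<^sup>2) \<partial>lborel)"
  proof (rule nn_integral_mono)
    fix x :: "real \<times> 'a"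
    obtain \<tau> \<xi> where x: "x = (\<tau>, \<xi>)" by (cases x)
    have "\<kappa> * K\<^sup>2 * (k x)\<^sup>2 \<le> (\<bar>\<tau>\<^sup>2 - (norm \<xi>)\<^sup>2\<bar> powr \<beta>)\<^sup>2 * K\<^sup>2 * (k x)\<^sup>2" if "x \<in> S"
      using \<kappa>(2)[of \<tau> \<xi>] that x by (intro mult_right_mono) auto
    then have "\<kappa> * K\<^sup>2 * (k x)\<^sup>2 \<le> (\<bar>\<tau>\<^sup>2 - (norm \<xi>)\<^sup>2\<bar> powr \<beta> * norm (G x))\<^sup>2" if "x \<in> S"
      using that K k0[of x] by (simp add: G_def norm_mult power_mult_distrib mult_ac del: of_real_mult)
    then have "ennreal (\<kappa> * K\<^sup>2) * ((ennreal (k x))\<^sup>2 * indicator S x) \<le> ennreal ((\<bar>\<tau>\<^sup>2 - (norm \<xi>)\<^sup>2\<bar> powr \<beta> * norm (G x))\<^sup>2)"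
      using mult3[of 1 "\<kappa> * K\<^sup>2" "(k x)\<^sup>2"] \<kappa>(1) k0[of x]
      by (cases "x \<in> S") (simp_all add: ennreal_power ennreal_leI)
    then show "ennreal (\<kappa> * K\<^sup>2) * ((ennreal (k x))\<^sup>2 * indicator S x) \<le>
      (case x of (\<tau>, \<xi>) \<Rightarrow> ennreal ((\<bar>\<tau>\<^sup>2 - (norm \<xi>)\<^sup>2\<bar> powr \<beta> * norm (G (\<tau>, \<xi>)))\<^sup>2))"
      by (simp add: x)
  qed
  finally have "ennreal (1 / (2 * pi) ^ (DIM('a) + 1)) * (ennreal (\<kappa> * K\<^sup>2) * ennreal (I\<^sup>2 / V)) \<le>
      ennreal (1 / (2 * pi) ^ (DIM('a) + 1)) * (\<integral>\<^sup>+(\<tau>, \<xi>). ennreal ((\<bar>\<tau>\<^sup>2 - (norm \<xi>)\<^sup>2\<bar> powr \<beta> * norm (G (\<tau>, \<xi>)))\<^sup>2) \<partial>lborel)"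
    by (rule mult_left_mono) simp
  also have "\<dots> \<le> box_norm_sq \<beta> ?W"
    unfolding box_norm_sq_def by (intro SUP_upper CollectI conjI G tempered_fun_kg_product Fi Hi)
  also have "ennreal (1 / (2 * pi) ^ (DIM('a) + 1)) * (ennreal (\<kappa> * K\<^sup>2) * ennreal (I\<^sup>2 / V)) =
      ennreal (1 / (2 * pi) ^ (DIM('a) + 1) * (\<kappa> * K\<^sup>2 * (I\<^sup>2 / V)))"
    using \<kappa>(1) V(2) by (intro mult3) auto
  finally show ?thesis unfolding K_def I_def .
qed

subsection \<open>Tent functions\<close>

text \<open>A product of one-dimensional hats whose heights and half-widths are the components of
  \<open>w\<close>. The inverse transform of a box indicator is a product of sinc functions and not
  integrable; that of a hat is a Fejer kernel, which is integrable.\<close>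

definition tent :: "'a::euclidean_space \<Rightarrow> 'a \<Rightarrow> 'a \<Rightarrow> real" where
  "tent c w \<xi> = (\<Prod>b\<in>Basis. max 0 (w \<bullet> b - \<bar>(\<xi> - c) \<bullet> b\<bar>))"

lemma continuous_tent [continuous_intros]: "continuous_on A (tent c w)"
  unfolding tent_def by (intro continuous_intros)

lemma measurable_tent [measurable]: "tent c w \<in> borel_measurable borel"
  by (intro borel_measurable_continuous_onI continuous_intros)

lemma tent_nonneg: "tent c w \<xi> \<ge> 0"
  unfolding tent_def by (intro prod_nonneg) auto

lemma tent_supp: "tent c w \<xi> \<noteq> 0 \<Longrightarrow> b \<in> Basis \<Longrightarrow> \<bar>(\<xi> - c) \<bullet> b\<bar> < w \<bullet> b"
  unfolding tent_def by (auto simp: prod_zero_iff max_def split: if_splits)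

lemma tent_supp_cbox: "tent c w \<xi> \<noteq> 0 \<Longrightarrow> \<xi> \<in> cbox (c - w) (c + w)"
  using tent_supp[of c w \<xi>] by (fastforce simp: mem_box inner_diff_left inner_add_left abs_less_iff)

lemma tent_le:
  assumes "\<And>b. b \<in> Basis \<Longrightarrow> w \<bullet> b > 0"
  shows "tent c w \<xi> \<le> (\<Prod>b\<in>Basis. w \<bullet> b)"
  unfolding tent_def by (intro prod_mono) (use assms in \<open>auto simp: less_imp_le\<close>)

lemma integrable_tent: "integrable lborel (tent c w)"
proof -
  have "integrable lborel (\<lambda>\<xi>. indicator (cbox (c - w) (c + w)) \<xi> *\<^sub>R tent c w \<xi>)"
    by (intro borel_integrable_compact compact_cbox continuous_intros)
  moreover have "indicator (cbox (c - w) (c + w)) \<xi> *\<^sub>R tent c w \<xi> = tent c w \<xi>" for \<xi>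
    using tent_supp_cbox[of c w \<xi>] by (auto simp: indicator_def)
  ultimately show ?thesis by (simp only:)
qed

text \<open>On the concentric box of half the size, whose volume is the product of the components of
  \<open>w\<close>, each factor is at least half its maximum.\<close>

lemma integral_tent_ge:
  fixes c w :: "'a::euclidean_space"
  assumes w: "\<And>b. b \<in> Basis \<Longrightarrow> w \<bullet> b > 0"
  shows "(\<Prod>b\<in>Basis. w \<bullet> b)\<^sup>2 / 2 ^ DIM('a) \<le> (LINT \<xi>|lborel. tent c w \<xi>)"
proof -
  let ?B = "cbox (c - w /\<^sub>R 2) (c + w /\<^sub>R 2)"
  have vol: "measure lborel ?B = (\<Prod>b\<in>Basis. w \<bullet> b)"
    using w by (subst measure_lborel_cbox_eq) (auto simp: inner_simps less_imp_le algebra_simps intro!: prod.cong)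
  have "(\<Prod>b\<in>Basis. w \<bullet> b)\<^sup>2 / 2 ^ DIM('a) = (LINT \<xi>|lborel. (\<Prod>b\<in>Basis. w \<bullet> b / 2) * indicator ?B \<xi>)"
    using vol by (simp add: power2_eq_square prod_dividef)
  also have "\<dots> \<le> (LINT \<xi>|lborel. tent c w \<xi>)"
  proof (rule integral_mono)
    show "(\<Prod>b\<in>Basis. w \<bullet> b / 2) * indicator ?B \<xi> \<le> tent c w \<xi>" for \<xi>
    proof (cases "\<xi> \<in> ?B")
      case True
      have "(\<Prod>b\<in>Basis. w \<bullet> b / 2) \<le> tent c w \<xi>"
        unfolding tent_def
      proof (intro prod_mono conjI)
        fix b :: 'a assume b: "b \<in> Basis"
        have "c \<bullet> b - w \<bullet> b / 2 \<le> \<xi> \<bullet> b \<and> \<xi> \<bullet> b \<le> c \<bullet> b + w \<bullet> b / 2"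
          using True b by (simp add: mem_box inner_simps)
        then have "\<bar>(\<xi> - c) \<bullet> b\<bar> \<le> w \<bullet> b / 2" unfolding inner_diff_left by linarith
        then show "w \<bullet> b / 2 \<le> max 0 (w \<bullet> b - \<bar>(\<xi> - c) \<bullet> b\<bar>)" by linarith
      qed (use w in \<open>auto simp: less_imp_le\<close>)
      then show ?thesis using True by simp
    qed (simp add: tent_nonneg)
  qed (auto intro!: integrable_tent integrable_real_indicator simp: emeasure_lborel_cbox_eq)
  finally show ?thesis .
qed

text \<open>Squared supremum times the volume of the supporting box; \<open>2 ^ DIM('a)\<close>
  enters because \<open>w\<close> holds half-widths.\<close>

lemma nn_integral_tent_le:
  fixes c w :: "'a::euclidean_space"
  assumes w: "\<And>b. b \<in> Basis \<Longrightarrow> w \<bullet> b > 0"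
    and \<psi>: "\<And>\<xi>. tent c w \<xi> \<noteq> 0 \<Longrightarrow> 0 \<le> \<psi> \<xi> \<and> \<psi> \<xi> \<le> P"
  shows "(\<integral>\<^sup>+\<xi>. ennreal ((\<psi> \<xi> * tent c w \<xi>)\<^sup>2) \<partial>lborel)
    \<le> ennreal ((P * (\<Prod>b\<in>Basis. w \<bullet> b))\<^sup>2 * (2 ^ DIM('a) * (\<Prod>b\<in>Basis. w \<bullet> b)))"
proof -
  let ?B = "cbox (c - w) (c + w)"
  have vol: "emeasure lborel ?B = ennreal (2 ^ DIM('a) * (\<Prod>b\<in>Basis. w \<bullet> b))"
  proof -
    have "(\<Prod>b\<in>Basis. (c + w - (c - w)) \<bullet> b) = (\<Prod>b\<in>Basis. 2 * (w \<bullet> b))"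
      by (intro prod.cong refl) (simp add: inner_simps)
    also have "\<dots> = 2 ^ DIM('a) * (\<Prod>b\<in>Basis. w \<bullet> b)" by (simp add: prod.distrib)
    finally show ?thesis
      using w by (subst emeasure_lborel_cbox_eq) (auto simp: inner_simps less_imp_le)
  qed
  have "(\<integral>\<^sup>+\<xi>. ennreal ((\<psi> \<xi> * tent c w \<xi>)\<^sup>2) \<partial>lborel) \<le> (\<integral>\<^sup>+\<xi>. ennreal ((P * (\<Prod>b\<in>Basis. w \<bullet> b))\<^sup>2) * indicator ?B \<xi> \<partial>lborel)"
  proof (rule nn_integral_mono)
    fix \<xi>
    show "ennreal ((\<psi> \<xi> * tent c w \<xi>)\<^sup>2) \<le> ennreal ((P * (\<Prod>b\<in>Basis. w \<bullet> b))\<^sup>2) * indicator ?B \<xi>"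
    proof (cases "tent c w \<xi> = 0")
      case False
      have "(\<psi> \<xi> * tent c w \<xi>)\<^sup>2 \<le> (P * (\<Prod>b\<in>Basis. w \<bullet> b))\<^sup>2"
        using \<psi>[OF False] tent_nonneg[of c w \<xi>] tent_le[OF w, of c \<xi>] by (intro power_mono mult_mono) auto
      then show ?thesis using tent_supp_cbox[OF False] by (simp add: ennreal_leI)
    qed simp
  qed
  also have "\<dots> = ennreal ((P * (\<Prod>b\<in>Basis. w \<bullet> b))\<^sup>2) * emeasure lborel ?B"
    by (rule nn_integral_cmult_indicator) simp
  also have "\<dots> = ennreal ((P * (\<Prod>b\<in>Basis. w \<bullet> b))\<^sup>2 * (2 ^ DIM('a) * (\<Prod>b\<in>Basis. w \<bullet> b)))"
    unfolding vol using w by (intro ennreal_mult[symmetric] mult_nonneg_nonneg prod_nonneg) (auto simp: less_imp_le)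
  finally show ?thesis .
qed

text \<open>Two intervals of length w_b shifted against each other by y_b overlap in length w_b -
  |y_b|, or not at all. This geometric form exhibits the tent as a correlation of box
  indicators.\<close>

lemma tent_eq_measure:
  fixes c w :: "'a::euclidean_space"
  assumes w: "\<And>b. b \<in> Basis \<Longrightarrow> w \<bullet> b > 0"
  shows "tent c w \<xi> = measure lborel (cbox 0 w \<inter> cbox (\<xi> - c) (\<xi> - c + w))"
proof -
  define y where "y = \<xi> - c"
  \<comment> \<open>The lower and upper corners of the intersection of the two boxes.\<close>
  define l u where "l = (\<Sum>b\<in>Basis. max (0 \<bullet> b) (y \<bullet> b) *\<^sub>R b)" and "u = (\<Sum>b\<in>Basis. min (w \<bullet> b) ((y + w) \<bullet> b) *\<^sub>R b)"
  have lu: "(u - l) \<bullet> b = w \<bullet> b - \<bar>y \<bullet> b\<bar>" "l \<bullet> b \<le> u \<bullet> b \<longleftrightarrow> \<bar>y \<bullet> b\<bar> \<le> w \<bullet> b" if "b \<in> Basis" for b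
    using that w[OF that] by (auto simp: l_def u_def inner_simps inner_Basis max_def min_def abs_if)
  have "measure lborel (cbox 0 w \<inter> cbox y (y + w)) = measure lborel (cbox l u)"
    by (simp add: Int_interval l_def u_def)
  also have "\<dots> = (\<Prod>b\<in>Basis. max 0 (w \<bullet> b - \<bar>y \<bullet> b\<bar>))"
  proof (cases "\<forall>b\<in>Basis. l \<bullet> b \<le> u \<bullet> b")
    case True
    then show ?thesis by (subst measure_lborel_cbox_eq) (auto simp: lu intro!: prod.cong)
  next
    case False
    then obtain b where b: "b \<in> Basis" "\<not> \<bar>y \<bullet> b\<bar> \<le> w \<bullet> b" using lu by blast
    then have "(\<Prod>b\<in>Basis. max 0 (w \<bullet> b - \<bar>y \<bullet> b\<bar>)) = 0"
      by (intro prod_zero bexI[OF _ b(1)]) auto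
    then show ?thesis using False by (subst measure_lborel_cbox_eq) auto
  qed
  finally show ?thesis by (simp add: tent_def y_def)
qed

text \<open>A tent function is the autocorrelation of the indicator of a box, up to a translation. Hence its
  inverse Fourier transform has the modulus of a squared \<open>L\<^sup>2\<close> function.\<close>

lemma integrable_inv_fourier_tent:
  fixes c w :: "'a::euclidean_space"
  assumes w: "\<And>b. b \<in> Basis \<Longrightarrow> w \<bullet> b > 0"
  shows "integrable lborel (inv_fourier (\<lambda>\<xi>. complex_of_real (tent c w \<xi>)))"
proof -
  define A :: "'a \<Rightarrow> complex" where "A = (\<lambda>\<eta>. complex_of_real (indicator (cbox 0 w) \<eta>))"
  have A [measurable]: "A \<in> borel_measurable borel" by (simp add: A_def)
  have Ai: "integrable lborel A"
    unfolding A_def complex_of_real_integrable_eq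
    by (intro integrable_real_indicator) (auto simp: emeasure_lborel_cbox_eq)
  have ti: "integrable lborel (\<lambda>\<xi>. complex_of_real (tent c w \<xi>))" using integrable_tent[of c w] by simp
  have cnjA: "cnj (A \<zeta>) = A \<zeta>" for \<zeta> by (simp add: A_def indicator_def)
  \<comment> \<open>The factor \<open>cis (x \<bullet> c)\<close> is the phase of the translation by
    \<open>c\<close>; having modulus 1, it disappears from the norm below.\<close>
  have eq: "complex_of_real (norm (LINT \<eta>|lborel. cis (x \<bullet> \<eta>) * A \<eta>) ^ 2) * cis (x \<bullet> c) = (LINT \<xi>|lborel. cis (x \<bullet> \<xi>) * tent c w \<xi>)" for x
  proof -
    let ?h = "\<lambda>\<eta> \<xi>. A \<eta> * A (\<eta> + c - \<xi>) * cis (x \<bullet> \<xi>)"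
    have "(LINT \<eta>|lborel. cis (x \<bullet> \<eta>) * A \<eta>) * cnj (LINT \<eta>|lborel. cis (x \<bullet> \<eta>) * A \<eta>) * cis (x \<bullet> c)
      = (LINT \<eta>|lborel. cis (x \<bullet> \<eta>) * A \<eta> * (LINT \<zeta>|lborel. cis (x \<bullet> c) * cnj (cis (x \<bullet> \<zeta>) * A \<zeta>)))"
      unfolding integral_mult_left_zero integral_mult_right_zero Bochner_Integration.integral_cnj by (simp only: mult_ac)
    also have "\<dots> = (LINT \<eta>|lborel. (LINT \<xi>|lborel. ?h \<eta> \<xi>))"
    proof (intro Bochner_Integration.integral_cong refl)
      fix \<eta> :: 'a
      \<comment> \<open>The substitution \<zeta> = \<eta> + c - \<xi> turns the product of the two
        transforms into the transform of a correlation.\<close>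
      have "(LINT \<xi>|lborel. ?h \<eta> \<xi>) = (LINT \<zeta>|lborel. A \<eta> * A \<zeta> * cis (x \<bullet> (\<eta> + c - \<zeta>)))"
        by (subst lborel_integral_affine[of "-1" _ "\<eta> + c"]) auto
      also have "\<dots> = (LINT \<zeta>|lborel. (cis (x \<bullet> \<eta>) * A \<eta>) * (cis (x \<bullet> c) * cnj (cis (x \<bullet> \<zeta>) * A \<zeta>)))"
        unfolding complex_cnj_mult cnjA cis_cnj inner_add_right diff_conv_add_uminus inner_minus_right cis_mult[symmetric]
        by (simp only: mult_ac)
      finally show "cis (x \<bullet> \<eta>) * A \<eta> * (LINT \<zeta>|lborel. cis (x \<bullet> c) * cnj (cis (x \<bullet> \<zeta>) * A \<zeta>)) = (LINT \<xi>|lborel. ?h \<eta> \<xi>)"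
        by (simp only: integral_mult_right_zero)
    qed
    also have "\<dots> = (LINT \<xi>|lborel. (LINT \<eta>|lborel. ?h \<eta> \<xi>))"
    proof (rule lborel_pair.Fubini_integral[symmetric])
      have m1: "(\<lambda>p. A (fst p + c - snd p)) \<in> borel_measurable (borel :: ('a \<times> 'a) measure)"
        by (rule measurable_compose[OF _ A]) (intro borel_measurable_continuous_onI continuous_intros)
      have m2: "(\<lambda>p. A (fst p)) \<in> borel_measurable (borel :: ('a \<times> 'a) measure)"
        by (rule measurable_compose[OF _ A]) (intro borel_measurable_continuous_onI continuous_intros)
      have m3: "(\<lambda>p. cis (x \<bullet> snd p)) \<in> borel_measurable (borel :: ('a \<times> 'a) measure)"
        by (intro borel_measurable_continuous_onI continuous_intros)
      have m: "(\<lambda>(\<eta>, \<xi>). ?h \<eta> \<xi>) \<in> borel_measurable (lborel \<Otimes>\<^sub>M lborel)"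
        unfolding lborel_prod split_beta using m1 m2 m3 by simp
      have Ai': "integrable lborel (\<lambda>\<xi>. A (\<eta> + c - \<xi>))" for \<eta>
        using lborel_integrable_affine[of "-1" A "\<eta> + c"] Ai by simp
      have "(LINT \<xi>|lborel. norm (?h \<eta> \<xi>)) = norm (A \<eta>) * (LINT \<zeta>|lborel. norm (A \<zeta>))" for \<eta>
        by (subst (2) lborel_integral_affine[of "-1" _ "\<eta> + c"]) (auto simp: norm_mult)
      then show "integrable (lborel \<Otimes>\<^sub>M lborel) (\<lambda>(\<eta>, \<xi>). ?h \<eta> \<xi>)"
        by (intro lborel_pair.Fubini_integrable m)
           (use Ai Ai' in \<open>auto intro!: integrable_mult_bounded[where B=1] integrable_mult_right simp: mult.assoc\<close>)
    qed
    also have "\<dots> = (LINT \<xi>|lborel. cis (x \<bullet> \<xi>) * tent c w \<xi>)"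
    proof (intro Bochner_Integration.integral_cong refl)
      fix \<xi> :: 'a
      have "A \<eta> * A (\<eta> + c - \<xi>) = complex_of_real (indicator (cbox 0 w \<inter> cbox (\<xi> - c) (\<xi> - c + w)) \<eta>)" for \<eta>
        by (auto simp: A_def indicator_def mem_box inner_simps algebra_simps)
      then have "(LINT \<eta>|lborel. ?h \<eta> \<xi>) = (LINT \<eta>|lborel. cis (x \<bullet> \<xi>) * complex_of_real (indicator (cbox 0 w \<inter> cbox (\<xi> - c) (\<xi> - c + w)) \<eta>))"
        by (simp add: mult.commute)
      also have "\<dots> = cis (x \<bullet> \<xi>) * tent c w \<xi>"
        unfolding integral_mult_right_zero integral_complex_of_real using tent_eq_measure[OF w, of c \<xi>] by simp
      finally show "(LINT \<eta>|lborel. ?h \<eta> \<xi>) = cis (x \<bullet> \<xi>) * tent c w \<xi>" .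
    qed
    finally show ?thesis by (simp only: complex_norm_square)
  qed
  \<comment> \<open>Squaring \<open>inv_fourier A\<close> brings in the normalisation twice, the
    tent carries it once; the factor \<open>(2 * pi) ^ DIM('a)\<close> restores the balance.\<close>
  have n: "norm (inv_fourier (\<lambda>\<xi>. complex_of_real (tent c w \<xi>)) x) = (2 * pi) ^ DIM('a) * (norm (inv_fourier A x))\<^sup>2" for x
  proof -
    have "norm (inv_fourier (\<lambda>\<xi>. complex_of_real (tent c w \<xi>)) x) = 1 / (2 * pi) ^ DIM('a) * norm (LINT \<eta>|lborel. cis (x \<bullet> \<eta>) * A \<eta>) ^ 2"
      unfolding inv_fourier_def eq[symmetric] norm_mult norm_of_real norm_cis by simp
    moreover have "norm (inv_fourier A x) = 1 / (2 * pi) ^ DIM('a) * norm (LINT \<eta>|lborel. cis (x \<bullet> \<eta>) * A \<eta>)"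
      unfolding inv_fourier_def norm_mult norm_of_real by simp
    moreover have "1 / a * t\<^sup>2 = a * (1 / a * t)\<^sup>2" if "a > 0" for a t :: real
      using that by (simp add: power2_eq_square)
    ultimately show ?thesis by simp
  qed
  \<comment> \<open>The Plancherel inequality for \<open>A\<close> bounds this L^1 norm by the
    volume of the box.\<close>
  have "(\<integral>\<^sup>+x. ennreal (norm (inv_fourier (\<lambda>\<xi>. complex_of_real (tent c w \<xi>)) x)) \<partial>lborel) =
      ennreal ((2 * pi) ^ DIM('a)) * (\<integral>\<^sup>+x. ennreal ((norm (inv_fourier A x))\<^sup>2) \<partial>lborel)"
    unfolding n using measurable_fourier_transforms(1)[OF Ai] by (simp add: ennreal_mult nn_integral_cmult)
  also have "\<dots> \<le> ennreal ((2 * pi) ^ DIM('a)) * (ennreal (1 / (2 * pi) ^ DIM('a)) * (\<integral>\<^sup>+\<xi>. ennreal ((norm (A \<xi>))\<^sup>2) \<partial>lborel))"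
    by (intro mult_left_mono nn_integral_inv_fourier_le Ai) simp
  also have "(\<integral>\<^sup>+\<xi>. ennreal ((norm (A \<xi>))\<^sup>2) \<partial>lborel) = (\<integral>\<^sup>+\<xi>. indicator (cbox 0 w) \<xi> \<partial>lborel)"
    by (intro nn_integral_cong) (simp add: A_def indicator_def)
  also have "\<dots> = emeasure lborel (cbox 0 w)" by simp
  also have "ennreal ((2 * pi) ^ DIM('a)) * (ennreal (1 / (2 * pi) ^ DIM('a)) * emeasure lborel (cbox 0 w)) < \<infinity>"
    by (auto simp: ennreal_mult_less_top emeasure_lborel_cbox_eq)
  finally show ?thesis
    using measurable_fourier_transforms(1)[OF ti] by (intro integrableI_bounded) auto
qed

text \<open>Take the inverse transform of the tent; it is integrable, so the inversion theorem
  applies.\<close>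

lemma exists_fourier_eq_tent:
  fixes c w :: "'a::euclidean_space"
  assumes w: "\<And>b. b \<in> Basis \<Longrightarrow> w \<bullet> b > 0"
  obtains f where "integrable lborel f" "\<And>\<xi>. fourier f \<xi> = complex_of_real (tent c w \<xi>)"
proof -
  let ?F = "\<lambda>\<xi>. complex_of_real (tent c w \<xi>)"
  have "fourier (inv_fourier ?F) \<xi> = ?F \<xi>" for \<xi>
  proof (rule fourier_inv_fourier)
    show "norm (?F \<xi>) \<le> (\<Prod>b\<in>Basis. w \<bullet> b)" for \<xi>
      using tent_le[OF w] tent_nonneg[of c w \<xi>] by simp
  qed (use integrable_tent[of c w] integrable_inv_fourier_tent[OF w] in \<open>auto intro!: continuous_intros\<close>)
  then show ?thesis using that integrable_inv_fourier_tent[OF w] by blast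
qed

subsection \<open>Nearly parallel frequencies\<close>

text \<open>The right-hand side equals 2 (phi_s(|eta|) phi_s(|zeta|) - s^2 - eta . zeta). The
  product of the energies is at least s^2 + |eta| |zeta|, and the opposite signs in direction
  \<open>e\<close> keep eta . zeta at least 2 below |eta| |zeta|.\<close>

lemma minkowski_diff_ge:
  fixes \<eta> \<zeta> e :: "'a::euclidean_space"
  assumes e: "e \<in> Basis" and p: "\<eta> \<bullet> e \<ge> 1" "\<zeta> \<bullet> e \<le> -1"
  shows "4 \<le> (norm (\<eta> - \<zeta>))\<^sup>2 - (kg_phi s (norm \<eta>) - kg_phi s (norm \<zeta>))\<^sup>2"
proof -
  \<comment> \<open>The reflection of \<eta> in the hyperplane orthogonal to \<open>e\<close>.
    Cauchy-Schwarz for the reflected vector gains twice the product of the \<open>e\<close>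
    components.\<close>
  define \<eta>' where "\<eta>' = \<eta> - (2 * (\<eta> \<bullet> e)) *\<^sub>R e"
  have n: "norm \<eta>' = norm \<eta>"
    using e by (simp add: norm_eq_sqrt_inner \<eta>'_def inner_diff_left inner_diff_right inner_commute algebra_simps)
  have "\<eta> \<bullet> \<zeta> - 2 * ((\<eta> \<bullet> e) * (\<zeta> \<bullet> e)) = \<eta>' \<bullet> \<zeta>"
    by (simp add: \<eta>'_def inner_diff_left inner_commute[of e \<zeta>])
  also have "\<dots> \<le> norm \<eta> * norm \<zeta>" using norm_cauchy_schwarz[of \<eta>' \<zeta>] n by simp
  finally have 1: "\<eta> \<bullet> \<zeta> - 2 * ((\<eta> \<bullet> e) * (\<zeta> \<bullet> e)) \<le> norm \<eta> * norm \<zeta>" .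
  have "1 * 1 \<le> (\<eta> \<bullet> e) * (- (\<zeta> \<bullet> e))" using p by (intro mult_mono) auto
  then have 2: "(\<eta> \<bullet> e) * (\<zeta> \<bullet> e) \<le> -1" by simp
  have "(s\<^sup>2 + norm \<eta> * norm \<zeta>)\<^sup>2 \<le> (kg_phi s (norm \<eta>) * kg_phi s (norm \<zeta>))\<^sup>2"
    unfolding power_mult_distrib kg_phi_sq using zero_le_power2[of "s * norm \<eta> - s * norm \<zeta>"]
    by (simp add: power2_eq_square algebra_simps)
  then have 3: "s\<^sup>2 + norm \<eta> * norm \<zeta> \<le> kg_phi s (norm \<eta>) * kg_phi s (norm \<zeta>)"
    by (rule power2_le_imp_le) (simp add: kg_phi_def)
  have "(norm (\<eta> - \<zeta>))\<^sup>2 - (kg_phi s (norm \<eta>) - kg_phi s (norm \<zeta>))\<^sup>2 =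
     2 * (kg_phi s (norm \<eta>) * kg_phi s (norm \<zeta>) - s\<^sup>2 - \<eta> \<bullet> \<zeta>)"
    using kg_phi_sq[of s "norm \<eta>"] kg_phi_sq[of s "norm \<zeta>"]
    by (simp add: power2_diff power2_norm_eq_inner inner_diff_left inner_diff_right inner_commute)
  moreover have "4 \<le> x" if "i - 2 * q \<le> n" "q \<le> -1" "t + n \<le> k" "x = 2 * (k - t - i)" for i q n t k x :: real
    using that by simp
  ultimately show ?thesis using 1 2 3 by blast
qed

text \<open>Write p for the energy and x for the component along \<open>e\<close>. As p^2 - x^2 = (p
  - x)(p + x), a bounded left-hand side and p + x >= L leave p - x of order 1/L. This is the origin
  of the thickness of the shell.\<close>

lemma kg_phi_close:
  fixes \<eta> e :: "'a::euclidean_space"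
  assumes x: "\<eta> \<bullet> e \<ge> 2 * L" and L: "L > 0" and K: "s\<^sup>2 + (norm \<eta>)\<^sup>2 - (\<eta> \<bullet> e)\<^sup>2 \<le> K" and K0: "0 \<le> s\<^sup>2 + (norm \<eta>)\<^sup>2 - (\<eta> \<bullet> e)\<^sup>2"
  shows "0 \<le> kg_phi s (norm \<eta>) - \<eta> \<bullet> e" "kg_phi s (norm \<eta>) - \<eta> \<bullet> e \<le> K / L"
proof -
  let ?p = "kg_phi s (norm \<eta>)" and ?x = "\<eta> \<bullet> e"
  have px: "?x \<le> ?p"
  proof (rule power2_le_imp_le)
    show "?x\<^sup>2 \<le> ?p\<^sup>2" unfolding kg_phi_sq using K0 by simp
  qed (simp add: kg_phi_def)
  then show "0 \<le> ?p - ?x" by simp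
  have "(?p - ?x) * L \<le> (?p - ?x) * (?p + ?x)" using px x L by (intro mult_left_mono) linarith+
  also have "\<dots> = s\<^sup>2 + (norm \<eta>)\<^sup>2 - ?x\<^sup>2"
    using kg_phi_sq[of s "norm \<eta>"] by (simp add: algebra_simps power2_eq_square)
  also have "\<dots> \<le> K" by (rule K)
  finally show "?p - ?x \<le> K / L" using L by (simp add: pos_le_divide_eq)
qed

lemma norm_sq_minus_component_le:
  fixes \<eta> e :: "'a::euclidean_space" and B :: real
  assumes e: "e \<in> Basis" and B: "\<And>b. b \<in> Basis \<Longrightarrow> b \<noteq> e \<Longrightarrow> \<bar>\<eta> \<bullet> b\<bar> \<le> B" and B0: "B \<ge> 0"
  shows "(norm \<eta>)\<^sup>2 - (\<eta> \<bullet> e)\<^sup>2 \<le> DIM('a) * B\<^sup>2" "0 \<le> (norm \<eta>)\<^sup>2 - (\<eta> \<bullet> e)\<^sup>2"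
proof -
  have "(norm \<eta>)\<^sup>2 = (\<Sum>b\<in>Basis. (\<eta> \<bullet> b)\<^sup>2)"
    by (subst power2_norm_eq_inner, subst euclidean_inner) (simp add: power2_eq_square)
  then have eq: "(norm \<eta>)\<^sup>2 - (\<eta> \<bullet> e)\<^sup>2 = (\<Sum>b\<in>Basis - {e}. (\<eta> \<bullet> b)\<^sup>2)"
    using e by (simp add: sum.remove[of Basis e])
  have "(\<Sum>b\<in>Basis - {e}. (\<eta> \<bullet> b)\<^sup>2) \<le> (\<Sum>b\<in>Basis - {e}. B\<^sup>2)"
    using B B0 by (intro sum_mono) (auto simp: abs_le_square_iff[symmetric])
  also have "\<dots> \<le> DIM('a) * B\<^sup>2"
    by (simp only: sum_constant) (intro mult_right_mono of_nat_mono card_Diff1_le zero_le_power2)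
  finally show "(norm \<eta>)\<^sup>2 - (\<eta> \<bullet> e)\<^sup>2 \<le> DIM('a) * B\<^sup>2" unfolding eq .
  show "0 \<le> (norm \<eta>)\<^sup>2 - (\<eta> \<bullet> e)\<^sup>2" unfolding eq by (rule sum_nonneg) simp
qed

text \<open>A power is monotone in one direction or the other according to the sign of its exponent,
  so its extremes are the end values. It is applied to the exponents \<beta> and \<alpha> of the
  main result, neither of which has a fixed sign.\<close>

lemma powr_sq_between:
  fixes y a b \<beta> :: real
  assumes "0 < a" "a \<le> y" "y \<le> b"
  shows "min ((a powr \<beta>)\<^sup>2) ((b powr \<beta>)\<^sup>2) \<le> (y powr \<beta>)\<^sup>2" "y powr \<beta> \<le> max (a powr \<beta>) (b powr \<beta>)"
proof -
  have "a powr \<beta> \<le> y powr \<beta> \<and> y powr \<beta> \<le> b powr \<beta> \<or> b powr \<beta> \<le> y powr \<beta> \<and> y powr \<beta> \<le> a powr \<beta>"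
  proof (cases "\<beta> \<ge> 0")
    case True
    then show ?thesis using assms by (intro disjI1 conjI powr_mono2) auto
  next
    case False
    then show ?thesis using assms by (intro disjI2 conjI powr_mono2') auto
  qed
  then show "min ((a powr \<beta>)\<^sup>2) ((b powr \<beta>)\<^sup>2) \<le> (y powr \<beta>)\<^sup>2" "y powr \<beta> \<le> max (a powr \<beta>) (b powr \<beta>)"
    by (auto simp: min_le_iff_disj le_max_iff_disj intro: power_mono)
qed

section \<open>Boxes, shells and planks elongated in one direction\<close>

lemma box_aspect:
  fixes e :: "'a::euclidean_space"
  assumes e: "e \<in> Basis" and b: "b \<in> Basis"
  shows "(r *\<^sub>R One + (l - r) *\<^sub>R e) \<bullet> b = (if b = e then l else r)"
  using assms by (simp add: inner_add_left inner_Basis)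

lemma prod_box_aspect:
  fixes e :: "'a::euclidean_space" and l r :: real
  assumes e: "e \<in> Basis"
  shows "(\<Prod>b\<in>Basis. if b = e then l else r) = l * r ^ (DIM('a) - 1)"
proof -
  have "(\<Prod>b\<in>Basis. if b = e then l else r) = l * (\<Prod>b\<in>Basis - {e}. if b = e then l else r)"
    using e by (subst prod.remove[of Basis e]) auto
  also have "(\<Prod>b\<in>Basis - {e}. if b = e then l else r) = (\<Prod>b\<in>Basis - {e}. r)"
    by (intro prod.cong) auto
  finally show ?thesis using e by (simp add: card_Diff_singleton)
qed

text \<open>The box has half side length \<open>2 L\<close> in direction \<open>e\<close> and \<open>6\<close> in all others, so that the factors \<open>L\<close> and \<open>1 / L\<close>
  cancel in the volume.\<close>

definition thin_shell :: "real \<Rightarrow> real \<Rightarrow> real \<Rightarrow> 'a::euclidean_space \<Rightarrow> (real \<times> 'a) set" where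
  "thin_shell K C L e = {(\<tau>, \<xi>). \<bar>\<tau> - \<xi> \<bullet> e\<bar> \<le> K / L \<and> \<xi> \<in> cbox (- (6 *\<^sub>R One + (2 * L - 6) *\<^sub>R e)) (6 *\<^sub>R One + (2 * L - 6) *\<^sub>R e) \<and>
     4 \<le> (norm \<xi>)\<^sup>2 - \<tau>\<^sup>2 \<and> (norm \<xi>)\<^sup>2 - \<tau>\<^sup>2 \<le> C}"

lemma closed_thin_shell: "closed (thin_shell K C L e)"
proof -
  have "thin_shell K C L e = {p. \<bar>fst p - snd p \<bullet> e\<bar> \<le> K / L} \<inter> snd -` cbox (- (6 *\<^sub>R One + (2 * L - 6) *\<^sub>R e)) (6 *\<^sub>R One + (2 * L - 6) *\<^sub>R e) \<inter>
     {p. 4 \<le> (norm (snd p))\<^sup>2 - (fst p)\<^sup>2} \<inter> {p. (norm (snd p))\<^sup>2 - (fst p)\<^sup>2 \<le> C}"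
    by (auto simp: thin_shell_def)
  also have "closed \<dots>"
    by (intro closed_Int closed_Collect_le closed_vimage continuous_intros closed_cbox)
  finally show ?thesis .
qed

lemma emeasure_thin_shell_le:
  fixes e :: "'a::euclidean_space"
  assumes e: "e \<in> Basis" and L: "L > 0" and K: "K \<ge> 0"
  shows "emeasure lborel (thin_shell K C L e) \<le> ennreal (8 * K * 12 ^ (DIM('a) - 1))"
proof -
  let ?r = "6 *\<^sub>R One + (2 * L - 6) *\<^sub>R e :: 'a"
  have m: "thin_shell K C L e \<in> sets borel" by (rule borel_closed[OF closed_thin_shell])
  have vol: "emeasure lborel (cbox (- ?r) ?r) = ennreal ((4 * L) * 12 ^ (DIM('a) - 1))"
  proof -
    have le: "- ?r \<bullet> b \<le> ?r \<bullet> b" if "b \<in> Basis" for b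
      unfolding inner_minus_left box_aspect[OF e that] using L by simp
    have "(\<Prod>b\<in>Basis. (?r - - ?r) \<bullet> b) = (\<Prod>b\<in>Basis. if b = e then 4 * L else 12)"
    proof (intro prod.cong refl)
      fix b :: 'a assume "b \<in> Basis"
      then show "(?r - - ?r) \<bullet> b = (if b = e then 4 * L else 12)"
        unfolding inner_diff_left inner_minus_left box_aspect[OF e \<open>b \<in> Basis\<close>] by simp
    qed
    then show ?thesis using le unfolding emeasure_lborel_cbox_eq prod_box_aspect[OF e] by simp
  qed
  \<comment> \<open>Slice by \<xi>: an energy interval of length 2K/L over a box of volume 4L times
    12^(d-1).\<close>
  have "emeasure lborel (thin_shell K C L e) = emeasure (lborel \<Otimes>\<^sub>M lborel) (thin_shell K C L e)"
    by (simp add: lborel_prod)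
  also have "\<dots> = (\<integral>\<^sup>+\<xi>. emeasure lborel ((\<lambda>\<tau>. (\<tau>, \<xi>)) -` thin_shell K C L e) \<partial>lborel)"
    by (rule lborel_pair.emeasure_pair_measure_alt2) (unfold lborel_prod, simp add: m)
  also have "\<dots> \<le> (\<integral>\<^sup>+\<xi>. ennreal (2 * K / L) * indicator (cbox (- ?r) ?r) \<xi> \<partial>lborel)"
  proof (rule nn_integral_mono)
    fix \<xi> :: 'a
    show "emeasure lborel ((\<lambda>\<tau>. (\<tau>, \<xi>)) -` thin_shell K C L e) \<le> ennreal (2 * K / L) * indicator (cbox (- ?r) ?r) \<xi>"
    proof (cases "\<xi> \<in> cbox (- ?r) ?r")
      case True
      have "emeasure lborel ((\<lambda>\<tau>. (\<tau>, \<xi>)) -` thin_shell K C L e) \<le> emeasure lborel {\<xi> \<bullet> e - K / L .. \<xi> \<bullet> e + K / L}"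
        by (intro emeasure_mono) (auto simp: thin_shell_def abs_le_iff)
      also have "\<dots> = ennreal (2 * K / L)" using L K by (subst emeasure_lborel_Icc) auto
      finally show ?thesis using True by simp
    next
      case False
      then have "(\<lambda>\<tau>. (\<tau>, \<xi>)) -` thin_shell K C L e = {}" by (auto simp: thin_shell_def)
      then show ?thesis by simp
    qed
  qed
  also have "\<dots> = ennreal (2 * K / L) * emeasure lborel (cbox (- ?r) ?r)"
    by (rule nn_integral_cmult_indicator) simp
  also have "\<dots> = ennreal ((2 * K / L) * ((4 * L) * 12 ^ (DIM('a) - 1)))"
    unfolding vol using L K by (intro ennreal_mult[symmetric]) auto
  also have "(2 * K / L) * ((4 * L) * 12 ^ (DIM('a) - 1)) = 8 * K * 12 ^ (DIM('a) - 1)"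
    using L by simp
  finally show ?thesis .
qed

text \<open>A region containing both tents: the component along \<open>e\<close> lies within L of
  3L, and a transverse one is at most 2 + 1 = 3 in modulus.\<close>

definition plank :: "real \<Rightarrow> 'a \<Rightarrow> 'a::euclidean_space set" where
  "plank L e = {\<eta>. 2 * L \<le> \<eta> \<bullet> e \<and> \<eta> \<bullet> e \<le> 4 * L \<and> (\<forall>b\<in>Basis - {e}. \<bar>\<eta> \<bullet> b\<bar> \<le> 3)}"

text \<open>Each transverse component contributes at most 9 to the squared norm, which explains K.
  The last bound adds K / L <= K L, from L >= 1, to the component along \<open>e\<close>.\<close>

lemma kg_phi_plank:
  fixes K L s :: real and e :: "'a::euclidean_space"
  assumes e: "e \<in> Basis" and \<eta>: "\<eta> \<in> plank L e" and L: "L \<ge> 1" and K: "K = s\<^sup>2 + real DIM('a) * 9"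
  shows "0 \<le> kg_phi s (norm \<eta>) - \<eta> \<bullet> e" "kg_phi s (norm \<eta>) - \<eta> \<bullet> e \<le> K / L"
    "2 * L \<le> kg_phi s (norm \<eta>)" "kg_phi s (norm \<eta>) \<le> (4 + K) * L"
proof -
  have "(norm \<eta>)\<^sup>2 - (\<eta> \<bullet> e)\<^sup>2 \<le> real DIM('a) * 3\<^sup>2" "0 \<le> (norm \<eta>)\<^sup>2 - (\<eta> \<bullet> e)\<^sup>2"
    using \<eta> by (intro norm_sq_minus_component_le[OF e, of \<eta> 3]; auto simp: plank_def)+
  then have 1: "s\<^sup>2 + (norm \<eta>)\<^sup>2 - (\<eta> \<bullet> e)\<^sup>2 \<le> K" "0 \<le> s\<^sup>2 + (norm \<eta>)\<^sup>2 - (\<eta> \<bullet> e)\<^sup>2"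
  proof -
    have g: "q + n - x \<le> q + d * 9" "0 \<le> q + n - x" if "n - x \<le> d * 3\<^sup>2" "0 \<le> n - x" "0 \<le> q" for d n q x :: real
      using that by simp_all
    assume a: "(norm \<eta>)\<^sup>2 - (\<eta> \<bullet> e)\<^sup>2 \<le> real DIM('a) * 3\<^sup>2" "0 \<le> (norm \<eta>)\<^sup>2 - (\<eta> \<bullet> e)\<^sup>2"
    show "s\<^sup>2 + (norm \<eta>)\<^sup>2 - (\<eta> \<bullet> e)\<^sup>2 \<le> K" unfolding K by (rule g(1)[OF a zero_le_power2])
    show "0 \<le> s\<^sup>2 + (norm \<eta>)\<^sup>2 - (\<eta> \<bullet> e)\<^sup>2" by (rule g(2)[OF a zero_le_power2])
  qed
  have L0: "L > 0" using L by simp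
  have x: "2 * L \<le> \<eta> \<bullet> e" "\<eta> \<bullet> e \<le> 4 * L" using \<eta> by (auto simp: plank_def)
  note 2 = kg_phi_close[OF x(1) L0 1]
  show "0 \<le> kg_phi s (norm \<eta>) - \<eta> \<bullet> e" "kg_phi s (norm \<eta>) - \<eta> \<bullet> e \<le> K / L" by (rule 2)+
  then show "2 * L \<le> kg_phi s (norm \<eta>)" using x by linarith
  have K0: "K \<ge> 0" by (simp add: K)
  have "K / L \<le> K / 1" using K0 L by (intro divide_left_mono) auto
  also have "\<dots> \<le> K * L" using mult_left_mono[OF L K0] by simp
  finally show "kg_phi s (norm \<eta>) \<le> (4 + K) * L" using x 2 by (simp add: algebra_simps)
qed

text \<open>Subtracting two points of the plank doubles the transverse bound 3 to 6 and leaves at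
  most 2L along \<open>e1\<close>. In the upper bound on the form, (xi . e1)^2 - tau^2 splits into a
  factor of size at most K / L and one of size at most (4 + K) L; the transverse part adds at most
  36 d.\<close>

lemma momentum_diff_in_thin_shell:
  fixes K L s :: real and e1 e2 :: "'a::euclidean_space"
  assumes e: "e1 \<in> Basis" "e2 \<in> Basis"
    and \<eta>: "\<eta> \<in> plank L e1" and \<zeta>: "\<zeta> \<in> plank L e1" and p: "\<eta> \<bullet> e2 \<ge> 1" "\<zeta> \<bullet> e2 \<le> -1"
    and L: "L \<ge> 1" and K: "K = s\<^sup>2 + real DIM('a) * 9"
  shows "momentum_diff s (\<eta>, \<zeta>) \<in> thin_shell K (K * (4 + K) + real DIM('a) * 36) L e1"
proof -
  define \<tau> \<xi> where "\<tau> = kg_phi s (norm \<eta>) - kg_phi s (norm \<zeta>)" and "\<xi> = \<eta> - \<zeta>"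
  have K0: "K \<ge> 0" by (simp add: K)
  note a = kg_phi_plank[OF e(1) \<eta> L K] and b = kg_phi_plank[OF e(1) \<zeta> L K]
  have \<xi>1: "\<xi> \<bullet> e1 = \<eta> \<bullet> e1 - \<zeta> \<bullet> e1" by (simp add: \<xi>_def inner_diff_left)
  have 1: "\<bar>\<tau> - \<xi> \<bullet> e1\<bar> \<le> K / L"
    using a(1,2) b(1,2) unfolding \<tau>_def \<xi>1 by linarith
  have 2: "\<bar>\<xi> \<bullet> e1\<bar> \<le> 2 * L" using \<eta> \<zeta> unfolding \<xi>1 plank_def by auto
  have 3: "\<bar>\<xi> \<bullet> b\<bar> \<le> 6" if "b \<in> Basis" "b \<noteq> e1" for b
  proof -
    have "\<bar>\<eta> \<bullet> b\<bar> \<le> 3" "\<bar>\<zeta> \<bullet> b\<bar> \<le> 3" using \<eta> \<zeta> that by (auto simp: plank_def)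
    then show ?thesis unfolding \<xi>_def inner_diff_left by linarith
  qed
  have 4: "\<xi> \<in> cbox (- (6 *\<^sub>R One + (2 * L - 6) *\<^sub>R e1)) (6 *\<^sub>R One + (2 * L - 6) *\<^sub>R e1)"
    unfolding mem_box
  proof
    fix b :: 'a assume b: "b \<in> Basis"
    have "\<bar>\<xi> \<bullet> b\<bar> \<le> (if b = e1 then 2 * L else 6)"
      using 2 3[OF b] by (cases "b = e1") (simp_all only: if_True if_False refl not_False_eq_True)
    then show "- (6 *\<^sub>R One + (2 * L - 6) *\<^sub>R e1) \<bullet> b \<le> \<xi> \<bullet> b \<and> \<xi> \<bullet> b \<le> (6 *\<^sub>R One + (2 * L - 6) *\<^sub>R e1) \<bullet> b"
      unfolding inner_minus_left box_aspect[OF e(1) b] by linarith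
  qed
  have 5: "4 \<le> (norm \<xi>)\<^sup>2 - \<tau>\<^sup>2" unfolding \<xi>_def \<tau>_def by (rule minkowski_diff_ge[OF e(2) p])
  have KL: "K / L \<le> K * L" "K / L \<ge> 0"
  proof -
    have "K / L \<le> K / 1" using K0 L by (intro divide_left_mono) auto
    also have "\<dots> \<le> K * L" using mult_left_mono[OF L K0] by simp
    finally show "K / L \<le> K * L" .
    show "K / L \<ge> 0" using K0 L by simp
  qed
  have "(\<xi> \<bullet> e1)\<^sup>2 - \<tau>\<^sup>2 = (\<xi> \<bullet> e1 - \<tau>) * (\<xi> \<bullet> e1 + \<tau>)" by (simp add: power2_eq_square algebra_simps)
  also have "\<dots> \<le> \<bar>\<xi> \<bullet> e1 - \<tau>\<bar> * \<bar>\<xi> \<bullet> e1 + \<tau>\<bar>" unfolding abs_mult[symmetric] by (rule abs_ge_self)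
  also have "\<dots> \<le> (K / L) * (4 * L + K * L)"
  proof (rule mult_mono)
    show "\<bar>\<xi> \<bullet> e1 - \<tau>\<bar> \<le> K / L" using 1 by linarith
    show "\<bar>\<xi> \<bullet> e1 + \<tau>\<bar> \<le> 4 * L + K * L" using 1 2 KL by linarith
  qed (use KL in auto)
  also have "\<dots> = K * (4 + K)" using L by (simp add: field_simps)
  finally have "(\<xi> \<bullet> e1)\<^sup>2 - \<tau>\<^sup>2 \<le> K * (4 + K)" .
  moreover have "(norm \<xi>)\<^sup>2 - (\<xi> \<bullet> e1)\<^sup>2 \<le> real DIM('a) * 6\<^sup>2"
    by (rule norm_sq_minus_component_le(1)[OF e(1)]) (auto intro: 3)
  moreover have "n - t \<le> a + d * 36" if "x - t \<le> a" "n - x \<le> d * 6\<^sup>2" for a d n t x :: real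
    using that by simp
  ultimately have 6: "(norm \<xi>)\<^sup>2 - \<tau>\<^sup>2 \<le> K * (4 + K) + real DIM('a) * 36" by blast
  have md: "momentum_diff s (\<eta>, \<zeta>) = (\<tau>, \<xi>)" by (simp add: momentum_diff_def \<tau>_def \<xi>_def)
  show ?thesis unfolding md thin_shell_def mem_Collect_eq prod.case using 1 4 5 6 by (intro conjI)
qed

text \<open>The sign \<sigma> treats both tents at once: centre 2\<sigma> and half-width 1 in
  direction \<open>e2\<close> keep that component at distance at least 1 from 0, on the side of
  \<sigma>.\<close>

lemma tent_supp_plank:
  fixes e1 e2 :: "'a::euclidean_space"
  assumes e: "e1 \<in> Basis" "e2 \<in> Basis" "e1 \<noteq> e2" and L: "L \<ge> 1" and \<sigma>: "\<bar>\<sigma>\<bar> = 1"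
    and t: "tent ((3 * L) *\<^sub>R e1 + (2 * \<sigma>) *\<^sub>R e2) (1 *\<^sub>R One + (L - 1) *\<^sub>R e1) \<xi> \<noteq> 0"
  shows "\<xi> \<in> plank L e1" "\<sigma> * (\<xi> \<bullet> e2) \<ge> 1"
proof -
  let ?c = "(3 * L) *\<^sub>R e1 + (2 * \<sigma>) *\<^sub>R e2"
  have s: "\<bar>\<xi> \<bullet> b - ?c \<bullet> b\<bar> < (if b = e1 then L else 1)" if "b \<in> Basis" for b
    using tent_supp[OF t that] unfolding inner_diff_left box_aspect[OF e(1) that] .
  have c: "?c \<bullet> b = (if b = e1 then 3 * L else if b = e2 then 2 * \<sigma> else 0)" if "b \<in> Basis" for b
    using e that by (auto simp: inner_add_left inner_Basis)
  have s1: "\<bar>\<xi> \<bullet> e1 - 3 * L\<bar> < L" using s[OF e(1)] c[OF e(1)] by simp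
  have s2: "\<bar>\<xi> \<bullet> e2 - 2 * \<sigma>\<bar> < 1" using s[OF e(2)] c[OF e(2)] e(3) by simp
  have s3: "\<bar>\<xi> \<bullet> b\<bar> \<le> 3" if "b \<in> Basis - {e1}" for b
    using s[of b] c[of b] that s2 \<sigma> by (cases "b = e2") auto
  show "\<xi> \<in> plank L e1" using s1 s3 by (auto simp: plank_def)
  show "\<sigma> * (\<xi> \<bullet> e2) \<ge> 1" using s2 \<sigma> by (auto simp: abs_if split: if_splits)
qed

section \<open>Norms of the data and the choice of L\<close>

lemma distr_of_in_sobolev:
  fixes f :: "'a::euclidean_space \<Rightarrow> complex"
  assumes f: "integrable lborel f" and F: "\<And>\<xi>. fourier f \<xi> = complex_of_real (tent c w \<xi>)"
    and w: "\<And>b. b \<in> Basis \<Longrightarrow> w \<bullet> b > 0" and \<alpha>: "\<alpha> \<le> 1"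
  shows "distr_of f \<in> sobolev \<alpha>"
proof -
  obtain R where R: "\<And>\<xi>. \<xi> \<in> cbox (c - w) (c + w) \<Longrightarrow> norm \<xi> \<le> R"
    using bounded_cbox[of "c - w" "c + w"] by (auto simp: bounded_iff)
  have supp: "norm \<xi> \<le> R" if "tent c w \<xi> \<noteq> 0" for \<xi> using R tent_supp_cbox[OF that] by blast
  have "L2_norm_sq (kg_phi_pow 1 \<alpha> (distr_of f)) \<le> ennreal (1 / (2 * pi) ^ DIM('a)) *
     (\<integral>\<^sup>+\<xi>. ennreal ((kg_phi 1 (norm \<xi>) powr \<alpha> * norm (fourier f \<xi>))\<^sup>2) \<partial>lborel)"
    by (rule L2_norm_sq_kg_phi_pow_le[OF f _ \<alpha>, of 1 R]) (use supp F in force)+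
  also have "\<dots> = ennreal (1 / (2 * pi) ^ DIM('a)) * (\<integral>\<^sup>+\<xi>. ennreal ((kg_phi 1 (norm \<xi>) powr \<alpha> * tent c w \<xi>)\<^sup>2) \<partial>lborel)"
    by (simp only: F norm_of_real abs_of_nonneg[OF tent_nonneg])
  also have "\<dots> < \<infinity>"
  proof -
    \<comment> \<open>The constant 3 is \<open>s powr \<alpha> + s + 1\<close> at s = 1.\<close>
    have "0 \<le> kg_phi 1 (norm \<xi>) powr \<alpha> \<and> kg_phi 1 (norm \<xi>) powr \<alpha> \<le> 3 * (1 + R)" if "tent c w \<xi> \<noteq> 0" for \<xi>
      using kg_phi_powr_le[of 1 \<alpha> "norm \<xi>"] \<alpha> supp[OF that] by auto
    note le_less_trans[OF nn_integral_tent_le[OF w, where \<psi> = "\<lambda>\<xi>. kg_phi 1 (norm \<xi>) powr \<alpha>"] ennreal_less_top, OF _ this]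
    then show ?thesis
      unfolding infinity_ennreal_def ennreal_mult_less_top by (simp only: ennreal_less_top simp_thms)
  qed
  finally show ?thesis using tempered_distr_of[OF f] by (simp add: sobolev_def)
qed

text \<open>On the plank phi_s is comparable to L, so its power is comparable to L^\<alpha> for
  either sign of \<alpha>. The squared height L^2 and a volume of order L supply the factor
  L^3.\<close>

lemma L2_norm_sq_plank_le:
  fixes f :: "'a::euclidean_space \<Rightarrow> complex" and K L s \<alpha> :: real
  assumes f: "integrable lborel f" and F: "\<And>\<xi>. fourier f \<xi> = complex_of_real (tent c w \<xi>)"
    and w: "\<And>b. b \<in> Basis \<Longrightarrow> w \<bullet> b > 0" "(\<Prod>b\<in>Basis. w \<bullet> b) = L"
    and s: "s > 0" and \<alpha>: "\<alpha> \<le> 1" and e: "e \<in> Basis" and L: "L \<ge> 1" and K: "K = s\<^sup>2 + real DIM('a) * 9"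
    and supp: "\<And>\<xi>. tent c w \<xi> \<noteq> 0 \<Longrightarrow> \<xi> \<in> plank L e"
  shows "L2_norm_sq (kg_phi_pow s \<alpha> (distr_of f)) \<le>
    ennreal ((max (2 powr \<alpha>) ((4 + K) powr \<alpha>))\<^sup>2 * 2 ^ DIM('a) / (2 * pi) ^ DIM('a) * (L powr \<alpha>)\<^sup>2 * L ^ 3)"
proof -
  define P where "P = max (2 powr \<alpha>) ((4 + K) powr \<alpha>)"
  have K0: "K \<ge> 0" by (simp add: K)
  have supp': "norm \<xi> \<le> (4 + K) * L" if "tent c w \<xi> \<noteq> 0" for \<xi>
    using kg_phi_plank(4)[OF e supp[OF that] L K] kg_phi_ge[of "norm \<xi>" s] by simp
  have bd: "0 \<le> kg_phi s (norm \<xi>) powr \<alpha> \<and> kg_phi s (norm \<xi>) powr \<alpha> \<le> P * L powr \<alpha>" if "tent c w \<xi> \<noteq> 0" for \<xi>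
  proof -
    note k = kg_phi_plank(3,4)[OF e supp[OF that] L K]
    have L0: "L > 0" using L by simp
    have "kg_phi s (norm \<xi>) powr \<alpha> = (kg_phi s (norm \<xi>) / L * L) powr \<alpha>" using L0 by simp
    also have "\<dots> = (kg_phi s (norm \<xi>) / L) powr \<alpha> * L powr \<alpha>"
      using L0 kg_phi_pos[OF s] by (intro powr_mult)
    also have "\<dots> \<le> P * L powr \<alpha>"
      unfolding P_def using k L0
      by (intro mult_right_mono powr_sq_between(2)) (simp_all add: pos_le_divide_eq pos_divide_le_eq)
    finally show ?thesis by simp
  qed
  have "L2_norm_sq (kg_phi_pow s \<alpha> (distr_of f)) \<le> ennreal (1 / (2 * pi) ^ DIM('a)) *
     (\<integral>\<^sup>+\<xi>. ennreal ((kg_phi s (norm \<xi>) powr \<alpha> * norm (fourier f \<xi>))\<^sup>2) \<partial>lborel)"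
    by (rule L2_norm_sq_kg_phi_pow_le[OF f s \<alpha>, of "(4 + K) * L"]) (use supp' F in force)
  also have "\<dots> = ennreal (1 / (2 * pi) ^ DIM('a)) * (\<integral>\<^sup>+\<xi>. ennreal ((kg_phi s (norm \<xi>) powr \<alpha> * tent c w \<xi>)\<^sup>2) \<partial>lborel)"
    by (simp only: F norm_of_real abs_of_nonneg[OF tent_nonneg])
  also have "\<dots> \<le> ennreal (1 / (2 * pi) ^ DIM('a)) * ennreal ((P * L powr \<alpha> * L)\<^sup>2 * (2 ^ DIM('a) * L))"
    using nn_integral_tent_le[OF w(1) bd] unfolding w(2) by (intro mult_left_mono) auto
  also have "\<dots> = ennreal (1 / (2 * pi) ^ DIM('a) * ((P * L powr \<alpha> * L)\<^sup>2 * (2 ^ DIM('a) * L)))"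
    using L by (intro ennreal_mult[symmetric]) auto
  also have "1 / q * ((P * l * L)\<^sup>2 * (d * L)) = P\<^sup>2 * d / q * l\<^sup>2 * L ^ 3" for q l d :: real
    by (simp add: power2_eq_square power3_eq_cube)
  finally show ?thesis by (simp only: P_def)
qed

text \<open>The two sides differ by the power L^(2 - 4\<alpha>), which is unbounded in L because
  \<alpha> < 1/2.\<close>

lemma powr_gap:
  fixes A c \<alpha> :: real
  assumes "\<alpha> < 1 / 2" "c > 0"
  obtains L where "L \<ge> 1" "A * ((L powr \<alpha>)\<^sup>2 * L ^ 3)\<^sup>2 < c * L ^ 8"
proof -
  \<comment> \<open>\<open>L\<close> solves L^(2 - 4\<alpha>) = x for some x > A / c, and is raised
    to 1 if smaller.\<close>
  define x L where "x = \<bar>A / c\<bar> + 1" and "L = max 1 (x powr (1 / (2 - 4 * \<alpha>)))"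
  have "x > 0" unfolding x_def by linarith
  have "A / c < x" unfolding x_def by linarith
  also have "x = (x powr (1 / (2 - 4 * \<alpha>))) powr (2 - 4 * \<alpha>)"
    using assms(1) \<open>x > 0\<close> by (simp add: powr_powr)
  also have "\<dots> \<le> L powr (2 - 4 * \<alpha>)"
    using assms(1) by (intro powr_mono2) (auto simp: L_def)
  finally have L: "L powr (2 - 4 * \<alpha>) > A / c" "L \<ge> 1" by (auto simp: L_def)
  have L0: "L > 0" using L by simp
  have "(L powr \<alpha>) ^ 4 = (L powr \<alpha>) powr real 4" by (rule powr_realpow[symmetric]) (use L0 in simp)
  also have "\<dots> = L powr (4 * \<alpha>)" unfolding powr_powr by (simp add: mult.commute)
  finally have l4: "(L powr \<alpha>) ^ 4 = L powr (4 * \<alpha>)" .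
  have l6: "L ^ 6 = L powr 6" using powr_realpow[OF L0, of 6] by simp
  have "((L powr \<alpha>)\<^sup>2 * L ^ 3)\<^sup>2 = (L powr \<alpha>) ^ 4 * L ^ 6"
    by (simp add: power_mult_distrib flip: power_mult)
  then have e: "((L powr \<alpha>)\<^sup>2 * L ^ 3)\<^sup>2 = L powr (4 * \<alpha> + 6)"
    unfolding l4 l6 powr_add .
  have "A < c * L powr (2 - 4 * \<alpha>)" using L(1) assms(2) by (simp add: pos_divide_less_eq mult.commute)
  then have "A * L powr (4 * \<alpha> + 6) < c * L powr (2 - 4 * \<alpha>) * L powr (4 * \<alpha> + 6)"
    using L0 by (intro mult_strict_right_mono) auto
  also have "c * L powr (2 - 4 * \<alpha>) * L powr (4 * \<alpha> + 6) = c * L powr (real 8)"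
    unfolding mult.assoc powr_add[symmetric] by simp
  also have "\<dots> = c * L ^ 8" using L0 by (simp only: powr_realpow)
  finally have "A * ((L powr \<alpha>)\<^sup>2 * L ^ 3)\<^sup>2 < c * L ^ 8" unfolding e .
  then show ?thesis by (rule that[OF L(2)])
qed

theorem exists_kg_counterexample:
  fixes e1 e2 :: "'a::euclidean_space" and s \<beta> C :: real
  assumes e: "e1 \<in> Basis" "e2 \<in> Basis" "e1 \<noteq> e2" and s: "s > 0" and \<alpha>: "\<alpha> < 1 / 2" and C: "C > 0"
  obtains f g :: "'a \<Rightarrow> complex"
  where "integrable lborel f" "integrable lborel g" "integrable lborel (fourier f)" "integrable lborel (fourier g)"
    "distr_of f \<in> sobolev \<alpha>" "distr_of g \<in> sobolev \<alpha>"
    "ennreal C * L2_norm_sq (kg_phi_pow s \<alpha> (distr_of f)) * L2_norm_sq (kg_phi_pow s \<alpha> (distr_of g))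
      < box_norm_sq \<beta> (\<lambda>p. kg_solution s f p * cnj (kg_solution s g p))"
proof -
  \<comment> \<open>None of the constants up to \<open>c2\<close> depends on \<open>L\<close>, which
    is chosen only after them.\<close>
  define K where "K = s\<^sup>2 + real DIM('a) * 9"
  define C0 where "C0 = K * (4 + K) + real DIM('a) * 36"
  define \<kappa> where "\<kappa> = min ((4 powr \<beta>)\<^sup>2) ((C0 powr \<beta>)\<^sup>2)"
  define V where "V = 8 * K * 12 ^ (DIM('a) - 1)"
  define M where "M = ((2 * pi) ^ (DIM('a) + 1) / (2 * pi) ^ (2 * DIM('a)))\<^sup>2"
  define q where "q = 1 / (2 * pi) ^ (DIM('a) + 1)"
  define c1 where "c1 = q * (\<kappa> * M * (1 / (2 ^ DIM('a)) ^ 4 / V))"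
  define c2 where "c2 = (max (2 powr \<alpha>) ((4 + K) powr \<alpha>))\<^sup>2 * 2 ^ DIM('a) / (2 * pi) ^ DIM('a)"
  have K0: "K > 0" using s by (simp add: K_def add_pos_nonneg)
  have "36 \<le> real DIM('a) * 36" using DIM_positive[where 'a='a] by simp
  then have C0: "C0 > 0" using K0 unfolding C0_def by (intro add_nonneg_pos) auto
  have \<kappa>: "\<kappa> > 0" using C0 by (simp add: \<kappa>_def)
  have V: "V > 0" using K0 by (simp add: V_def)
  have Mq: "M > 0" "q > 0" unfolding M_def q_def by (intro zero_less_power divide_pos_pos; simp)+
  have c1: "c1 > 0" unfolding c1_def using \<kappa> V Mq by (intro mult_pos_pos divide_pos_pos zero_less_power) auto
  have c2: "c2 \<ge> 0" unfolding c2_def by (intro divide_nonneg_nonneg mult_nonneg_nonneg zero_le_power2 zero_le_power) auto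
  obtain L where L: "L \<ge> 1" and gap: "(C * c2\<^sup>2) * ((L powr \<alpha>)\<^sup>2 * L ^ 3)\<^sup>2 < c1 * L ^ 8"
    using powr_gap[OF \<alpha> c1] .
  have L0: "L > 0" using L by simp
  define w where "w = 1 *\<^sub>R One + (L - 1) *\<^sub>R e1"
  define c where "c \<sigma> = (3 * L) *\<^sub>R e1 + (2 * \<sigma>) *\<^sub>R e2" for \<sigma> :: real
  have w: "w \<bullet> b > 0" if "b \<in> Basis" for b
    unfolding w_def box_aspect[OF e(1) that] using L0 by simp
  have wL: "(\<Prod>b\<in>Basis. w \<bullet> b) = L"
  proof -
    have "(\<Prod>b\<in>Basis. w \<bullet> b) = (\<Prod>b\<in>Basis. if b = e1 then L else 1)"
      unfolding w_def by (intro prod.cong refl box_aspect[OF e(1)])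
    then show ?thesis by (simp add: prod_box_aspect[OF e(1)])
  qed
  obtain f where f: "integrable lborel f" "\<And>\<xi>. fourier f \<xi> = complex_of_real (tent (c 1) w \<xi>)"
    using exists_fourier_eq_tent[OF w] by blast
  obtain g where g: "integrable lborel g" "\<And>\<xi>. fourier g \<xi> = complex_of_real (tent (c (-1)) w \<xi>)"
    using exists_fourier_eq_tent[OF w] by blast
  have supp: "\<xi> \<in> plank L e1" "\<sigma> * (\<xi> \<bullet> e2) \<ge> 1" if "tent (c \<sigma>) w \<xi> \<noteq> 0" "\<bar>\<sigma>\<bar> = 1" for \<xi> \<sigma>
    using tent_supp_plank[OF e L that(2)] that(1) unfolding c_def w_def by blast+
  have suppf: "\<xi> \<in> plank L e1" "\<xi> \<bullet> e2 \<ge> 1" if "tent (c 1) w \<xi> \<noteq> 0" for \<xi>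
    using supp[OF that] by auto
  have suppg: "\<xi> \<in> plank L e1" "\<xi> \<bullet> e2 \<le> -1" if "tent (c (-1)) w \<xi> \<noteq> 0" for \<xi>
    using supp[OF that] by auto
  have Ff: "integrable lborel (fourier f)"
    unfolding f(2)[THEN ext] complex_of_real_integrable_eq by (rule integrable_tent)
  have Fg: "integrable lborel (fourier g)"
    unfolding g(2)[THEN ext] complex_of_real_integrable_eq by (rule integrable_tent)
  have \<alpha>1: "\<alpha> \<le> 1" using \<alpha> by simp
  let ?S = "thin_shell K C0 L e1"
  let ?I = "(LINT \<xi>|lborel. tent (c 1) w \<xi>) * (LINT \<xi>|lborel. tent (c (-1)) w \<xi>)"
  have lower: "ennreal (q * (\<kappa> * M * (?I\<^sup>2 / V))) \<le> box_norm_sq \<beta> (\<lambda>p. kg_solution s f p * cnj (kg_solution s g p))"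
    unfolding q_def M_def
  proof (rule box_norm_sq_kg_product_ge[OF s e(2) f(2) tent_nonneg integrable_tent g(2) tent_nonneg integrable_tent])
    show "norm \<eta> \<le> (4 + K) * L \<and> \<eta> \<bullet> e2 \<ge> 1" if "tent (c 1) w \<eta> \<noteq> 0" for \<eta>
      using kg_phi_plank(4)[OF e(1) suppf(1)[OF that] L K_def] kg_phi_ge[of "norm \<eta>" s] suppf(2)[OF that] by simp
    show "momentum_diff s (\<eta>, \<zeta>) \<in> ?S" if "tent (c 1) w \<eta> \<noteq> 0" "tent (c (-1)) w \<zeta> \<noteq> 0" for \<eta> \<zeta>
      unfolding C0_def using suppf[OF that(1)] suppg[OF that(2)]
      by (intro momentum_diff_in_thin_shell[OF e(1,2)] L K_def)
    show "emeasure lborel ?S \<le> ennreal V"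
      unfolding V_def using K0 by (intro emeasure_thin_shell_le e L0) simp
    show "\<kappa> \<le> (\<bar>\<tau>\<^sup>2 - (norm \<xi>)\<^sup>2\<bar> powr \<beta>)\<^sup>2" if "(\<tau>, \<xi>) \<in> ?S" for \<tau> \<xi>
    proof -
      have "4 \<le> (norm \<xi>)\<^sup>2 - \<tau>\<^sup>2" "(norm \<xi>)\<^sup>2 - \<tau>\<^sup>2 \<le> C0" using that by (auto simp: thin_shell_def)
      then have "4 \<le> \<bar>\<tau>\<^sup>2 - (norm \<xi>)\<^sup>2\<bar>" "\<bar>\<tau>\<^sup>2 - (norm \<xi>)\<^sup>2\<bar> \<le> C0" by (simp_all add: abs_if)
      then show ?thesis unfolding \<kappa>_def by (intro powr_sq_between) simp_all
    qed
    show "\<zeta> \<bullet> e2 \<le> -1" if "tent (c (-1)) w \<zeta> \<noteq> 0" for \<zeta> by (rule suppg(2)[OF that])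
    show "?S \<in> sets borel" by (rule borel_closed[OF closed_thin_shell])
  qed (use \<kappa> V in auto)
  \<comment> \<open>Each tent has mass at least L^2 / 2^d, because the components of
    \<open>w\<close> multiply to L; the squared product of the masses is then of order L^8.\<close>
  have I: "L\<^sup>2 / 2 ^ DIM('a) * (L\<^sup>2 / 2 ^ DIM('a)) \<le> ?I"
    using integral_tent_ge[OF w, of "c 1"] integral_tent_ge[OF w, of "c (-1)"] unfolding wL
    by (intro mult_mono integral_nonneg_AE AE_I2 tent_nonneg) auto
  have "(1 / (2 ^ DIM('a)) ^ 4) * L ^ 8 = (L\<^sup>2 / 2 ^ DIM('a) * (L\<^sup>2 / 2 ^ DIM('a)))\<^sup>2"
    by (simp add: power_mult_distrib power_divide flip: power_mult power_add)
  also have "\<dots> \<le> ?I\<^sup>2" by (rule power_mono[OF I]) simp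
  finally have I2: "(1 / (2 ^ DIM('a)) ^ 4) * L ^ 8 \<le> ?I\<^sup>2" .
  have "c1 * L ^ 8 = q * (\<kappa> * M * ((1 / (2 ^ DIM('a)) ^ 4) * L ^ 8 / V))"
    unfolding c1_def by (simp only: mult_ac times_divide_eq_left times_divide_eq_right)
  also have "\<dots> \<le> q * (\<kappa> * M * (?I\<^sup>2 / V))"
    using \<kappa> V Mq by (intro mult_left_mono divide_right_mono I2 mult_nonneg_nonneg less_imp_le)
  finally have low: "c1 * L ^ 8 \<le> q * (\<kappa> * M * (?I\<^sup>2 / V))" .
  let ?u = "c2 * (L powr \<alpha>)\<^sup>2 * L ^ 3"
  have u0: "?u \<ge> 0" using c2 L0 by (intro mult_nonneg_nonneg) auto
  have upf: "L2_norm_sq (kg_phi_pow s \<alpha> (distr_of f)) \<le> ennreal ?u"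
    unfolding c2_def by (rule L2_norm_sq_plank_le[OF f w wL s \<alpha>1 e(1) L K_def suppf(1)])
  have upg: "L2_norm_sq (kg_phi_pow s \<alpha> (distr_of g)) \<le> ennreal ?u"
    unfolding c2_def by (rule L2_norm_sq_plank_le[OF g w wL s \<alpha>1 e(1) L K_def suppg(1)])
  have "ennreal C * L2_norm_sq (kg_phi_pow s \<alpha> (distr_of f)) * L2_norm_sq (kg_phi_pow s \<alpha> (distr_of g)) \<le> ennreal C * ennreal ?u * ennreal ?u"
    by (intro mult_mono upf upg order_refl) auto
  also have "\<dots> = ennreal (C * ?u * ?u)"
    using C u0 by (simp only: ennreal_mult mult_nonneg_nonneg less_imp_le)
  also have "C * ?u * ?u = (C * c2\<^sup>2) * ((L powr \<alpha>)\<^sup>2 * L ^ 3)\<^sup>2"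
    by (simp only: power2_eq_square mult_ac)
  also have "ennreal \<dots> < ennreal (c1 * L ^ 8)"
    using gap c1 L0 by (intro ennreal_lessI) auto
  also have "\<dots> \<le> ennreal (q * (\<kappa> * M * (?I\<^sup>2 / V)))" by (rule ennreal_leI[OF low])
  also note lower
  finally have main: "ennreal C * L2_norm_sq (kg_phi_pow s \<alpha> (distr_of f)) * L2_norm_sq (kg_phi_pow s \<alpha> (distr_of g))
      < box_norm_sq \<beta> (\<lambda>p. kg_solution s f p * cnj (kg_solution s g p))" .
  show ?thesis
    by (rule that[OF f(1) g(1) Ff Fg distr_of_in_sobolev[OF f w \<alpha>1] distr_of_in_sobolev[OF g w \<alpha>1] main])
qed

theorem proposition3p4:
  fixes s \<beta> C :: real
  assumes "CARD('n::finite) \<ge> 2" and "s > 0" and "\<beta> < (3 - real CARD('n)) / 4" and "C > 0"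
  shows "\<exists>f g :: (real ^ 'n) distribution. \<exists>u v :: real \<times> (real ^ 'n) \<Rightarrow> complex.
    f \<in> sobolev ((real CARD('n) - 1) / 4 + \<beta>) \<and>
    g \<in> sobolev ((real CARD('n) - 1) / 4 + \<beta>) \<and>
    kg_wave s f u \<and> kg_wave s g v \<and>
    box_norm_sq \<beta> (\<lambda>p. u p * cnj (v p)) >
      ennreal C * L2_norm_sq (kg_phi_pow s ((real CARD('n) - 1) / 4 + \<beta>) f)
                * L2_norm_sq (kg_phi_pow s ((real CARD('n) - 1) / 4 + \<beta>) g)"
proof -
  \<comment> \<open>Equivalent to the hypothesis on \<beta>: the threshold below which L^(6 +
    4\<alpha>) is of smaller order than L^8.\<close>
  have \<alpha>: "(real CARD('n) - 1) / 4 + \<beta> < 1 / 2" using assms(3) by (simp add: field_simps)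
  \<comment> \<open>Here the dimension enters: \<open>i\<close> gives the common direction of the
    waves, \<open>j\<close> the direction that separates them.\<close>
  obtain i j :: 'n where "i \<noteq> j"
    using assms(1) ex_card[of 2 "UNIV :: 'n set"] by (auto simp: card_2_iff)
  then have e: "axis i 1 \<in> (Basis :: (real ^ 'n) set)" "axis j 1 \<in> (Basis :: (real ^ 'n) set)" "axis i (1::real) \<noteq> axis j 1"
    by (auto simp: axis_eq_axis)
  show ?thesis
    by (rule exists_kg_counterexample[OF e assms(2) \<alpha> assms(4), of \<beta>])
       (blast intro: kg_wave_kg_solution)
qed

end
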